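(* Let $\tau$ be in the limit circle case at both $a$ and $b$, with boundary condition bases $\{\phi_a,\psi_a\}$ at $a$ and $\{\phi_b,\psi_b\}$ at $b$, and let $T_{\alpha,\beta}$ and $u_{z,1},u_{z,2}$ be as in the context. The following statements hold. (i) If $\beta\in(0,\pi)$, then the maximal common part of $T_{0,0}$ and $T_{0,\beta}$ is the restriction of $T_{\max}$ to the set $$\mathcal S_1=\{y\in\operatorname{dom}(T_{\max}): [y,\phi_a](a)=[y,\phi_b](b)=[y,\psi_b](b)=0\}.$$ Moreover, for each $z\in\rho(T_{0,0})\cap\rho(T_{0,\beta})$ the scalar $K_{0,\beta}(z)=-\cot(\beta)-[u_{z,1},\psi_b](b)$ is nonzero and $$(T_{0,\beta}-zI)^{-1}=(T_{0,0}-zI)^{-1}+K_{0,\beta}(z)^{-1}\langle u_{\overline z,1},\,\cdot\,\rangle\,u_{z,1}.$$ (ii) If $\alpha\in(0,\pi)$, then the maximal common part of $T_{0,0}$ and $T_{\alpha,0}$ is the restriction of $T_{\max}$ to the set $$\mathcal S_2=\{y\in\operatorname{dom}(T_{\max}): [y,\phi_a](a)=[y,\phi_b](b)=[y,\psi_a](a)=0\}.$$ Moreover, for each $z\in\rho(T_{0,0})\cap\rho(T_{\alpha,0})$ the scalar $K_{\alpha,0}(z)=\cot(\alpha)+[u_{z,2},\psi_a](a)$ is nonzero and $$(T_{\alpha,0}-zI)^{-1}=(T_{0,0}-zI)^{-1}+K_{\alpha,0}(z)^{-1}\langle u_{\overline z,2},\,\cdot\,\rangle\,u_{z,2}.$$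
   Context: Setting. Let $-\infty\le a<b\le\infty$ and let $p,q,r$ be real-valued Lebesgue measurable functions on $(a,b)$ with $p>0$, $r>0$ a.e. and $p^{-1},q,r\in L^1_{\mathrm{loc}}((a,b);dx)$. Let $\mathfrak D(a,b)$ be the set of $f\in AC_{\mathrm{loc}}(a,b)$ (complex-valued) with $pf'\in AC_{\mathrm{loc}}(a,b)$, and $\tau f=\frac1r[-(pf')'+qf]$ for $f\in\mathfrak D(a,b)$. The Lagrange bracket is $[f,g](x)=f(x)\overline{(pg')(x)}-(pf')(x)\overline{g(x)}$ for $f,g\in\mathfrak D(a,b)$. $I$ and $\langle\cdot,\cdot\rangle$ (linear in the second argument) are the identity and inner product of $L^2((a,b);r(x)\,dx)$. The maximal operator is $T_{\max}f=\tau f$ with $\operatorname{dom}(T_{\max})=\{g\in\mathfrak D(a,b): g,\tau g\in L^2((a,b);r\,dx)\}$; it is densely defined, and the minimal operator is $T_{\min}:=(T_{\max})^*$, which is closed, symmetric, densely defined, with $(T_{\min})^*=T_{\max}$. For $f,g\in\operatorname{dom}(T_{\max})$ the limits $[f,g](a)=\lim_{x\downarrow a}[f,g](x)$ and $[f,g](b)=\lim_{x\uparrow b}[f,g](x)$ exist and are finite. $\tau$ is in the limit circle case at an endpoint if for each $z\in\mathbb C$ all solutions $y\in\mathfrak D(a,b)$ of $\tau y=zy$ are square integrable w.r.t. $r\,dx$ near that endpoint. A boundary condition basis at $c\in\{a,b\}$ is a pair of real-valued functions $\phi,\psi\in\operatorname{dom}(T_{\max})$ with $[\psi,\phi](c)=1$.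 For $\alpha,\beta\in[0,\pi)$, $T_{\alpha,\beta}$ is the restriction of $T_{\max}$ to the set of $g\in\operatorname{dom}(T_{\max})$ with $$\cos(\alpha)[g,\phi_a](a)+\sin(\alpha)[g,\psi_a](a)=0,\qquad \cos(\beta)[g,\phi_b](b)+\sin(\beta)[g,\psi_b](b)=0;$$ it is known to be a self-adjoint extension of $T_{\min}$. For $z\in\rho(T_{0,0})$, $u_{z,1},u_{z,2}$ are the solutions of $\tau u=zu$ satisfying $$[u_{z,1},\phi_a](a)=0,\ [u_{z,1},\phi_b](b)=1,\qquad [u_{z,2},\phi_a](a)=1,\ [u_{z,2},\phi_b](b)=0.$$ For self-adjoint extensions $T,T'$ of $T_{\min}$, the maximal common part of $T$ and $T'$ is the restriction of $T$ to $\{f\in\operatorname{dom}(T)\cap\operatorname{dom}(T'): Tf=T'f\}$. *)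

theory Defs
  imports "HOL-Analysis.Analysis"
begin

section \<open>Operators in a weighted \<open>L\<^sup>2\<close> space\<close>

text \<open>
  Elements of \<open>L\<^sup>2(M)\<close> are handled through representatives, i.e. square integrable functions,
  two of which denote the same vector iff they agree almost everywhere. A linear operator in
  \<open>L\<^sup>2(M)\<close> is identified with its graph, given as a set of pairs of representatives which
  is saturated under almost everywhere equality in both components. Such saturated relations
  correspond exactly to relations on the quotient, so that equality of operators is equality
  of these sets.
\<close>

type_synonym l2op = "((real \<Rightarrow> complex) \<times> (real \<Rightarrow> complex)) set"

definition L2 :: "real measure \<Rightarrow> (real \<Rightarrow> complex) set" where
  "L2 M = {f \<in> borel_measurable M. integrable M (\<lambda>x. (cmod (f x))\<^sup>2)}"

text \<open>The inner product is linear in the second argument.\<close>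

definition L2_inner :: "real measure \<Rightarrow> (real \<Rightarrow> complex) \<Rightarrow> (real \<Rightarrow> complex) \<Rightarrow> complex" where
  "L2_inner M f g = (LINT x|M. cnj (f x) * g x)"

definition L2_norm :: "real measure \<Rightarrow> (real \<Rightarrow> complex) \<Rightarrow> real" where
  "L2_norm M f = sqrt (LINT x|M. (cmod (f x))\<^sup>2)"

text \<open>Restriction of \<open>T\<close> to (the vectors represented by elements of) \<open>A\<close>.\<close>

definition op_restrict :: "real measure \<Rightarrow> l2op \<Rightarrow> (real \<Rightarrow> complex) set \<Rightarrow> l2op" where
  "op_restrict M T A = {(f, h) \<in> T. \<exists>g\<in>A. AE x in M. f x = g x}"

text \<open>\<open>T - z I\<close>; the inverse of an operator is the converse relation of its graph.\<close>

definition op_shift :: "l2op \<Rightarrow> complex \<Rightarrow> l2op" where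
  "op_shift T z = {(f, \<lambda>x. h x - z * f x) | f h. (f, h) \<in> T}"

definition op_add :: "l2op \<Rightarrow> l2op \<Rightarrow> l2op" where
  "op_add A B = {(f, \<lambda>x. g x + h x) | f g h. (f, g) \<in> A \<and> (f, h) \<in> B}"

text \<open>The everywhere defined operator \<open>c \<langle>v, \<cdot>\<rangle> w\<close>.\<close>

definition rank_one_op ::
    "real measure \<Rightarrow> complex \<Rightarrow> (real \<Rightarrow> complex) \<Rightarrow> (real \<Rightarrow> complex) \<Rightarrow> l2op" where
  "rank_one_op M c v w =
     {(f, h). f \<in> L2 M \<and> h \<in> L2 M \<and> (AE x in M. h x = c * L2_inner M v f * w x)}"

text \<open>\<open>T - z I\<close> is surjective, injective, and has a bounded inverse.\<close>

definition resolvent_set :: "real measure \<Rightarrow> l2op \<Rightarrow> complex set" where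
  "resolvent_set M T = {z.
     (\<forall>g\<in>L2 M. \<exists>f. (f, g) \<in> op_shift T z) \<and>
     (\<forall>f f' g. (f, g) \<in> op_shift T z \<and> (f', g) \<in> op_shift T z \<longrightarrow> (AE x in M. f x = f' x)) \<and>
     (\<exists>C. \<forall>(f, g)\<in>op_shift T z. L2_norm M f \<le> C * L2_norm M g)}"

definition max_common_part :: "real measure \<Rightarrow> l2op \<Rightarrow> l2op \<Rightarrow> l2op" where
  "max_common_part M T T' = op_restrict M T {f. \<exists>h. (f, h) \<in> T \<and> (f, h) \<in> T'}"


section \<open>Local integrability and local absolute continuity\<close>

definition L1_loc :: "real set \<Rightarrow> (real \<Rightarrow> real) \<Rightarrow> bool" where
  "L1_loc I f \<longleftrightarrow> (\<forall>K. compact K \<and> K \<subseteq> I \<longrightarrow> f absolutely_integrable_on K)"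

definition AC_on :: "real \<Rightarrow> real \<Rightarrow> (real \<Rightarrow> complex) \<Rightarrow> bool" where
  "AC_on c d f \<longleftrightarrow> (\<forall>\<epsilon>>0. \<exists>\<delta>>0. \<forall>(n::nat) x y.
     (\<forall>i<n. c \<le> x i \<and> x i \<le> y i \<and> y i \<le> d) \<and>
     disjoint_family_on (\<lambda>i. {x i<..<y i}) {..<n} \<and>
     (\<Sum>i<n. y i - x i) < \<delta> \<longrightarrow> (\<Sum>i<n. cmod (f (y i) - f (x i))) < \<epsilon>)"

definition AC_loc :: "real set \<Rightarrow> (real \<Rightarrow> complex) \<Rightarrow> bool" where
  "AC_loc I f \<longleftrightarrow> (\<forall>c d. c \<le> d \<and> {c..d} \<subseteq> I \<longrightarrow> AC_on c d f)"


section \<open>Sturm--Liouville expressions\<close>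

record sl_expr =
  lend :: ereal
  rend :: ereal
  pcoef :: "real \<Rightarrow> real"
  qcoef :: "real \<Rightarrow> real"
  rcoef :: "real \<Rightarrow> real"

definition sl_int :: "sl_expr \<Rightarrow> real set" where
  "sl_int S = einterval (lend S) (rend S)"

definition sturm_liouville :: "sl_expr \<Rightarrow> bool" where
  "sturm_liouville S \<longleftrightarrow>
     lend S < rend S \<and>
     pcoef S \<in> borel_measurable (lebesgue_on (sl_int S)) \<and>
     qcoef S \<in> borel_measurable (lebesgue_on (sl_int S)) \<and>
     rcoef S \<in> borel_measurable (lebesgue_on (sl_int S)) \<and>
     (AE x in lebesgue_on (sl_int S). pcoef S x > 0) \<and>
     (AE x in lebesgue_on (sl_int S). rcoef S x > 0) \<and>
     L1_loc (sl_int S) (\<lambda>x. inverse (pcoef S x)) \<and>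
     L1_loc (sl_int S) (qcoef S) \<and>
     L1_loc (sl_int S) (rcoef S)"

text \<open>The measure \<open>r dx\<close> on \<open>(a,b)\<close>.\<close>

definition sl_measure :: "sl_expr \<Rightarrow> real measure" where
  "sl_measure S = density (lebesgue_on (sl_int S)) (\<lambda>x. ennreal (rcoef S x))"

text \<open>
  The derivative \<open>f'\<close> of a locally absolutely continuous \<open>f\<close> exists only almost everywhere, so
  \<open>pf' \<in> AC\<^sub>l\<^sub>o\<^sub>c\<close> means that \<open>pf'\<close> agrees almost everywhere with a locally absolutely continuous
  function. The latter is unique on \<open>(a,b)\<close>; pointwise values of \<open>pf'\<close> refer to it.
\<close>

definition is_quasi_deriv :: "sl_expr \<Rightarrow> (real \<Rightarrow> complex) \<Rightarrow> (real \<Rightarrow> complex) \<Rightarrow> bool" where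
  "is_quasi_deriv S f h \<longleftrightarrow> AC_loc (sl_int S) h \<and>
     (AE x in lebesgue_on (sl_int S). h x = of_real (pcoef S x) * vector_derivative f (at x))"

definition quasi_deriv :: "sl_expr \<Rightarrow> (real \<Rightarrow> complex) \<Rightarrow> real \<Rightarrow> complex" where
  "quasi_deriv S f = (SOME h. is_quasi_deriv S f h)"

definition sl_D :: "sl_expr \<Rightarrow> (real \<Rightarrow> complex) set" where
  "sl_D S = {f. AC_loc (sl_int S) f \<and> (\<exists>h. is_quasi_deriv S f h)}"

definition sl_tau :: "sl_expr \<Rightarrow> (real \<Rightarrow> complex) \<Rightarrow> real \<Rightarrow> complex" where
  "sl_tau S f x = (1 / of_real (rcoef S x)) *
     (- vector_derivative (quasi_deriv S f) (at x) + of_real (qcoef S x) * f x)"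

definition sl_solution :: "sl_expr \<Rightarrow> complex \<Rightarrow> (real \<Rightarrow> complex) \<Rightarrow> bool" where
  "sl_solution S z y \<longleftrightarrow>
     y \<in> sl_D S \<and> (AE x in lebesgue_on (sl_int S). sl_tau S y x = z * y x)"

definition bracket ::
    "sl_expr \<Rightarrow> (real \<Rightarrow> complex) \<Rightarrow> (real \<Rightarrow> complex) \<Rightarrow> real \<Rightarrow> complex" where
  "bracket S f g x = f x * cnj (quasi_deriv S g x) - quasi_deriv S f x * cnj (g x)"

text \<open>
  Boundary values of the bracket. The endpoints may be infinite, so the limits are taken in the
  extended reals.
\<close>

definition bracket_l :: "sl_expr \<Rightarrow> (real \<Rightarrow> complex) \<Rightarrow> (real \<Rightarrow> complex) \<Rightarrow> complex" where
  "bracket_l S f g = Lim (at_right (lend S)) (\<lambda>t. bracket S f g (real_of_ereal t))"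

definition bracket_r :: "sl_expr \<Rightarrow> (real \<Rightarrow> complex) \<Rightarrow> (real \<Rightarrow> complex) \<Rightarrow> complex" where
  "bracket_r S f g = Lim (at_left (rend S)) (\<lambda>t. bracket S f g (real_of_ereal t))"

text \<open>
  A vector of \<open>L\<^sup>2\<close> has at most one representative on \<open>(a,b)\<close> that is locally absolutely
  continuous. \<open>dom_max\<close> consists of these representatives, on which brackets are meaningful;
  \<open>T_max\<close> is the saturated graph.
\<close>

definition dom_max :: "sl_expr \<Rightarrow> (real \<Rightarrow> complex) set" where
  "dom_max S = {g \<in> sl_D S. g \<in> L2 (sl_measure S) \<and> sl_tau S g \<in> L2 (sl_measure S)}"

definition T_max :: "sl_expr \<Rightarrow> l2op" where
  "T_max S = {(f, h). f \<in> L2 (sl_measure S) \<and> h \<in> L2 (sl_measure S) \<and>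
     (\<exists>g\<in>dom_max S. (AE x in sl_measure S. f x = g x) \<and>
                     (AE x in sl_measure S. h x = sl_tau S g x))}"

definition limit_circle_l :: "sl_expr \<Rightarrow> bool" where
  "limit_circle_l S \<longleftrightarrow> (\<forall>z y. sl_solution S z y \<longrightarrow>
     (\<exists>c\<in>sl_int S. set_integrable (sl_measure S) (einterval (lend S) (ereal c))
        (\<lambda>x. (cmod (y x))\<^sup>2)))"

definition limit_circle_r :: "sl_expr \<Rightarrow> bool" where
  "limit_circle_r S \<longleftrightarrow> (\<forall>z y. sl_solution S z y \<longrightarrow>
     (\<exists>c\<in>sl_int S. set_integrable (sl_measure S) (einterval (ereal c) (rend S))
        (\<lambda>x. (cmod (y x))\<^sup>2)))"

definition bc_basis_l :: "sl_expr \<Rightarrow> (real \<Rightarrow> complex) \<Rightarrow> (real \<Rightarrow> complex) \<Rightarrow> bool" where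
  "bc_basis_l S \<phi> \<psi> \<longleftrightarrow> \<phi> \<in> dom_max S \<and> \<psi> \<in> dom_max S \<and>
     (\<forall>x\<in>sl_int S. \<phi> x \<in> \<real> \<and> \<psi> x \<in> \<real>) \<and> bracket_l S \<psi> \<phi> = 1"

definition bc_basis_r :: "sl_expr \<Rightarrow> (real \<Rightarrow> complex) \<Rightarrow> (real \<Rightarrow> complex) \<Rightarrow> bool" where
  "bc_basis_r S \<phi> \<psi> \<longleftrightarrow> \<phi> \<in> dom_max S \<and> \<psi> \<in> dom_max S \<and>
     (\<forall>x\<in>sl_int S. \<phi> x \<in> \<real> \<and> \<psi> x \<in> \<real>) \<and> bracket_r S \<psi> \<phi> = 1"

text \<open>Restriction of \<open>T_max\<close> by separated boundary conditions with parameters \<open>\<alpha>\<close> and \<open>\<beta>\<close>.\<close>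

definition T_sep :: "sl_expr \<Rightarrow> (real \<Rightarrow> complex) \<Rightarrow> (real \<Rightarrow> complex) \<Rightarrow>
    (real \<Rightarrow> complex) \<Rightarrow> (real \<Rightarrow> complex) \<Rightarrow> real \<Rightarrow> real \<Rightarrow> l2op" where
  "T_sep S \<phi>a \<psi>a \<phi>b \<psi>b \<alpha> \<beta> = op_restrict (sl_measure S) (T_max S) {g \<in> dom_max S.
     of_real (cos \<alpha>) * bracket_l S g \<phi>a + of_real (sin \<alpha>) * bracket_l S g \<psi>a = 0 \<and>
     of_real (cos \<beta>) * bracket_r S g \<phi>b + of_real (sin \<beta>) * bracket_r S g \<psi>b = 0}"

end

theory Submission
  imports Defs
begin

text \<open>
Throughout, \<open>[f,g]\<close> is the Lagrange bracket and \<open>u\<^sub>z\<close> stands for \<open>u\<^sub>z\<^sub>,\<^sub>1\<close> or \<open>u\<^sub>z\<^sub>,\<^sub>2\<close>.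

Why the theorem holds. The operator with both parameters zero and the perturbed operator \<open>T\<close> are
restrictions of the same maximal operator, they share the condition at one endpoint, and at the
other endpoint one has \<open>[y,\<phi>] = 0\<close> where \<open>T\<close> has \<open>c [y,\<phi>] + s [y,\<psi>] = 0\<close> with \<open>s \<noteq> 0\<close>. Hence on the
common domain both \<open>[y,\<phi>]\<close> and \<open>[y,\<psi>]\<close> vanish there, which is the description of the maximal common
part (lemma \<open>common_part_boundary\<close>). For the resolvents, let \<open>f\<close> be the image of \<open>k\<close> under the
unperturbed resolvent. Adding a multiple \<open>\<kappa> u\<^sub>z\<close> keeps both the equation \<open>(\<tau> - z) y = k\<close> and the shared
condition; the remaining condition of \<open>T\<close> is one linear equation for \<open>\<kappa>\<close>, whose coefficient is a
nonzero multiple of \<open>K\<close>. If \<open>K\<close> were zero, \<open>u\<^sub>z\<close> would be an eigenfunction of \<open>T\<close>, contrary to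
\<open>z \<in> \<rho>(T)\<close>. To solve for \<open>\<kappa>\<close> one needs \<open>[f,\<psi>]\<close> at the endpoint. Green's formula (lemma \<open>green\<close>)
expresses the inner product of \<open>u\<close> at the conjugate of \<open>z\<close> with \<open>k = (\<tau> - z) f\<close> by boundary brackets
of \<open>f\<close> with this solution, and the Pluecker identity (lemma \<open>bdry_pluecker\<close>) shows that these
reduce to \<open>\<plusminus>[f,\<psi>]\<close>. Finally, \<open>T - z\<close> is injective, so the
solution obtained in this way is the image of \<open>k\<close> under the resolvent of \<open>T\<close>. This is carried out in
lemma \<open>krein_resolvent_formula\<close>, once for both endpoints.

The analytic input is calculus for locally absolutely continuous functions. A quasi-derivative is
defined through a derivative that exists almost everywhere, so even its linearity depends on the
theorem that absolutely continuous functions are differentiable almost everywhere (lemma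
\<open>AC_on_differentiable_ae\<close>, by Vitali coverings), and Green's formula is the fundamental theorem of
calculus for such functions (lemma \<open>AC_on_FTC\<close>) applied to the bracket. As the derivative of
the bracket of two functions in the maximal domain is integrable up to the endpoints, the boundary
values exist (lemma \<open>AC_loc_endpoint_limits\<close>).
\<close>

section \<open>Absolutely continuous functions on a compact interval\<close>

text \<open>
Divisions of an interval are sets of closed intervals, so the increment of a function is taken as
a function of the interval as a set.
\<close>

definition incr :: "(real \<Rightarrow> 'a::real_normed_vector) \<Rightarrow> real set \<Rightarrow> 'a" where
  "incr F K = F (Sup K) - F (Inf K)"

definition separated_intervals :: "real \<Rightarrow> real \<Rightarrow> real set set \<Rightarrow> bool" where
  "separated_intervals c d C \<longleftrightarrow> finite C \<and> (\<forall>K\<in>C. \<exists>u v. K = {u..v} \<and> u < v \<and> c \<le> u \<and> v \<le> d) \<and>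
     pairwise disjnt C"

lemma incr_interval [simp]: "u \<le> v \<Longrightarrow> incr F {u..v} = F v - F u"
  by (simp add: incr_def)

text \<open>
Absolute continuity is defined for families indexed by an initial segment of the naturals; the
families met below are indexed by intervals, by pairs of intervals or by a tagged division.
\<close>

lemma AC_on_finite_family:
  assumes "AC_on c d F" and "0 < e"
  shows "\<exists>\<delta>>0. \<forall>(I::'i set) u v. finite I \<and> (\<forall>i\<in>I. c \<le> u i \<and> u i \<le> v i \<and> v i \<le> d) \<and>
      disjoint_family_on (\<lambda>i. {u i<..<v i}) I \<and> (\<Sum>i\<in>I. v i - u i) < \<delta> \<longrightarrow>
      (\<Sum>i\<in>I. cmod (F (v i) - F (u i))) < e"
proof -
  obtain \<delta> where \<delta>: "0 < \<delta>" and
    AC: "\<And>(n::nat) x y. (\<forall>i<n. c \<le> x i \<and> x i \<le> y i \<and> y i \<le> d) \<Longrightarrow>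
     disjoint_family_on (\<lambda>i. {x i<..<y i}) {..<n} \<Longrightarrow>
     (\<Sum>i<n. y i - x i) < \<delta> \<Longrightarrow> (\<Sum>i<n. cmod (F (y i) - F (x i))) < e"
    using assms unfolding AC_on_def by meson
  show ?thesis
  proof (intro exI[of _ \<delta>] conjI allI impI \<delta>; elim conjE)
    fix I :: "'i set" and u v
    assume fin: "finite I" and uv: "\<forall>i\<in>I. c \<le> u i \<and> u i \<le> v i \<and> v i \<le> d"
      and dis: "disjoint_family_on (\<lambda>i. {u i<..<v i}) I" and sm: "(\<Sum>i\<in>I. v i - u i) < \<delta>"
    obtain h where h: "bij_betw h {..<card I} I"
      using ex_bij_betw_nat_finite[OF fin] atLeast0LessThan by metis
    have "(\<Sum>i<card I. cmod (F (v (h i)) - F (u (h i)))) < e"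
    proof (rule AC)
      show "\<forall>i<card I. c \<le> u (h i) \<and> u (h i) \<le> v (h i) \<and> v (h i) \<le> d"
        using uv bij_betwE[OF h] by auto
      show "disjoint_family_on (\<lambda>i. {u (h i)<..<v (h i)}) {..<card I}"
        unfolding disjoint_family_on_def
      proof (intro ballI impI)
        fix i j assume "i \<in> {..<card I}" "j \<in> {..<card I}" "i \<noteq> j"
        then have "h i \<in> I" "h j \<in> I" "h i \<noteq> h j"
          using h by (auto simp: bij_betw_def inj_on_def)
        then show "{u (h i)<..<v (h i)} \<inter> {u (h j)<..<v (h j)} = {}"
          using dis unfolding disjoint_family_on_def by blast
      qed
      show "(\<Sum>i<card I. v (h i) - u (h i)) < \<delta>"
        using sm sum.reindex_bij_betw[OF h, of "\<lambda>i. v i - u i"] by simp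
    qed
    then show "(\<Sum>i\<in>I. cmod (F (v i) - F (u i))) < e"
      using sum.reindex_bij_betw[OF h, of "\<lambda>i. cmod (F (v i) - F (u i))"] by simp
  qed
qed

text \<open>
Closure under sums, products, conjugation and real and imaginary parts reduces to this comparison
of increments.
\<close>

lemma AC_on_dominated:
  assumes f: "AC_on c d f" and g: "AC_on c d g"
    and bd: "\<And>x y. \<lbrakk>c \<le> x; x \<le> y; y \<le> d\<rbrakk> \<Longrightarrow>
      cmod (h y - h x) \<le> A * cmod (f y - f x) + B * cmod (g y - g x)"
  shows "AC_on c d h"
  unfolding AC_on_def
proof (intro allI impI)
  fix e :: real assume e: "0 < e"
  \<comment> \<open>Each of the two sums is made smaller than this, so that the total stays below \<open>e\<close>
    even when \<open>A\<close> or \<open>B\<close> vanishes.\<close>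
  define e' where "e' = e / (2 * (\<bar>A\<bar> + \<bar>B\<bar> + 1))"
  have e': "0 < e'" using e by (simp add: e'_def)
  obtain d1 where d1: "0 < d1" and f1: "\<And>(n::nat) x y. (\<forall>i<n. c \<le> x i \<and> x i \<le> y i \<and> y i \<le> d) \<Longrightarrow>
     disjoint_family_on (\<lambda>i. {x i<..<y i}) {..<n} \<Longrightarrow>
     (\<Sum>i<n. y i - x i) < d1 \<Longrightarrow> (\<Sum>i<n. cmod (f (y i) - f (x i))) < e'"
    using f e' unfolding AC_on_def by meson
  obtain d2 where d2: "0 < d2" and g2: "\<And>(n::nat) x y. (\<forall>i<n. c \<le> x i \<and> x i \<le> y i \<and> y i \<le> d) \<Longrightarrow>
     disjoint_family_on (\<lambda>i. {x i<..<y i}) {..<n} \<Longrightarrow>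
     (\<Sum>i<n. y i - x i) < d2 \<Longrightarrow> (\<Sum>i<n. cmod (g (y i) - g (x i))) < e'"
    using g e' unfolding AC_on_def by meson
  show "\<exists>\<delta>>0. \<forall>(n::nat) x y. (\<forall>i<n. c \<le> x i \<and> x i \<le> y i \<and> y i \<le> d) \<and>
     disjoint_family_on (\<lambda>i. {x i<..<y i}) {..<n} \<and>
     (\<Sum>i<n. y i - x i) < \<delta> \<longrightarrow> (\<Sum>i<n. cmod (h (y i) - h (x i))) < e"
  proof (intro exI[of _ "min d1 d2"] conjI allI impI; (elim conjE)?)
    fix n :: nat and x y :: "nat \<Rightarrow> real"
    assume xy: "\<forall>i<n. c \<le> x i \<and> x i \<le> y i \<and> y i \<le> d"
      and dis: "disjoint_family_on (\<lambda>i. {x i<..<y i}) {..<n}"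
      and sm: "(\<Sum>i<n. y i - x i) < min d1 d2"
    have "(\<Sum>i<n. cmod (h (y i) - h (x i))) \<le>
        (\<Sum>i<n. A * cmod (f (y i) - f (x i)) + B * cmod (g (y i) - g (x i)))"
      using xy by (intro sum_mono bd) auto
    also have "\<dots> = A * (\<Sum>i<n. cmod (f (y i) - f (x i))) + B * (\<Sum>i<n. cmod (g (y i) - g (x i)))"
      by (simp add: sum.distrib sum_distrib_left)
    also have "\<dots> \<le> \<bar>A\<bar> * (\<Sum>i<n. cmod (f (y i) - f (x i))) + \<bar>B\<bar> * (\<Sum>i<n. cmod (g (y i) - g (x i)))"
      by (intro add_mono mult_right_mono sum_nonneg) auto
    also have "\<dots> \<le> \<bar>A\<bar> * e' + \<bar>B\<bar> * e'"
      using f1[OF xy dis] g2[OF xy dis] sm by (intro add_mono mult_left_mono) auto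
    also have "\<dots> < 2 * (\<bar>A\<bar> + \<bar>B\<bar> + 1) * e'"
    proof -
      have "(\<bar>A\<bar> + \<bar>B\<bar>) * e' < (2 * (\<bar>A\<bar> + \<bar>B\<bar> + 1)) * e'"
        using e' by (intro mult_strict_right_mono) auto
      then show ?thesis by (simp add: distrib_right)
    qed
    also have "\<dots> = e" unfolding e'_def by (simp add: divide_simps)
    finally show "(\<Sum>i<n. cmod (h (y i) - h (x i))) < e" .
  qed (use d1 d2 in auto)
qed

lemma AC_on_continuous_on:
  assumes "AC_on c d F"
  shows "continuous_on {c..d} F"
  unfolding continuous_on_iff
proof (intro ballI allI impI)
  fix x and e :: real assume x: "x \<in> {c..d}" and e: "0 < e"
  obtain \<delta> where \<delta>: "0 < \<delta>"
    and AC: "\<forall>(I::unit set) u v. finite I \<and> (\<forall>i\<in>I. c \<le> u i \<and> u i \<le> v i \<and> v i \<le> d) \<and>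
      disjoint_family_on (\<lambda>i. {u i<..<v i}) I \<and> (\<Sum>i\<in>I. v i - u i) < \<delta> \<longrightarrow>
      (\<Sum>i\<in>I. cmod (F (v i) - F (u i))) < e"
    using AC_on_finite_family[OF assms e] by blast
  have *: "cmod (F v - F u) < e" if "c \<le> u" "u \<le> v" "v \<le> d" "v - u < \<delta>" for u v
    using AC[rule_format, of "{()}" "\<lambda>_. u" "\<lambda>_. v"] that by (simp add: disjoint_family_on_def)
  show "\<exists>\<delta>>0. \<forall>x'\<in>{c..d}. dist x' x < \<delta> \<longrightarrow> dist (F x') (F x) < e"
  proof (intro exI[of _ \<delta>] conjI ballI impI \<delta>)
    fix x' assume "x' \<in> {c..d}" "dist x' x < \<delta>"
    then show "dist (F x') (F x) < e"
      using *[of x x'] *[of x' x] x by (cases "x \<le> x'") (auto simp: dist_norm norm_minus_commute)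
  qed
qed

lemma AC_on_const: "AC_on c d (\<lambda>_. k)"
  unfolding AC_on_def by (auto intro: exI[of _ 1])

lemma AC_on_of_real_id: "AC_on c d (\<lambda>x. of_real (x::real))"
  unfolding AC_on_def
proof (intro allI impI)
  fix e :: real assume "0 < e"
  have *: "(\<Sum>i<n. cmod (of_real (y i) - of_real (x i))) = (\<Sum>i<n. y i - x i)"
    if "\<forall>i<n. c \<le> x i \<and> x i \<le> y i \<and> y i \<le> d" for n :: nat and x y :: "nat \<Rightarrow> real"
    using that by (intro sum.cong) (auto simp flip: of_real_diff)
  show "\<exists>\<delta>>0. \<forall>(n::nat) x y. (\<forall>i<n. c \<le> x i \<and> x i \<le> y i \<and> y i \<le> d) \<and>
     disjoint_family_on (\<lambda>i. {x i<..<y i}) {..<n} \<and>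
     (\<Sum>i<n. y i - x i) < \<delta> \<longrightarrow>
     (\<Sum>i<n. cmod (complex_of_real (y i) - of_real (x i))) < e"
    using \<open>0 < e\<close> by (intro exI[of _ e]) (auto simp: *)
qed

lemma AC_on_add:
  assumes "AC_on c d f" "AC_on c d g"
  shows "AC_on c d (\<lambda>x. f x + g x)"
  by (rule AC_on_dominated[OF assms, where A = 1 and B = 1])
     (simp add: add_diff_add norm_triangle_ineq)

lemma AC_on_mult:
  assumes f: "AC_on c d f" and g: "AC_on c d g"
  shows "AC_on c d (\<lambda>x. f x * g x)"
proof -
  obtain A where A: "\<And>x. x \<in> {c..d} \<Longrightarrow> cmod (f x) \<le> A"
    using compact_imp_bounded[OF compact_continuous_image[OF AC_on_continuous_on[OF f]]]
    unfolding bounded_iff by blast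
  obtain B where B: "\<And>x. x \<in> {c..d} \<Longrightarrow> cmod (g x) \<le> B"
    using compact_imp_bounded[OF compact_continuous_image[OF AC_on_continuous_on[OF g]]]
    unfolding bounded_iff by blast
  show ?thesis
  proof (rule AC_on_dominated[OF f g, where A = B and B = A])
    fix x y assume "c \<le> x" "x \<le> y" "y \<le> d"
    then have xy: "x \<in> {c..d}" "y \<in> {c..d}" by auto
    have "f y * g y - f x * g x = g y * (f y - f x) + f x * (g y - g x)"
      by (simp add: algebra_simps)
    then have "cmod (f y * g y - f x * g x) \<le> cmod (g y) * cmod (f y - f x) + cmod (f x) * cmod (g y - g x)"
      by (metis norm_mult norm_triangle_ineq)
    also have "\<dots> \<le> B * cmod (f y - f x) + A * cmod (g y - g x)"
      using A[OF xy(1)] B[OF xy(2)] by (intro add_mono mult_right_mono) auto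
    finally show "cmod (f y * g y - f x * g x) \<le> B * cmod (f y - f x) + A * cmod (g y - g x)" .
  qed
qed

lemma AC_on_cnj:
  assumes "AC_on c d f" shows "AC_on c d (\<lambda>x. cnj (f x))"
  by (rule AC_on_dominated[OF assms assms, where A = 1 and B = 0])
     (simp flip: complex_cnj_diff)

lemma AC_on_Re:
  assumes "AC_on c d f" shows "AC_on c d (\<lambda>x. of_real (Re (f x)))"
  by (rule AC_on_dominated[OF assms assms, where A = 1 and B = 0])
     (simp add: abs_Re_le_cmod flip: of_real_diff minus_complex.simps(1))

lemma AC_on_Im:
  assumes "AC_on c d f" shows "AC_on c d (\<lambda>x. of_real (Im (f x)))"
  by (rule AC_on_dominated[OF assms assms, where A = 1 and B = 0])
     (simp add: abs_Im_le_cmod flip: of_real_diff minus_complex.simps(2))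

lemma sum_incr_division:
  assumes "q division_of {u..v}" "u \<le> v"
  shows "(\<Sum>K\<in>q. incr F K) = F v - F u"
proof -
  define p where "p = (\<lambda>K. (Inf K, K)) ` q"
  have K: "\<exists>x y. K = {x..y} \<and> x \<le> y" if "K \<in> q" for K
    using division_ofD(3,4)[OF assms(1) that] by (metis atLeastatMost_empty_iff2 interval_cbox not_le)
  have "p tagged_division_of {u..v}"
    unfolding tagged_division_of
  proof (intro conjI allI impI)
    show "finite p" using assms(1) by (auto simp: p_def)
  next
    fix x K assume "(x, K) \<in> p"
    then have K': "K \<in> q" "x = Inf K" by (auto simp: p_def)
    from K[OF K'(1)] K' show "x \<in> K" by auto
    show "K \<subseteq> {u..v}" using K' assms by auto
    show "\<exists>a b. K = cbox a b" using K[OF K'(1)] interval_cbox by metis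
  next
    fix x K x' K' assume "(x, K) \<in> p \<and> (x', K') \<in> p \<and> (x, K) \<noteq> (x', K')"
    then show "interior K \<inter> interior K' = {}"
      using division_ofD(5)[OF assms(1)] by (auto simp: p_def)
  next
    have "{K. \<exists>x. (x, K) \<in> p} = q" by (auto simp: p_def)
    then show "\<Union>{K. \<exists>x. (x, K) \<in> p} = {u..v}" using assms by auto
  qed
  from additive_tagged_division_1[OF assms(2) this, of F]
  have "(\<Sum>(x, K)\<in>p. incr F K) = F v - F u" by (simp add: incr_def)
  moreover have "(\<Sum>(x, K)\<in>p. incr F K) = (\<Sum>K\<in>q. incr F K)"
    unfolding p_def by (subst sum.reindex) (auto simp: inj_on_def)
  ultimately show ?thesis by simp
qed

lemma separated_intervals_division:
  assumes "separated_intervals c d C"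
  shows "C division_of \<Union>C"
  unfolding division_of_def
proof (intro conjI ballI impI)
  show "finite C" using assms by (simp add: separated_intervals_def)
  fix K assume "K \<in> C"
  then obtain u v where K: "K = {u..v}" "u < v"
    using assms unfolding separated_intervals_def by blast
  show "K \<subseteq> \<Union>C" using \<open>K \<in> C\<close> by blast
  show "K \<noteq> {}" using K by simp
  show "\<exists>a b. K = cbox a b" using K by (metis interval_cbox)
  fix L assume "L \<in> C" "K \<noteq> L"
  then have "K \<inter> L = {}"
    using assms \<open>K \<in> C\<close> by (auto simp: separated_intervals_def pairwise_def disjnt_def)
  then show "interior K \<inter> interior L = {}" using interior_subset by blast
qed simp

text \<open>
The increments over two families of disjoint intervals almost agree as soon as the second
family lies within the first and fills it up to a small length: the difference is the sum of the
increments over the gaps.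
\<close>

lemma AC_on_gap:
  assumes "AC_on c d F" and "0 < e"
  obtains \<delta> where "0 < \<delta>"
    and "\<And>C D. \<lbrakk>separated_intervals c d C; separated_intervals c d D; \<And>J. J \<in> D \<Longrightarrow> \<exists>I\<in>C. J \<subseteq> I;
      (\<Sum>I\<in>C. incr id I) - (\<Sum>J\<in>D. incr id J) < \<delta>\<rbrakk> \<Longrightarrow>
      cmod ((\<Sum>I\<in>C. incr F I) - (\<Sum>J\<in>D. incr F J)) < e"
proof -
  obtain \<delta> where \<delta>: "0 < \<delta>"
    and AC: "\<forall>(I::(real set \<times> real set) set) u v.
      finite I \<and> (\<forall>i\<in>I. c \<le> u i \<and> u i \<le> v i \<and> v i \<le> d) \<and>
      disjoint_family_on (\<lambda>i. {u i<..<v i}) I \<and> (\<Sum>i\<in>I. v i - u i) < \<delta> \<longrightarrow>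
      (\<Sum>i\<in>I. cmod (F (v i) - F (u i))) < e"
    using AC_on_finite_family[OF assms] by blast
  show thesis
  proof (rule that[OF \<delta>])
    fix C D
    assume C: "separated_intervals c d C" and D: "separated_intervals c d D"
      and sub: "\<And>J. J \<in> D \<Longrightarrow> \<exists>I\<in>C. J \<subseteq> I"
      and small: "(\<Sum>I\<in>C. incr id I) - (\<Sum>J\<in>D. incr id J) < \<delta>"
    \<comment> \<open>The members of \<open>D\<close> inside \<open>I\<close> are completed to a division \<open>q I\<close> of \<open>I\<close>. What is
      added is a family of nonoverlapping intervals of small total length, and absolute continuity
      applies to it.\<close>
    define P where "P I = {J\<in>D. J \<subseteq> I}" for I
    have finC: "finite C" and finD: "finite D" using C D by (auto simp: separated_intervals_def)
    have Cint: "interior A \<inter> interior B = {}" if "A \<in> C" "B \<in> C" "A \<noteq> B" for A B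
    proof -
      have "A \<inter> B = {}" using C that by (auto simp: separated_intervals_def pairwise_def disjnt_def)
      then show ?thesis using interior_subset by blast
    qed
    have "\<exists>q. P I \<subseteq> q \<and> q division_of I" if I: "I \<in> C" for I
    proof -
      obtain u v where uv: "I = {u..v}" using C I by (auto simp: separated_intervals_def)
      have "separated_intervals c d (P I)"
        using D unfolding separated_intervals_def P_def pairwise_def by auto
      from partial_division_extend_interval[OF separated_intervals_division[OF this], of u v]
      show ?thesis using uv by (metis (no_types, lifting) P_def Sup_least interval_cbox mem_Collect_eq)
    qed
    then obtain q where q: "\<And>I. I \<in> C \<Longrightarrow> P I \<subseteq> q I" "\<And>I. I \<in> C \<Longrightarrow> q I division_of I"
      by metis
    define R where "R = (SIGMA I:C. q I - P I)"
    have finR: "finite R" unfolding R_def using finC q(2) by auto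
    \<comment> \<open>Used for \<open>G = F\<close>, and for \<open>G = id\<close> to see that the total length of the added intervals is
      less than \<open>\<delta>\<close>.\<close>
    have *: "(\<Sum>I\<in>C. incr G I) - (\<Sum>J\<in>D. incr G J) = (\<Sum>(I, L)\<in>R. incr G L)"
      for G :: "real \<Rightarrow> 'z::real_normed_vector"
    proof -
      have DU: "D = (\<Union>I\<in>C. P I)" using sub by (auto simp: P_def)
      have "(\<Sum>J\<in>D. incr G J) = (\<Sum>I\<in>C. \<Sum>J\<in>P I. incr G J)"
        unfolding DU
      proof (rule sum.UNION_disjoint[OF finC]; intro ballI impI equals0I)
        show "finite (P I)" for I using finD by (simp add: P_def)
        fix I I' J assume "I \<in> C" "I' \<in> C" and ne: "I \<noteq> I'" and "J \<in> P I \<inter> P I'"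
        then have "interior J \<subseteq> interior I \<inter> interior I'" and "J \<in> D"
          by (auto simp: P_def dest: interior_mono)
        moreover have "interior J \<noteq> {}"
          using D \<open>J \<in> D\<close> by (auto simp: separated_intervals_def)
        ultimately show False using Cint[OF \<open>I \<in> C\<close> \<open>I' \<in> C\<close> ne] by auto
      qed
      moreover have "(\<Sum>I\<in>C. incr G I) = (\<Sum>I\<in>C. (\<Sum>L\<in>q I - P I. incr G L) + (\<Sum>J\<in>P I. incr G J))"
      proof (rule sum.cong[OF refl])
        fix I assume I: "I \<in> C"
        obtain u v where uv: "I = {u..v}" "u \<le> v" using C I by (auto simp: separated_intervals_def)
        have "incr G I = (\<Sum>K\<in>q I. incr G K)"
          using sum_incr_division[of "q I" u v G] q(2)[OF I] uv by simp
        also have "\<dots> = (\<Sum>L\<in>q I - P I. incr G L) + (\<Sum>J\<in>P I. incr G J)"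
          using q I by (intro sum.subset_diff) auto
        finally show "incr G I = \<dots>" .
      qed
      ultimately have "(\<Sum>I\<in>C. incr G I) - (\<Sum>J\<in>D. incr G J) = (\<Sum>I\<in>C. \<Sum>L\<in>q I - P I. incr G L)"
        by (simp add: sum.distrib)
      also have "\<dots> = (\<Sum>(I, L)\<in>R. incr G L)"
        unfolding R_def using finC q(2) by (intro sum.Sigma) auto
      finally show ?thesis .
    qed
    have L: "\<exists>x y. L = {x..y} \<and> x \<le> y \<and> c \<le> x \<and> y \<le> d" if IL: "I \<in> C" "L \<in> q I" for I L
    proof -
      obtain u v where uv: "I = {u..v}" "u \<le> v" "c \<le> u" "v \<le> d"
        using C IL unfolding separated_intervals_def by (meson less_imp_le)
      obtain x y where xy: "L = {x..y}"
        using division_ofD(4)[OF q(2)[OF IL(1)] IL(2)] by auto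
      have "L \<noteq> {}" "L \<subseteq> {u..v}" using division_ofD(2,3)[OF q(2)[OF IL(1)] IL(2)] uv by auto
      then show ?thesis using uv xy by auto
    qed
    have "(\<Sum>i\<in>R. cmod (F (Sup (snd i)) - F (Inf (snd i)))) < e"
    proof -
      have h1: "\<forall>i\<in>R. c \<le> Inf (snd i) \<and> Inf (snd i) \<le> Sup (snd i) \<and> Sup (snd i) \<le> d"
        using L by (fastforce simp: R_def)
      have h2: "disjoint_family_on (\<lambda>i. {Inf (snd i)<..<Sup (snd i)}) R"
        unfolding disjoint_family_on_def
      proof (intro ballI impI)
        fix i j assume ij: "i \<in> R" "j \<in> R" "i \<noteq> j"
        have int: "{Inf (snd i)<..<Sup (snd i)} = interior (snd i)" if "i \<in> R" for i
          using L that by (fastforce simp: R_def)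
        have subs: "interior (snd i) \<subseteq> interior (fst i)" if "i \<in> R" for i
          using that division_ofD(2)[OF q(2)] by (intro interior_mono) (fastforce simp: R_def)
        have "interior (snd i) \<inter> interior (snd j) = {}"
        proof (cases "fst i = fst j")
          case True
          then have "snd i \<noteq> snd j" using ij by (simp add: prod_eq_iff)
          then show ?thesis using True ij division_ofD(5)[OF q(2)[of "fst i"], of "snd i" "snd j"]
            by (auto simp: R_def)
        next
          case False
          then have "interior (fst i) \<inter> interior (fst j) = {}"
            using ij by (intro Cint) (auto simp: R_def)
          then show ?thesis using subs ij by blast
        qed
        then show "{Inf (snd i)<..<Sup (snd i)} \<inter> {Inf (snd j)<..<Sup (snd j)} = {}"
          using int[OF ij(1)] int[OF ij(2)] by simp
      qed
      have h3: "(\<Sum>i\<in>R. Sup (snd i) - Inf (snd i)) < \<delta>"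
        using small *[of id] by (simp add: incr_def case_prod_beta)
      show ?thesis
        by (rule AC[rule_format, OF conjI[OF finR conjI[OF h1 conjI[OF h2 h3]]]])
    qed
    moreover have "cmod (\<Sum>(I, L)\<in>R. incr F L) \<le> (\<Sum>i\<in>R. cmod (F (Sup (snd i)) - F (Inf (snd i))))"
      unfolding case_prod_beta incr_def by (rule norm_sum)
    ultimately show "cmod ((\<Sum>I\<in>C. incr F I) - (\<Sum>J\<in>D. incr F J)) < e"
      using *[of F] by simp
  qed
qed

section \<open>Almost everywhere differentiability\<close>

lemma measure_separated_intervals:
  assumes "separated_intervals c d C"
  shows "\<Union>C \<in> lmeasurable" "measure lebesgue (\<Union>C) = (\<Sum>K\<in>C. incr id K)"
proof -
  have fin: "finite C" and K: "\<And>K. K \<in> C \<Longrightarrow> \<exists>u v. K = {u..v} \<and> u < v"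
    using assms unfolding separated_intervals_def by blast+
  have lm: "K \<in> lmeasurable" "measure lebesgue K = incr id K" if "K \<in> C" for K
    using K[OF that] by auto
  show "\<Union>C \<in> lmeasurable" using fin lm by (intro fmeasurable.finite_Union) auto
  have "measure lebesgue (\<Union>C) = (\<Sum>K\<in>C. measure lebesgue K)"
    using assms fin lm
    by (intro measure_negligible_finite_Union)
       (auto simp: separated_intervals_def pairwise_def disjnt_def)
  then show "measure lebesgue (\<Union>C) = (\<Sum>K\<in>C. incr id K)" using lm by simp
qed

text \<open>
Points that are strictly inside arbitrarily short intervals with a given property. The intervals
need not be centred at the point; this makes the set a countable intersection of open sets, hence
measurable for any property at all.
\<close>

definition fine_points :: "(real \<Rightarrow> real \<Rightarrow> bool) \<Rightarrow> real set" where
  "fine_points Q = {x. \<forall>e>0. \<exists>u v. u < x \<and> x < v \<and> v - u < e \<and> Q u v}"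

lemma fine_pointsD:
  "x \<in> fine_points Q \<Longrightarrow> 0 < e \<Longrightarrow> \<exists>u v. u < x \<and> x < v \<and> v - u < e \<and> Q u v"
  by (simp add: fine_points_def)

lemma fine_points_borel: "fine_points Q \<in> sets borel"
proof -
  have "fine_points Q = (\<Inter>n::nat. \<Union>{{u<..<v} | u v. v - u < 1 / Suc n \<and> Q u v})"
  proof (intro set_eqI iffI)
    fix x assume "x \<in> fine_points Q"
    then have "\<exists>u v. x \<in> {u<..<v} \<and> v - u < 1 / Suc n \<and> Q u v" for n :: nat
      by (simp add: fine_points_def)
    then show "x \<in> (\<Inter>n::nat. \<Union>{{u<..<v} | u v. v - u < 1 / Suc n \<and> Q u v})" by blast
  next
    fix x assume x: "x \<in> (\<Inter>n::nat. \<Union>{{u<..<v} | u v. v - u < 1 / Suc n \<and> Q u v})"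
    show "x \<in> fine_points Q"
      unfolding fine_points_def
    proof (intro CollectI allI impI)
      fix e :: real assume "0 < e"
      then obtain n where n: "1 / real (Suc n) < e"
        using nat_approx_posE by blast
      from x obtain u v where "x \<in> {u<..<v}" "v - u < 1 / Suc n" "Q u v" by blast
      then show "\<exists>u v. u < x \<and> x < v \<and> v - u < e \<and> Q u v"
        using n by (intro exI[of _ u] exI[of _ v]) auto
    qed
  qed
  moreover have "\<dots> \<in> sets borel"
  proof (intro sets.countable_INT'' borel_open)
    fix n :: nat
    show "open (\<Union>{{u<..<v} | u v. v - u < 1 / Suc n \<and> Q u v})"
      by (rule open_Union) auto
  qed auto
  ultimately show ?thesis by simp
qed

text \<open>
Vitali's covering theorem for intervals, in the finite form: the intervals that witness fine points
contain finitely many disjoint ones that cover the set up to small measure.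
\<close>

lemma fine_points_vitali:
  assumes E: "E \<in> lmeasurable" and G: "open G" "E \<subseteq> G" "G \<subseteq> {c..d}" and e: "0 < e"
    and fine: "E \<subseteq> fine_points Q"
  shows "\<exists>C. separated_intervals c d C \<and>
    (\<forall>K\<in>C. K \<subseteq> G \<and> (\<exists>u v. K = {u..v} \<and> u < v \<and> Q u v)) \<and>
    measure lebesgue (E - \<Union>C) < e"
proof -
  define N where "N = {(u, v). u < v \<and> Q u v \<and> {u..v} \<subseteq> G}"
  define mid where "mid = (\<lambda>(u::real, v). (u + v) / 2)"
  define rad where "rad = (\<lambda>(u::real, v). (v - u) / 2)"
  define J where "J = (\<lambda>(u::real, v). {u..v})"
  have J: "cball (mid i) (rad i) = J i" for i
    by (cases i) (auto simp: mid_def rad_def J_def cball_eq_atLeastAtMost field_simps)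
  have "\<exists>i. i \<in> N \<and> x \<in> cball (mid i) (rad i) \<and> rad i < r" if x: "x \<in> E" and r: "0 < r" for x r
  proof -
    obtain \<rho> where \<rho>: "0 < \<rho>" "ball x \<rho> \<subseteq> G" using G x open_contains_ball by blast
    have "x \<in> fine_points Q" "0 < min r \<rho>" using fine x r \<rho>(1) by auto
    then obtain u v where uv: "u < x" "x < v" "v - u < min r \<rho>" "Q u v"
      using fine_pointsD by blast
    have "{u..v} \<subseteq> ball x \<rho>" using uv by (auto simp: dist_real_def)
    then have "(u, v) \<in> N" using uv \<rho> by (auto simp: N_def)
    moreover have "x \<in> J (u, v)" using uv by (simp add: J_def)
    moreover have "rad (u, v) < r" using uv r by (simp add: rad_def)
    ultimately show ?thesis using J by blast
  qed
  note cover = this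
  have rad: "0 < rad i" if "i \<in> N" for i using that by (auto simp: N_def rad_def)
  obtain C0 where C0: "countable C0" "C0 \<subseteq> N"
    "pairwise (\<lambda>i j. disjnt (J i) (J j)) C0" "negligible (E - (\<Union>i\<in>C0. J i))"
  proof (rule Vitali_covering_theorem_cballs[of N rad E mid, OF rad cover])
    fix C assume "countable C" "C \<subseteq> N"
      "pairwise (\<lambda>i j. disjnt (cball (mid i) (rad i)) (cball (mid j) (rad j))) C"
      "negligible (E - (\<Union>i\<in>C. cball (mid i) (rad i)))"
    then show thesis using that unfolding J by blast
  qed
  show ?thesis
  proof (cases "C0 = {}")
    case True
    then have "measure lebesgue (E - \<Union>{}) < e" using C0(4) e by (simp add: negligible_imp_measure0)
    then show ?thesis by (intro exI[of _ "{}"]) (auto simp: separated_intervals_def)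
  next
    case False
    \<comment> \<open>Finitely many of the countably many Vitali intervals suffice, since the parts of \<open>E\<close> that
      they leave uncovered decrease to a null set.\<close>
    define K where "K n = J (from_nat_into C0 n)" for n
    have Kin: "from_nat_into C0 n \<in> C0" for n using False by (simp add: from_nat_into)
    have UK: "(\<Union>n. K n) = (\<Union>i\<in>C0. J i)"
      unfolding K_def using range_from_nat_into[OF False C0(1)] by (metis image_image)
    define B where "B n = E - (\<Union>k\<le>n. K k)" for n
    have Bl: "B n \<in> lmeasurable" for n
    proof -
      have "K k \<in> lmeasurable" for k by (auto simp: K_def J_def split: prod.splits)
      then have "(\<Union>k\<le>n. K k) \<in> lmeasurable" by (intro fmeasurable.finite_UN) auto
      then show ?thesis unfolding B_def using E by (intro fmeasurable.Diff)
    qed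
    have "(\<lambda>n. measure lebesgue (B n)) \<longlonglongrightarrow> measure lebesgue (\<Inter>n. B n)"
    proof (rule Lim_measure_decseq)
      show "range B \<subseteq> sets lebesgue" using Bl by (auto simp: fmeasurable_def)
      show "decseq B" unfolding B_def decseq_def by fastforce
      show "emeasure lebesgue (B n) \<noteq> \<infinity>" for n using Bl[of n] by (auto simp: fmeasurable_def)
    qed
    moreover have "(\<Inter>n. B n) = E - (\<Union>n. K n)" unfolding B_def by auto
    ultimately have "(\<lambda>n. measure lebesgue (B n)) \<longlonglongrightarrow> 0"
      using C0(4) UK by (simp add: negligible_imp_measure0)
    then obtain n where n: "measure lebesgue (B n) < e"
      using e by (metis (no_types, lifting) eventually_happens order_tendstoD(2) trivial_limit_sequentially)
    have KN: "\<exists>u v. K k = {u..v} \<and> u < v \<and> Q u v \<and> {u..v} \<subseteq> G" for k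
      using Kin[of k] C0(2) by (auto simp: K_def N_def J_def)
    show ?thesis
    proof (intro exI[of _ "K ` {..n}"] conjI ballI)
      show "separated_intervals c d (K ` {..n})"
        unfolding separated_intervals_def
      proof (intro conjI ballI)
        show "finite (K ` {..n})" by simp
        fix L assume "L \<in> K ` {..n}"
        then obtain u v where L: "L = {u..v}" "u < v" "{u..v} \<subseteq> G" using KN by blast
        then have "{u..v} \<subseteq> {c..d}" using G(3) by blast
        then show "\<exists>u v. L = {u..v} \<and> u < v \<and> c \<le> u \<and> v \<le> d" using L by auto
      next
        show "pairwise disjnt (K ` {..n})"
        proof (rule pairwiseI)
          fix A B assume AB: "A \<in> K ` {..n}" "B \<in> K ` {..n}" "A \<noteq> B"
          then obtain k l where "A = K k" "B = K l" by auto
          then show "disjnt A B" using AB(3) C0(3) Kin unfolding K_def pairwise_def by metis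
        qed
      qed
      fix L assume "L \<in> K ` {..n}"
      then obtain k where "L = K k" by blast
      with KN[of k] show "L \<subseteq> G" "\<exists>u v. L = {u..v} \<and> u < v \<and> Q u v" by metis+
    next
      show "measure lebesgue (E - \<Union> (K ` {..n})) < e" using n by (simp add: B_def)
    qed
  qed
qed

lemma lmeasurable_outer_open_within:
  assumes "E \<in> lmeasurable" "E \<subseteq> U" "open U" "0 < e"
  obtains G where "open G" "E \<subseteq> G" "G \<subseteq> U" "G \<in> lmeasurable" "measure lebesgue G < measure lebesgue E + e"
proof -
  have "E \<in> sets lebesgue" using assms(1) by (simp add: fmeasurableD)
  then obtain T where T: "open T" "E \<subseteq> T" "(T - E) \<in> lmeasurable" "emeasure lebesgue (T - E) < ennreal e"
    using sets_lebesgue_outer_open assms(4) by metis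
  have "measure lebesgue (T - E) < e"
    using T(3,4) assms(4) by (simp add: emeasure_eq_measure2 ennreal_less_iff)
  moreover have "T = E \<union> (T - E)" using T by blast
  then have Tl: "T \<in> lmeasurable" and "measure lebesgue T \<le> measure lebesgue E + measure lebesgue (T - E)"
    using assms(1) T(3) by (metis fmeasurable.Un, metis measure_Un_le fmeasurableD)
  moreover have "T \<inter> U \<in> lmeasurable" using Tl assms(3)
    by (intro fmeasurable_Int_fmeasurable) auto
  moreover have "measure lebesgue (T \<inter> U) \<le> measure lebesgue T"
    using Tl calculation by (intro measure_mono_fmeasurable) auto
  ultimately show thesis
    using T assms by (intro that[of "T \<inter> U"]) auto
qed

text \<open>
An interval is connected, so it cannot meet the interiors of two disjoint intervals while being
covered by such interiors.
\<close>

lemma separated_intervals_refine: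
  assumes C: "separated_intervals c d C" and "u \<le> v" and J: "{u..v} \<subseteq> (\<Union>K\<in>C. interior K)"
  shows "\<exists>I\<in>C. {u..v} \<subseteq> I"
proof -
  obtain I where I: "I \<in> C" "u \<in> interior I" using J \<open>u \<le> v\<close> by fastforce
  define R where "R = (\<Union>K\<in>C - {I}. interior K)"
  have "interior I \<inter> interior K = {}" if "K \<in> C - {I}" for K
  proof -
    have "disjnt I K" using C I(1) that unfolding separated_intervals_def pairwise_def by blast
    then show ?thesis using interior_subset unfolding disjnt_def by blast
  qed
  then have dis: "interior I \<inter> R = {}" unfolding R_def by blast
  have cover: "{u..v} \<subseteq> interior I \<union> R" using J unfolding R_def by blast
  have "open R" unfolding R_def by (intro open_UN ballI open_interior)
  moreover have "interior I \<inter> R \<inter> {u..v} = {}" using dis by blast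
  ultimately have "interior I \<inter> {u..v} = {} \<or> R \<inter> {u..v} = {}"
    by (intro connectedD[OF connected_Icc open_interior _ _ cover])
  moreover have "u \<in> interior I \<inter> {u..v}" using I \<open>u \<le> v\<close> by simp
  ultimately have "R \<inter> {u..v} = {}" by blast
  then have "{u..v} \<subseteq> interior I" using cover by blast
  then show ?thesis using I interior_subset by blast
qed

text \<open>
The core of the differentiability theorem. Suppose that around each point of a set of positive
measure \<open>F\<close> both increases with slope above \<open>s\<close> and decreases with slope below \<open>-s\<close> on arbitrarily
short intervals. By Vitali, almost all of the set is covered by disjoint intervals of the first
kind, of little more total length, and within these almost all of it is covered again by disjoint
intervals of the second kind. The increments over the first family add up to at least a fixed
positive number, those over the second to a nonpositive one. But the two families differ only by
gaps of small total length, so absolute continuity makes the two sums almost equal.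
\<close>

lemma AC_on_oscillation_null:
  fixes F :: "real \<Rightarrow> real"
  assumes AC: "AC_on c d (\<lambda>x. of_real (F x))" and s: "0 < s"
  shows "negligible ({c<..<d} \<inter> fine_points (\<lambda>u v. s * (v - u) < F v - F u)
           \<inter> fine_points (\<lambda>u v. F v - F u < - s * (v - u)))"
    (is "negligible ?E")
proof (rule ccontr)
  assume nn: "\<not> negligible ?E"
  have E: "?E \<in> lmeasurable"
  proof -
    have "?E \<in> sets borel" using fine_points_borel by (intro sets.Int) auto
    then have "?E \<in> sets lebesgue" by auto
    moreover have "bounded ?E" by (rule bounded_subset[of "{c<..<d}"]) auto
    ultimately show ?thesis using bounded_set_imp_lmeasurable by blast
  qed
  define m where "m = measure lebesgue ?E"
  have m: "0 < m" using nn E unfolding m_def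
    by (simp add: negligible_iff_measure zero_less_measure_iff)
  define cF :: "real \<Rightarrow> complex" where "cF = (\<lambda>x. of_real (F x))"
  obtain \<delta> where \<delta>: "0 < \<delta>" and gap:
    "\<And>C D. \<lbrakk>separated_intervals c d C; separated_intervals c d D; \<And>J. J \<in> D \<Longrightarrow> \<exists>I\<in>C. J \<subseteq> I;
      (\<Sum>I\<in>C. incr id I) - (\<Sum>J\<in>D. incr id J) < \<delta>\<rbrakk> \<Longrightarrow>
      cmod ((\<Sum>I\<in>C. incr cF I) - (\<Sum>J\<in>D. incr cF J)) < s * m / 2"
    using AC_on_gap[of c d cF "s * m / 2"] AC s m unfolding cF_def by auto
  \<comment> \<open>The two families below have total lengths in \<open>(m - \<eta>, m + \<eta>)\<close> and above \<open>m - 2\<eta>\<close>, so they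
    differ by less than \<open>3\<eta> \<le> \<delta>\<close>; and \<open>\<eta> \<le> m/2\<close> makes the increments over the first family
    add up to at least \<open>s m / 2\<close>.\<close>
  define \<eta> where "\<eta> = min (m / 2) (\<delta> / 3)"
  have \<eta>: "0 < \<eta>" "2 * \<eta> \<le> m" "3 * \<eta> \<le> \<delta>" using m \<delta> by (auto simp: \<eta>_def)
  obtain G where G: "open G" "?E \<subseteq> G" "G \<subseteq> {c<..<d}" "G \<in> lmeasurable" "measure lebesgue G < m + \<eta>"
    using lmeasurable_outer_open_within[OF E, of "{c<..<d}" \<eta>] \<eta>(1) unfolding m_def by auto
  have "G \<subseteq> {c..d}" using G(3) by auto
  moreover have "?E \<subseteq> fine_points (\<lambda>u v. s * (v - u) < F v - F u)" by blast
  ultimately have "\<exists>C. separated_intervals c d C \<and>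
    (\<forall>K\<in>C. K \<subseteq> G \<and> (\<exists>u v. K = {u..v} \<and> u < v \<and> s * (v - u) < F v - F u)) \<and>
    measure lebesgue (?E - \<Union>C) < \<eta>"
    by (rule fine_points_vitali[OF E G(1,2) _ \<eta>(1)])
  then
  obtain C where C: "separated_intervals c d C"
    "\<forall>K\<in>C. K \<subseteq> G \<and> (\<exists>u v. K = {u..v} \<and> u < v \<and> s * (v - u) < F v - F u)"
    "measure lebesgue (?E - \<Union>C) < \<eta>"
    by (elim exE conjE) (rule that)
  \<comment> \<open>Choosing the second family inside this open set forces each of its intervals into a single
    interval of the first family.\<close>
  define W where "W = (\<Union>K\<in>C. interior K)"
  have finC: "finite C" using C(1) by (simp add: separated_intervals_def)
  have E1: "?E \<inter> W \<in> lmeasurable"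
  proof (rule fmeasurable_Int_fmeasurable[OF E])
    have "open W" unfolding W_def by (intro open_UN ballI open_interior)
    then show "W \<in> sets lebesgue" by auto
  qed
  have WC: "negligible (\<Union>C - W)"
  proof (rule negligible_subset)
    show "negligible (\<Union>K\<in>C. {Inf K, Sup K})" using finC by (intro negligible_Union) auto
    show "\<Union>C - W \<subseteq> (\<Union>K\<in>C. {Inf K, Sup K})"
    proof
      fix x assume x: "x \<in> \<Union>C - W"
      then obtain K where K: "K \<in> C" "x \<in> K" "x \<notin> interior K" by (auto simp: W_def)
      obtain u v where "K = {u..v}" "u < v" using C(2) K(1) by blast
      then have "x \<in> {Inf K, Sup K}" using K by auto
      then show "x \<in> (\<Union>K\<in>C. {Inf K, Sup K})" using K(1) by blast
    qed
  qed
  have mE1: "m - \<eta> < measure lebesgue (?E \<inter> W)"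
  proof -
    have UC: "\<Union>C \<in> lmeasurable" by (rule measure_separated_intervals[OF C(1)])
    have A: "?E - \<Union>C \<in> lmeasurable" "\<Union>C - W \<in> lmeasurable" "measure lebesgue (\<Union>C - W) = 0"
      using E UC WC by (auto simp: negligible_iff_measure intro: fmeasurable.Diff)
    have "m \<le> measure lebesgue ((?E \<inter> W) \<union> (?E - \<Union>C) \<union> (\<Union>C - W))"
      unfolding m_def
    proof (rule measure_mono_fmeasurable)
      show "?E \<in> sets lebesgue" using E by (rule fmeasurableD)
      show "?E \<inter> W \<union> (?E - \<Union>C) \<union> (\<Union>C - W) \<in> lmeasurable"
        using A E1 by (intro fmeasurable.Un)
    qed auto
    also have "\<dots> \<le> measure lebesgue ((?E \<inter> W) \<union> (?E - \<Union>C)) + measure lebesgue (\<Union>C - W)"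
      using A E1 by (intro measure_Un_le fmeasurableD fmeasurable.Un)
    also have "\<dots> \<le> measure lebesgue (?E \<inter> W) + measure lebesgue (?E - \<Union>C) + 0"
      using A E1 by (intro add_mono measure_Un_le fmeasurableD) auto
    finally show ?thesis using C(3) by linarith
  qed
  have W: "open W" "?E \<inter> W \<subseteq> W"
    unfolding W_def by (intro open_UN ballI open_interior) auto
  have "W \<subseteq> \<Union>C" using interior_subset by (fastforce simp: W_def)
  also have "\<dots> \<subseteq> {c..d}" using C(2) G(3) by fastforce
  finally have "W \<subseteq> {c..d}" .
  moreover have "?E \<inter> W \<subseteq> fine_points (\<lambda>u v. F v - F u < - s * (v - u))" by blast
  ultimately have "\<exists>D. separated_intervals c d D \<and>
    (\<forall>K\<in>D. K \<subseteq> W \<and> (\<exists>u v. K = {u..v} \<and> u < v \<and> F v - F u < - s * (v - u))) \<and>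
    measure lebesgue (?E \<inter> W - \<Union>D) < \<eta>"
    by (rule fine_points_vitali[OF E1 W _ \<eta>(1)])
  then
  obtain D where D: "separated_intervals c d D"
    "\<forall>K\<in>D. K \<subseteq> W \<and> (\<exists>u v. K = {u..v} \<and> u < v \<and> F v - F u < - s * (v - u))"
    "measure lebesgue (?E \<inter> W - \<Union>D) < \<eta>"
    by (elim exE conjE) (rule that)
  have sub: "\<exists>I\<in>C. J \<subseteq> I" if J: "J \<in> D" for J
  proof -
    obtain u v where uv: "J = {u..v}" "u < v" "J \<subseteq> W" using bspec[OF D(2) J] by metis
    show ?thesis
      unfolding uv(1)
    proof (rule separated_intervals_refine[OF C(1)])
      show "{u..v} \<subseteq> (\<Union>K\<in>C. interior K)" using uv(1,3) unfolding W_def by simp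
    qed (use uv in simp)
  qed
  have lenC: "(\<Sum>I\<in>C. incr id I) < m + \<eta>" "m - \<eta> < (\<Sum>I\<in>C. incr id I)"
  proof -
    note M = measure_separated_intervals[OF C(1)]
    have "\<Union>C \<subseteq> G" using C(2) by blast
    then have "measure lebesgue (\<Union>C) \<le> measure lebesgue G"
      using M G by (intro measure_mono_fmeasurable) auto
    then show "(\<Sum>I\<in>C. incr id I) < m + \<eta>" using M G by simp
    have "W \<subseteq> \<Union>C" using interior_subset by (fastforce simp: W_def)
    then have "measure lebesgue (?E \<inter> W) \<le> measure lebesgue (\<Union>C)"
      using M E1 by (intro measure_mono_fmeasurable) auto
    then show "m - \<eta> < (\<Sum>I\<in>C. incr id I)" using M mE1 by simp
  qed
  have lenD: "m - 2 * \<eta> < (\<Sum>J\<in>D. incr id J)"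
  proof -
    note M = measure_separated_intervals[OF D(1)]
    have "measure lebesgue (?E \<inter> W) \<le> measure lebesgue (\<Union>D \<union> (?E \<inter> W - \<Union>D))"
      using M E1 by (intro measure_mono_fmeasurable fmeasurable.Un fmeasurable.Diff fmeasurableD) auto
    also have "\<dots> \<le> measure lebesgue (\<Union>D) + measure lebesgue (?E \<inter> W - \<Union>D)"
      using M E1 by (intro measure_Un_le) (auto intro!: fmeasurableD)
    finally show ?thesis using M D(3) mE1 by linarith
  qed
  have re: "(\<Sum>I\<in>X. incr cF I) = of_real (\<Sum>I\<in>X. incr F I)" for X
    by (simp add: incr_def cF_def)
  have "cmod ((\<Sum>I\<in>C. incr cF I) - (\<Sum>J\<in>D. incr cF J)) < s * m / 2"
    by (rule gap[OF C(1) D(1) sub]) (use lenC lenD \<eta> in auto)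
  then have small: "(\<Sum>I\<in>C. incr F I) - (\<Sum>J\<in>D. incr F J) < s * m / 2"
    unfolding re of_real_diff[symmetric] norm_of_real by linarith
  have "s * (m / 2) \<le> s * (\<Sum>I\<in>C. incr id I)"
    by (rule mult_left_mono) (use s lenC(2) \<eta>(2) in linarith)+
  also have "\<dots> = (\<Sum>I\<in>C. s * incr id I)" by (rule sum_distrib_left)
  also have "\<dots> \<le> (\<Sum>I\<in>C. incr F I)"
  proof (rule sum_mono)
    fix I assume "I \<in> C"
    from bspec[OF C(2) this] obtain u v where I: "I = {u..v}" "u < v" "s * (v - u) < F v - F u"
      by metis
    then show "s * incr id I \<le> incr F I" by simp
  qed
  also have "\<dots> < s * m / 2 + (\<Sum>J\<in>D. incr F J)" using small by linarith
  also have "(\<Sum>J\<in>D. incr F J) \<le> 0"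
  proof (rule sum_nonpos)
    fix I assume "I \<in> D"
    from bspec[OF D(2) this] obtain u v where I: "I = {u..v}" "u < v" "F v - F u < - s * (v - u)"
      by metis
    then show "incr F I \<le> 0" using mult_pos_pos[OF s, of "v - u"] by simp
  qed
  finally show False by simp
qed

text \<open>
Difference quotients are unbounded only on a null set, because an absolutely continuous function
has small total variation on a short interval.
\<close>

lemma AC_on_steep_null:
  assumes AC: "AC_on c d F"
  shows "negligible ({c<..<d} \<inter> (\<Inter>n. fine_points (\<lambda>u v. real n * (v - u) < cmod (F v - F u))))"
    (is "negligible ?E")
proof -
  obtain \<delta> where \<delta>: "0 < \<delta>"
    and small: "\<forall>(I::real set set) u v. finite I \<and> (\<forall>i\<in>I. c \<le> u i \<and> u i \<le> v i \<and> v i \<le> d) \<and>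
      disjoint_family_on (\<lambda>i. {u i<..<v i}) I \<and> (\<Sum>i\<in>I. v i - u i) < \<delta> \<longrightarrow>
      (\<Sum>i\<in>I. cmod (F (v i) - F (u i))) < 1"
    using AC_on_finite_family[OF AC, of 1] by fastforce
  \<comment> \<open>Near \<open>x\<close> every disjoint family has total length below \<open>\<delta>\<close>, so its increments add up to less
    than 1; steepness \<open>n\<close> then bounds the measure by about \<open>1 / n\<close>.\<close>
  have local: "negligible (?E \<inter> {x - \<delta>/3<..<x + \<delta>/3})" (is "negligible ?A") for x
  proof (rule ccontr)
    assume nn: "\<not> negligible ?A"
    have A: "?A \<in> lmeasurable"
    proof -
      have "?A \<in> sets borel" using fine_points_borel
        by (intro sets.Int sets.countable_INT'') auto
      then have "?A \<in> sets lebesgue" by auto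
      moreover have "bounded ?A" by (rule bounded_subset[of "{c<..<d}"]) auto
      ultimately show ?thesis using bounded_set_imp_lmeasurable by blast
    qed
    define m where "m = measure lebesgue ?A"
    have m: "0 < m" using nn A unfolding m_def
      by (simp add: negligible_iff_measure zero_less_measure_iff)
    obtain n :: nat where "2 / m < real n" using reals_Archimedean2 by blast
    then have n: "1 < real n * (m / 2)" using m by (simp add: field_simps)
    define G where "G = {c<..<d} \<inter> {x - \<delta>/3<..<x + \<delta>/3}"
    have G: "open G" "?A \<subseteq> G" "G \<subseteq> {c..d}" by (auto simp: G_def)
    have fine: "?A \<subseteq> fine_points (\<lambda>u v. real n * (v - u) < cmod (F v - F u))" by blast
    have "\<exists>C. separated_intervals c d C \<and>
      (\<forall>K\<in>C. K \<subseteq> G \<and> (\<exists>u v. K = {u..v} \<and> u < v \<and> real n * (v - u) < cmod (F v - F u))) \<and>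
      measure lebesgue (?A - \<Union>C) < m / 2"
      by (rule fine_points_vitali[OF A G _ fine]) (use m in simp)
    then obtain C where C: "separated_intervals c d C"
      "\<forall>K\<in>C. K \<subseteq> G \<and> (\<exists>u v. K = {u..v} \<and> u < v \<and> real n * (v - u) < cmod (F v - F u))"
      "measure lebesgue (?A - \<Union>C) < m / 2"
      by (elim exE conjE) (rule that)
    note M = measure_separated_intervals[OF C(1)]
    have "m \<le> measure lebesgue (\<Union>C \<union> (?A - \<Union>C))"
      unfolding m_def
    proof (rule measure_mono_fmeasurable)
      show "?A \<in> sets lebesgue" using A by (rule fmeasurableD)
      show "\<Union>C \<union> (?A - \<Union>C) \<in> lmeasurable" using A M(1) by (intro fmeasurable.Un fmeasurable.Diff)
    qed auto
    also have "\<dots> \<le> measure lebesgue (\<Union>C) + measure lebesgue (?A - \<Union>C)"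
      using A M(1) by (intro measure_Un_le fmeasurableD fmeasurable.Diff)
    finally have len: "m / 2 < (\<Sum>K\<in>C. incr id K)" using C(3) M(2) by linarith
    have "\<Union>C \<subseteq> {x - \<delta>/3<..<x + \<delta>/3}" using C(2) unfolding G_def by blast
    then have "measure lebesgue (\<Union>C) \<le> measure lebesgue {x - \<delta>/3<..<x + \<delta>/3}"
      using M(1) by (intro measure_mono_fmeasurable fmeasurableD) auto
    then have len2: "(\<Sum>K\<in>C. incr id K) < \<delta>" using M(2) \<delta> by simp
    have CK: "\<exists>u v. K = {u..v} \<and> u < v \<and> c \<le> u \<and> v \<le> d" if "K \<in> C" for K
      using C(1) that unfolding separated_intervals_def by blast
    have h0: "finite C" using C(1) by (simp add: separated_intervals_def)
    have h1: "\<forall>K\<in>C. c \<le> Inf K \<and> Inf K \<le> Sup K \<and> Sup K \<le> d"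
    proof
      fix K assume "K \<in> C"
      from CK[OF this] show "c \<le> Inf K \<and> Inf K \<le> Sup K \<and> Sup K \<le> d" by auto
    qed
    have h2: "disjoint_family_on (\<lambda>K. {Inf K<..<Sup K}) C"
      unfolding disjoint_family_on_def
    proof (intro ballI impI)
      fix K L assume KL: "K \<in> C" "L \<in> C" "K \<noteq> L"
      have sub: "{Inf K<..<Sup K} \<subseteq> K" if "K \<in> C" for K using CK[OF that] by auto
      have "disjnt K L" using C(1) KL unfolding separated_intervals_def pairwise_def by blast
      then show "{Inf K<..<Sup K} \<inter> {Inf L<..<Sup L} = {}"
        using sub[OF KL(1)] sub[OF KL(2)] unfolding disjnt_def by blast
    qed
    have h3: "(\<Sum>K\<in>C. Sup K - Inf K) < \<delta>" using len2 by (simp add: incr_def)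
    have "real n * (m / 2) \<le> real n * (\<Sum>K\<in>C. incr id K)" using len by (intro mult_left_mono) auto
    also have "\<dots> = (\<Sum>K\<in>C. real n * incr id K)" by (rule sum_distrib_left)
    also have "\<dots> \<le> (\<Sum>K\<in>C. cmod (F (Sup K) - F (Inf K)))"
    proof (rule sum_mono)
      fix I assume "I \<in> C"
      from bspec[OF C(2) this] obtain u v
        where I: "I = {u..v}" "u < v" "real n * (v - u) < cmod (F v - F u)" by metis
      then show "real n * incr id I \<le> cmod (F (Sup I) - F (Inf I))" by simp
    qed
    also have "\<dots> < 1"
      by (rule small[rule_format, OF conjI[OF h0 conjI[OF h1 conjI[OF h2 h3]]]])
    finally show False using n by simp
  qed
  show ?thesis
    unfolding locally_negligible_alt[of ?E]
  proof
    fix x assume "x \<in> ?E"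
    then have "x \<in> ?E \<inter> {x - \<delta>/3<..<x + \<delta>/3}" using \<delta> by auto
    moreover have "openin (top_of_set ?E) (?E \<inter> {x - \<delta>/3<..<x + \<delta>/3})"
      by (rule openin_open_Int) auto
    ultimately show "\<exists>U. openin (top_of_set ?E) U \<and> x \<in> U \<and> negligible U"
      using local[of x] by blast
  qed
qed

text \<open>
A condition on all sufficiently short intervals \<open>(u,v)\<close> that contain \<open>x\<close>: the complementary notion
to fine points.
\<close>

definition eventually_straddling :: "real \<Rightarrow> (real \<Rightarrow> real \<Rightarrow> bool) \<Rightarrow> bool" where
  "eventually_straddling x Q \<longleftrightarrow> (\<exists>e>0. \<forall>u v. u < x \<and> x < v \<and> v - u < e \<longrightarrow> Q u v)"

lemma not_fine_point: "x \<notin> fine_points Q \<Longrightarrow> eventually_straddling x (\<lambda>u v. \<not> Q u v)"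
  by (auto simp: fine_points_def eventually_straddling_def)

lemma eventually_straddling_conj:
  assumes "eventually_straddling x P" "eventually_straddling x Q"
  shows "eventually_straddling x (\<lambda>u v. P u v \<and> Q u v)"
proof -
  obtain e1 e2 where "0 < e1" "\<forall>u v. u < x \<and> x < v \<and> v - u < e1 \<longrightarrow> P u v"
    "0 < e2" "\<forall>u v. u < x \<and> x < v \<and> v - u < e2 \<longrightarrow> Q u v"
    using assms unfolding eventually_straddling_def by blast
  then show ?thesis
    unfolding eventually_straddling_def by (intro exI[of _ "min e1 e2"]) auto
qed

lemma eventually_straddling_mono:
  assumes "eventually_straddling x P" "\<And>u v. u < x \<Longrightarrow> x < v \<Longrightarrow> P u v \<Longrightarrow> Q u v"
  shows "eventually_straddling x Q"
  using assms unfolding eventually_straddling_def by blast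

lemma eventually_straddling_ex:
  assumes "eventually_straddling x P"
  shows "\<exists>u v. u < x \<and> x < v \<and> P u v"
proof -
  obtain e where "0 < e" "\<forall>u v. u < x \<and> x < v \<and> v - u < e \<longrightarrow> P u v"
    using assms unfolding eventually_straddling_def by blast
  then show ?thesis by (intro exI[of _ "x - e/3"] exI[of _ "x + e/3"]) auto
qed

text \<open>
For a continuous function, control of the difference quotients over intervals that contain \<open>x\<close>
in the interior passes to one-sided quotients at \<open>x\<close> by letting one end tend to \<open>x\<close>.
\<close>

lemma straddle_DERIV:
  fixes F :: "real \<Rightarrow> real"
  assumes cont: "isCont F x"
    and L: "\<And>e. 0 < e \<Longrightarrow> eventually_straddling x (\<lambda>u v. \<bar>F v - F u - L * (v - u)\<bar> \<le> e * (v - u))"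
  shows "(F has_real_derivative L) (at x)"
  unfolding has_field_derivative_def has_derivative_at_alt
proof (intro conjI allI impI)
  show "bounded_linear ((*) L)" by (rule bounded_linear_mult_right)
  fix e :: real assume "0 < e"
  from L[OF this] obtain \<delta> where \<delta>: "0 < \<delta>"
    and st: "\<And>u v. u < x \<Longrightarrow> x < v \<Longrightarrow> v - u < \<delta> \<Longrightarrow> \<bar>F v - F u - L * (v - u)\<bar> \<le> e * (v - u)"
    unfolding eventually_straddling_def by blast
  have right: "\<bar>F v - F x - L * (v - x)\<bar> \<le> e * (v - x)" if v: "x < v" "v - x < \<delta>" for v
  proof (rule tendsto_le[of "at_left x"])
    show "((\<lambda>u. \<bar>F v - F u - L * (v - u)\<bar>) \<longlongrightarrow> \<bar>F v - F x - L * (v - x)\<bar>) (at_left x)"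
      using cont by (intro tendsto_intros) (auto simp: isCont_def intro: tendsto_within_subset)
    show "((\<lambda>u. e * (v - u)) \<longlongrightarrow> e * (v - x)) (at_left x)" by (intro tendsto_intros)
    have "\<forall>\<^sub>F u in at_left x. u \<in> {v - \<delta><..<x}"
      using v by (intro eventually_at_left_real) auto
    then show "\<forall>\<^sub>F u in at_left x. \<bar>F v - F u - L * (v - u)\<bar> \<le> e * (v - u)"
      by eventually_elim (use v in \<open>auto intro!: st\<close>)
  qed auto
  have left: "\<bar>F x - F u - L * (x - u)\<bar> \<le> e * (x - u)" if u: "u < x" "x - u < \<delta>" for u
  proof (rule tendsto_le[of "at_right x"])
    show "((\<lambda>v. \<bar>F v - F u - L * (v - u)\<bar>) \<longlongrightarrow> \<bar>F x - F u - L * (x - u)\<bar>) (at_right x)"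
      using cont by (intro tendsto_intros) (auto simp: isCont_def intro: tendsto_within_subset)
    show "((\<lambda>v. e * (v - u)) \<longlongrightarrow> e * (x - u)) (at_right x)" by (intro tendsto_intros)
    have "\<forall>\<^sub>F v in at_right x. v \<in> {x<..<u + \<delta>}"
      using u by (intro eventually_at_right_real) auto
    then show "\<forall>\<^sub>F v in at_right x. \<bar>F v - F u - L * (v - u)\<bar> \<le> e * (v - u)"
      by eventually_elim (use u in \<open>auto intro!: st\<close>)
  qed auto
  show "\<exists>\<delta>>0. \<forall>y. norm (y - x) < \<delta> \<longrightarrow> norm (F y - F x - L * (y - x)) \<le> e * norm (y - x)"
  proof (intro exI[of _ \<delta>] conjI \<delta> allI impI)
    fix y assume y: "norm (y - x) < \<delta>"
    consider "y = x" | "x < y" | "y < x" by linarith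
    then show "norm (F y - F x - L * (y - x)) \<le> e * norm (y - x)"
    proof cases
      case 2 then show ?thesis using right[of y] y by simp
    next
      case 3
      have "\<bar>F y - F x - L * (y - x)\<bar> = \<bar>F x - F y - L * (x - y)\<bar>" by (simp add: algebra_simps abs_if)
      then show ?thesis using left[of y] y 3 by simp
    qed simp
  qed
qed

text \<open>
If straddling difference quotients at \<open>x\<close> neither are unbounded nor stay both above \<open>q\<close> and below
\<open>p\<close> for rationals \<open>p < q\<close> on arbitrarily short intervals, then they converge. Countably many null
sets are excluded in this way.
\<close>

lemma AC_on_real_differentiable_ae:
  fixes F :: "real \<Rightarrow> real"
  assumes AC: "AC_on c d (\<lambda>x. of_real (F x))"
  shows "\<exists>N. negligible N \<and> (\<forall>x\<in>{c<..<d} - N. \<exists>L. (F has_real_derivative L) (at x))"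
proof -
  define A where "A = {c<..<d} \<inter>
    (\<Inter>n. fine_points (\<lambda>u v. real n * (v - u) < cmod (of_real (F v) - of_real (F u))))"
  define B where "B p q = {c<..<d} \<inter> fine_points (\<lambda>u v. q * (v - u) < F v - F u)
      \<inter> fine_points (\<lambda>u v. F v - F u < p * (v - u))" for p q
  have A: "negligible A" unfolding A_def by (rule AC_on_steep_null[OF AC])
  have B: "negligible (B p q)" if "p < q" for p q
  proof -
    \<comment> \<open>Subtracting the mean slope makes the two slopes \<open>\<plusminus>(q - p) / 2\<close>.\<close>
    define G where "G = (\<lambda>x. F x - (p + q) / 2 * x)"
    have "AC_on c d (\<lambda>x. of_real (F x) + of_real (- (p + q) / 2) * of_real x)"
      by (intro AC_on_add AC_on_mult AC AC_on_const AC_on_of_real_id)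
    moreover have "(\<lambda>x. of_real (F x) + of_real (- (p + q) / 2) * of_real x) = (\<lambda>x. complex_of_real (G x))"
      by (simp add: G_def fun_eq_iff field_simps)
    ultimately have G: "AC_on c d (\<lambda>x. complex_of_real (G x))" by simp
    have "((q - p) / 2 * (v - u) < G v - G u) = (q * (v - u) < F v - F u)"
      "(G v - G u < - ((q - p) / 2) * (v - u)) = (F v - F u < p * (v - u))" for u v
      by (auto simp: G_def field_simps)
    with AC_on_oscillation_null[OF G, of "(q - p) / 2"] that show ?thesis
      by (simp add: B_def)
  qed
  define N where "N = A \<union> (\<Union>(p, q)\<in>{(p, q) \<in> \<rat> \<times> \<rat>. p < q}. B p q)"
  have "countable {(p :: real, q :: real) \<in> \<rat> \<times> \<rat>. p < q}"
    by (rule countable_subset[of _ "\<rat> \<times> \<rat>"]) (auto intro: countable_SIGMA countable_rat)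
  then have "negligible (\<Union>(p, q)\<in>{(p, q) \<in> \<rat> \<times> \<rat>. p < q}. B p q)"
    using B by (intro negligible_countable_Union) auto
  then have N: "negligible N" unfolding N_def using A by (intro negligible_Un)
  have "\<exists>L. (F has_real_derivative L) (at x)" if x: "x \<in> {c<..<d} - N" for x
  proof -
    have "x \<notin> A" using x by (simp add: N_def)
    then obtain n where "x \<notin> fine_points (\<lambda>u v. real n * (v - u) < cmod (of_real (F v) - of_real (F u)))"
      using x by (auto simp: A_def)
    from not_fine_point[OF this]
    have bd: "eventually_straddling x (\<lambda>u v. \<bar>F v - F u\<bar> \<le> real n * (v - u))"
      by (simp add: not_less flip: of_real_diff)
    have dich: "eventually_straddling x (\<lambda>u v. F v - F u \<le> q * (v - u)) \<or>
        eventually_straddling x (\<lambda>u v. p * (v - u) \<le> F v - F u)"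
      if pq: "p \<in> \<rat>" "q \<in> \<rat>" "p < q" for p q
    proof -
      have "x \<notin> B p q" using x pq by (auto simp: N_def)
      then have "x \<notin> fine_points (\<lambda>u v. q * (v - u) < F v - F u) \<or>
          x \<notin> fine_points (\<lambda>u v. F v - F u < p * (v - u))"
        using x by (simp add: B_def)
      then show ?thesis
      proof
        assume "x \<notin> fine_points (\<lambda>u v. q * (v - u) < F v - F u)"
        from not_fine_point[OF this] show ?thesis by (simp add: not_less)
      next
        assume "x \<notin> fine_points (\<lambda>u v. F v - F u < p * (v - u))"
        from not_fine_point[OF this] show ?thesis by (simp add: not_less)
      qed
    qed
    \<comment> \<open>The derivative is the supremum of the slopes that are eventually exceeded: the lower bounds
      hold by choice of the supremum, the upper bounds by the dichotomy for rational slopes.\<close>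
    define S where "S = {p. eventually_straddling x (\<lambda>u v. p * (v - u) \<le> F v - F u)}"
    have Sn: "- real n \<in> S"
      unfolding S_def using eventually_straddling_mono[OF bd] by simp
    have Sb: "p \<le> real n" if "p \<in> S" for p
    proof -
      have "eventually_straddling x (\<lambda>u v. p * (v - u) \<le> F v - F u \<and> \<bar>F v - F u\<bar> \<le> real n * (v - u))"
        using that bd unfolding S_def by (intro eventually_straddling_conj) auto
      from eventually_straddling_ex[OF this] obtain u v
        where uv: "u < x" "x < v" "p * (v - u) \<le> F v - F u" "\<bar>F v - F u\<bar> \<le> real n * (v - u)" by blast
      then have "p * (v - u) \<le> real n * (v - u)" by linarith
      then show ?thesis using uv by simp
    qed
    have bdd: "bdd_above S" using Sb by (rule bdd_aboveI)
    define L where "L = Sup S"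
    have "(F has_real_derivative L) (at x)"
    proof (rule straddle_DERIV)
      have "continuous_on {c..d} (\<lambda>x. Re (of_real (F x)))"
        by (intro continuous_intros AC_on_continuous_on AC)
      then show "isCont F x"
        using x by (auto intro: continuous_on_interior)
      fix e :: real assume e: "0 < e"
      obtain p where p: "p \<in> S" "L - e < p"
        using less_cSup_iff[of S "L - e"] Sn bdd e unfolding L_def by auto
      have low: "eventually_straddling x (\<lambda>u v. p * (v - u) \<le> F v - F u)" using p by (simp add: S_def)
      obtain q1 where q1: "q1 \<in> \<rat>" "L < q1" "q1 < L + e" using Rats_dense_in_real[of L "L + e"] e by auto
      obtain q2 where q2: "q2 \<in> \<rat>" "q1 < q2" "q2 < L + e" using Rats_dense_in_real[of q1 "L + e"] q1 by auto
      have "q1 \<notin> S" using q1(2) cSup_upper[OF _ bdd] unfolding L_def by fastforce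
      then have up: "eventually_straddling x (\<lambda>u v. F v - F u \<le> q2 * (v - u))"
        using dich[OF q1(1) q2(1) q2(2)] by (simp add: S_def)
      show "eventually_straddling x (\<lambda>u v. \<bar>F v - F u - L * (v - u)\<bar> \<le> e * (v - u))"
      proof (rule eventually_straddling_mono[OF eventually_straddling_conj[OF low up]])
        fix u v assume uv: "u < x" "x < v" and *: "p * (v - u) \<le> F v - F u \<and> F v - F u \<le> q2 * (v - u)"
        have "(L - e) * (v - u) \<le> p * (v - u)" "q2 * (v - u) \<le> (L + e) * (v - u)"
          using p q2 uv by (auto intro!: mult_right_mono)
        then show "\<bar>F v - F u - L * (v - u)\<bar> \<le> e * (v - u)"
          using * unfolding abs_le_iff by (simp add: algebra_simps)
      qed
    qed
    then show ?thesis by blast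
  qed
  then show ?thesis using N by blast
qed

lemma AC_on_differentiable_ae:
  assumes "AC_on c d F"
  shows "\<exists>N. negligible N \<and> (\<forall>x\<in>{c<..<d} - N. F differentiable (at x))"
proof -
  obtain N1 where N1: "negligible N1" "\<forall>x\<in>{c<..<d} - N1. \<exists>L. ((\<lambda>x. Re (F x)) has_real_derivative L) (at x)"
    using AC_on_real_differentiable_ae[OF AC_on_Re[OF assms]] by blast
  obtain N2 where N2: "negligible N2" "\<forall>x\<in>{c<..<d} - N2. \<exists>L. ((\<lambda>x. Im (F x)) has_real_derivative L) (at x)"
    using AC_on_real_differentiable_ae[OF AC_on_Im[OF assms]] by blast
  have "F differentiable (at x)" if x: "x \<in> {c<..<d} - (N1 \<union> N2)" for x
  proof -
    obtain a b where "((\<lambda>x. Re (F x)) has_real_derivative a) (at x)"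
        "((\<lambda>x. Im (F x)) has_real_derivative b) (at x)"
      using N1(2) N2(2) x by blast
    then have "(F has_vector_derivative Complex a b) (at x)"
      by (simp add: has_vector_derivative_complex_iff has_real_derivative_iff_has_vector_derivative)
    then show ?thesis by (rule differentiableI_vector)
  qed
  then show ?thesis using N1(1) N2(1) negligible_Un by blast
qed

section \<open>The fundamental theorem of calculus\<close>

text \<open>
The fundamental theorem of calculus for absolutely continuous functions, for the gauge
integral, where integrability of the derivative is part of the conclusion.
\<close>

lemma AC_on_FTC:
  assumes AC: "AC_on c d F" and cd: "c \<le> d" and N: "negligible N"
    and der: "\<And>x. x \<in> {c<..<d} - N \<Longrightarrow> (F has_vector_derivative k x) (at x)"
  shows "(k has_integral (F d - F c)) {c..d}"
proof (cases "c = d")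
  case False
  with cd have less: "c < d" by simp
  define N' where "N' = N \<union> {c, d}"
  have N': "negligible N'" using N by (auto simp: N'_def negligible_Un)
  \<comment> \<open>On the exceptional null set the integrand may be anything; with the value 0 there, the tags in
    that set contribute only increments of \<open>F\<close> to the Riemann sum.\<close>
  define k0 where "k0 x = (if x \<in> N' then 0 else k x)" for x
  have "(k0 has_integral (F d - F c)) {c..d}"
    unfolding has_integral_factor_content_real
  proof (intro allI impI)
    fix e :: real assume e: "0 < e"
    define e2 where "e2 = e * (d - c) / 2"
    have e2: "0 < e2" using e less by (simp add: e2_def)
    obtain \<delta> where \<delta>: "0 < \<delta>"
      and small: "\<forall>(I::(real \<times> real set) set) u v. finite I \<and> (\<forall>i\<in>I. c \<le> u i \<and> u i \<le> v i \<and> v i \<le> d) \<and>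
        disjoint_family_on (\<lambda>i. {u i<..<v i}) I \<and> (\<Sum>i\<in>I. v i - u i) < \<delta> \<longrightarrow>
        (\<Sum>i\<in>I. cmod (F (v i) - F (u i))) < e2"
      using AC_on_finite_family[OF AC e2] by blast
    have N'm: "N' \<in> lmeasurable" "measure lebesgue N' = 0"
      using N' by (auto simp: negligible_iff_measure)
    obtain T where T: "open T" "N' \<subseteq> T" "T \<in> lmeasurable" "measure lebesgue T < \<delta>"
      using lmeasurable_outer_open_within[OF N'm(1) _ open_UNIV \<delta>] N'm(2) by auto
    have "\<exists>r>0. \<forall>y. norm (y - x) < r \<longrightarrow> norm (F y - F x - (y - x) *\<^sub>R k x) \<le> e / 2 * norm (y - x)"
      if "x \<in> {c..d} - N'" for x
    proof -
      have "x \<in> {c<..<d} - N" using that by (auto simp: N'_def)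
      then have "(F has_derivative (\<lambda>h. h *\<^sub>R k x)) (at x)"
        using der unfolding has_vector_derivative_def by blast
      moreover have "0 < e / 2" using e by simp
      ultimately show ?thesis unfolding has_derivative_at_alt by blast
    qed
    then obtain r where r: "\<And>x. x \<in> {c..d} - N' \<Longrightarrow> 0 < r x"
      "\<And>x y. x \<in> {c..d} - N' \<Longrightarrow> norm (y - x) < r x \<Longrightarrow>
         norm (F y - F x - (y - x) *\<^sub>R k x) \<le> e / 2 * norm (y - x)"
      by metis
    \<comment> \<open>Intervals with an exceptional tag must lie in an open set of measure below \<open>\<delta>\<close>, where
      absolute continuity controls the increments; the other ones are so short that the
      differential approximates the increment.\<close>
    define \<gamma> where "\<gamma> x = (if x \<in> N' then T else if x \<in> {c..d} then ball x (r x) else ball x 1)" for x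
    have \<gamma>: "gauge \<gamma>" using T(1,2) r(1) by (auto simp: gauge_def \<gamma>_def)
    have est: "norm ((\<Sum>(x, K)\<in>p. measure lborel K *\<^sub>R k0 x) - (F d - F c)) \<le> e * measure lborel {c..d}"
      if p: "p tagged_division_of {c..d}" and fine: "\<gamma> fine p" for p
    proof -
      have fin: "finite p" using p by auto
      have pK: "\<exists>u v. K = {u..v} \<and> u \<le> x \<and> x \<le> v \<and> c \<le> u \<and> v \<le> d" if "(x, K) \<in> p" for x K
      proof -
        have *: "x \<in> K" "K \<subseteq> {c..d}" "\<exists>u v. K = cbox u v"
          using tagged_division_ofD(2-4)[OF p that] by auto
        then obtain u v where "K = {u..v}" by auto
        then show ?thesis using * by auto
      qed
      define D where "D = (\<lambda>(x::real, K). F (Sup K) - F (Inf K))"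
      define E where "E = (\<lambda>(x, K). measure lborel K *\<^sub>R k0 x - D (x, K))"
      have SE: "(\<Sum>(x, K)\<in>p. measure lborel K *\<^sub>R k0 x) - (F d - F c) = sum E p"
        using additive_tagged_division_1[OF cd p, of F]
        by (simp add: E_def D_def sum_subtractf case_prod_beta)
      have "norm (E i) \<le> e / 2 * measure lborel (snd i) + (if fst i \<in> N' then norm (D i) else 0)"
        if i: "i \<in> p" for i
      proof -
        obtain x K where xK: "i = (x, K)" by (cases i)
        obtain u v where uv: "K = {u..v}" "u \<le> x" "x \<le> v" "c \<le> u" "v \<le> d"
          using pK i xK by blast
        show ?thesis
        proof (cases "x \<in> N'")
          case True
          then show ?thesis using e by (simp add: xK E_def k0_def)
        next
          case False
          have x: "x \<in> {c..d} - N'" using False uv by auto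
          have "K \<subseteq> \<gamma> x" using fine i xK by (auto simp: fine_def)
          then have Kr: "K \<subseteq> ball x (r x)" using x by (simp add: \<gamma>_def)
          have "u \<in> K" "v \<in> K" using uv by auto
          then have "norm (u - x) < r x" "norm (v - x) < r x" using Kr by (auto simp: dist_norm norm_minus_commute)
          from r(2)[OF x this(1)] r(2)[OF x this(2)]
          have 1: "norm (F u - F x - (u - x) *\<^sub>R k x) \<le> e / 2 * (x - u)"
            "norm (F v - F x - (v - x) *\<^sub>R k x) \<le> e / 2 * (v - x)" using uv by auto
          have Ei: "E i = (F u - F x - (u - x) *\<^sub>R k x) - (F v - F x - (v - x) *\<^sub>R k x)"
            using uv False by (simp add: xK E_def D_def k0_def algebra_simps)
          have "norm (E i) \<le> e / 2 * (x - u) + e / 2 * (v - x)"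
            unfolding Ei using 1 norm_triangle_ineq4[of "F u - F x - (u - x) *\<^sub>R k x" "F v - F x - (v - x) *\<^sub>R k x"]
            by linarith
          also have "\<dots> = e / 2 * (v - u)" by (simp add: field_simps)
          also have "v - u = measure lborel K" using uv by simp
          finally show ?thesis using False by (simp add: xK)
        qed
      qed
      then have "norm (sum E p) \<le> (\<Sum>i\<in>p. e / 2 * measure lborel (snd i) + (if fst i \<in> N' then norm (D i) else 0))"
        by (rule sum_norm_le)
      also have "\<dots> = e / 2 * (\<Sum>i\<in>p. measure lborel (snd i)) + (\<Sum>i\<in>{i\<in>p. fst i \<in> N'}. norm (D i))"
        using fin by (simp add: sum.distrib sum_distrib_left sum.inter_filter)
      also have "(\<Sum>i\<in>p. measure lborel (snd i)) = measure lborel {c..d}"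
        using additive_content_tagged_division[of p c d] p by (simp add: case_prod_beta)
      also have "(\<Sum>i\<in>{i\<in>p. fst i \<in> N'}. norm (D i)) \<le> e2"
      proof -
        define R where "R = {i\<in>p. fst i \<in> N'}"
        have RK: "\<exists>u v. snd i = {u..v} \<and> u \<le> v \<and> c \<le> u \<and> v \<le> d \<and> {u..v} \<subseteq> T" if iR: "i \<in> R" for i
        proof -
          obtain x K where xK: "i = (x, K)" by (cases i)
          obtain u v where uv: "K = {u..v}" "u \<le> x" "x \<le> v" "c \<le> u" "v \<le> d"
            using pK[of x K] iR xK unfolding R_def by blast
          have "K \<subseteq> \<gamma> x" using fine iR xK by (auto simp: fine_def R_def)
          then have "K \<subseteq> T" using iR xK by (simp add: \<gamma>_def R_def)
          then show ?thesis using uv xK by auto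
        qed
        have h0: "finite R" using fin by (simp add: R_def)
        have h1: "\<forall>i\<in>R. c \<le> Inf (snd i) \<and> Inf (snd i) \<le> Sup (snd i) \<and> Sup (snd i) \<le> d"
        proof
          fix i assume "i \<in> R"
          from RK[OF this] show "c \<le> Inf (snd i) \<and> Inf (snd i) \<le> Sup (snd i) \<and> Sup (snd i) \<le> d" by auto
        qed
        have int: "{Inf (snd i)<..<Sup (snd i)} = interior (snd i)" if "i \<in> R" for i
          using RK[OF that] by auto
        have h2: "disjoint_family_on (\<lambda>i. {Inf (snd i)<..<Sup (snd i)}) R"
          unfolding disjoint_family_on_def
        proof (intro ballI impI)
          fix i j assume ij: "i \<in> R" "j \<in> R" "i \<noteq> j"
          obtain x K y L where xy: "i = (x, K)" "j = (y, L)" by (cases i, cases j)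
          have "interior K \<inter> interior L = {}"
            using tagged_division_ofD(5)[OF p, of x K y L] ij xy by (auto simp: R_def)
          then show "{Inf (snd i)<..<Sup (snd i)} \<inter> {Inf (snd j)<..<Sup (snd j)} = {}"
            using int[OF ij(1)] int[OF ij(2)] xy by simp
        qed
        have "(\<Sum>i\<in>R. Sup (snd i) - Inf (snd i)) = (\<Sum>i\<in>R. measure lebesgue {Inf (snd i)<..<Sup (snd i)})"
          using h1 by (intro sum.cong) auto
        also have "\<dots> = measure lebesgue (\<Union>i\<in>R. {Inf (snd i)<..<Sup (snd i)})"
        proof (rule measure_finite_Union[symmetric, OF h0 _ h2])
          fix i :: "real \<times> real set"
          have "{Inf (snd i)<..<Sup (snd i)} \<in> lmeasurable" by (rule lmeasurable_open) auto
          from fmeasurableD2[OF this] show "emeasure lebesgue {Inf (snd i)<..<Sup (snd i)} \<noteq> \<infinity>" by simp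
        qed auto
        also have "\<dots> \<le> measure lebesgue T"
        proof (rule measure_mono_fmeasurable[OF _ _ T(3)])
          show "(\<Union>i\<in>R. {Inf (snd i)<..<Sup (snd i)}) \<subseteq> T"
          proof (rule UN_least)
            fix i assume "i \<in> R"
            from RK[OF this] show "{Inf (snd i)<..<Sup (snd i)} \<subseteq> T" by auto
          qed
        qed (use h0 in auto)
        finally have h3: "(\<Sum>i\<in>R. Sup (snd i) - Inf (snd i)) < \<delta>" using T(4) by simp
        have "(\<Sum>i\<in>R. cmod (F (Sup (snd i)) - F (Inf (snd i)))) < e2"
          by (rule small[rule_format, OF conjI[OF h0 conjI[OF h1 conjI[OF h2 h3]]]])
        then show ?thesis by (simp add: R_def D_def case_prod_beta)
      qed
      finally show ?thesis
        using SE less by (simp add: e2_def field_simps)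
    qed
    show "\<exists>\<gamma>. gauge \<gamma> \<and> (\<forall>p. p tagged_division_of {c..d} \<and> \<gamma> fine p \<longrightarrow>
        norm ((\<Sum>(x, K)\<in>p. measure lborel K *\<^sub>R k0 x) - (F d - F c)) \<le> e * measure lborel {c..d})"
      by (intro exI[of _ \<gamma>] conjI allI impI \<gamma>) (elim conjE, rule est)
  qed
  then show ?thesis
    by (rule has_integral_spike[OF N', rotated]) (simp add: k0_def)
qed (auto intro: has_integral_refl)

lemma AE_lebesgue_on_negligible:
  assumes "S \<in> sets lebesgue"
  shows "(AE x in lebesgue_on S. P x) \<longleftrightarrow> (\<exists>N. negligible N \<and> (\<forall>x\<in>S - N. P x))"
proof -
  have "(AE x in lebesgue_on S. P x) \<longleftrightarrow> (\<exists>N. negligible N \<and> {x. \<not> (x \<in> S \<longrightarrow> P x)} \<subseteq> N)"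
    using assms by (simp add: AE_restrict_space_iff eventually_ae_filter_negligible)
  also have "\<dots> \<longleftrightarrow> (\<exists>N. negligible N \<and> (\<forall>x\<in>S - N. P x))" by blast
  finally show ?thesis .
qed

lemma AC_loc_differentiable_ae:
  assumes I: "open I" and AC: "AC_loc I F"
  shows "AE x in lebesgue_on I. F differentiable (at x)"
proof -
  define R where "R = {(p, q) \<in> \<rat> \<times> \<rat>. p < q \<and> {p..q} \<subseteq> I}"
  have "\<exists>N. negligible N \<and> (\<forall>x\<in>{fst i<..<snd i} - N. F differentiable (at x))" if "i \<in> R" for i
    using that AC by (intro AC_on_differentiable_ae) (auto simp: R_def AC_loc_def)
  then obtain N where N: "\<And>i. i \<in> R \<Longrightarrow> negligible (N i)"
    "\<And>i x. i \<in> R \<Longrightarrow> x \<in> {fst i<..<snd i} - N i \<Longrightarrow> F differentiable (at x)"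
    by metis
  have "countable R"
    by (rule countable_subset[of _ "\<rat> \<times> \<rat>"]) (auto simp: R_def intro: countable_SIGMA countable_rat)
  then have "negligible (\<Union>i\<in>R. N i)" using N(1) by (intro negligible_countable_Union) auto
  moreover have "F differentiable (at x)" if x: "x \<in> I - (\<Union>i\<in>R. N i)" for x
  proof -
    obtain e where e: "0 < e" "ball x e \<subseteq> I" using I x open_contains_ball by blast
    obtain p where p: "p \<in> \<rat>" "x - e < p" "p < x" using Rats_dense_in_real[of "x - e" x] e by auto
    obtain q where q: "q \<in> \<rat>" "x < q" "q < x + e" using Rats_dense_in_real[of x "x + e"] e by auto
    have "{p..q} \<subseteq> ball x e" using p q by (auto simp: dist_real_def)
    then have "(p, q) \<in> R" using p q e by (auto simp: R_def)
    then show ?thesis using N(2)[of "(p, q)" x] x p q by auto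
  qed
  ultimately show ?thesis
    using I by (subst AE_lebesgue_on_negligible) auto
qed

lemma AC_loc_increment:
  assumes I: "open I" and AC: "AC_loc I F" and k: "integrable (lebesgue_on I) k"
    and der: "AE x in lebesgue_on I. (F has_vector_derivative k x) (at x)"
    and cd: "c \<le> d" "{c..d} \<subseteq> I"
  shows "F d - F c = (LINT x|lebesgue. indicator {c..d} x *\<^sub>R (indicator I x *\<^sub>R k x))"
proof -
  have Il: "I \<in> sets lebesgue" using I by auto
  obtain N where N: "negligible N" "\<forall>x\<in>I - N. (F has_vector_derivative k x) (at x)"
    using der unfolding AE_lebesgue_on_negligible[OF Il] by blast
  have "AC_on c d F" using AC cd by (auto simp: AC_loc_def)
  then have "(k has_integral (F d - F c)) {c..d}"
    by (rule AC_on_FTC[OF _ cd(1) N(1)]) (use N(2) cd(2) in force)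
  moreover have "((\<lambda>x. indicator I x *\<^sub>R k x) has_integral (F d - F c)) {c..d}"
    by (rule has_integral_eq[OF _ calculation]) (use cd(2) in auto)
  moreover have "integrable lebesgue (\<lambda>x. indicator I x *\<^sub>R k x)"
    using k Il by (simp add: integrable_restrict_space)
  then have "set_integrable lebesgue {c..d} (\<lambda>x. indicator I x *\<^sub>R k x)"
    unfolding set_integrable_def by (rule integrable_mult_indicator[rotated]) simp
  ultimately show ?thesis
    using set_lebesgue_integral_eq_integral(2) unfolding set_lebesgue_integral_def
    by (metis integral_unique)
qed

lemma einterval_Icc_subset:
  "c \<in> einterval a b \<Longrightarrow> d \<in> einterval a b \<Longrightarrow> {c..d} \<subseteq> einterval a b"
  using less_le_trans[of a "ereal c"] le_less_trans[of _ "ereal d" b]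
  by (auto simp: einterval_def)

text \<open>
An integrable derivative forces limits at both ends of the interval, finite or not; this is
what makes the boundary values of the Lagrange bracket exist.
\<close>

lemma AC_loc_endpoint_limits:
  assumes ab: "a < b" and AC: "AC_loc (einterval a b) F"
    and k: "integrable (lebesgue_on (einterval a b)) k"
    and der: "AE x in lebesgue_on (einterval a b). (F has_vector_derivative k x) (at x)"
  shows "\<exists>l r. ((\<lambda>t. F (real_of_ereal t)) \<longlongrightarrow> l) (at_right a) \<and>
      ((\<lambda>t. F (real_of_ereal t)) \<longlongrightarrow> r) (at_left b) \<and>
      r - l = (LINT x|lebesgue_on (einterval a b). k x)"
proof -
  define I where "I = einterval a b"
  define kk where "kk = (\<lambda>x. indicator I x *\<^sub>R k x)"
  have I: "open I" by (simp add: I_def)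
  have kk: "integrable lebesgue kk"
    unfolding kk_def using k I by (simp add: integrable_restrict_space I_def)
  have kki: "integrable lebesgue (\<lambda>x. indicator A x *\<^sub>R kk x)" if "A \<in> sets lebesgue" for A
    using kk that by (rule integrable_mult_indicator[rotated])
  have inc: "F d - F c = (LINT x|lebesgue. indicator {c..d} x *\<^sub>R kk x)"
    if "c \<le> d" "c \<in> I" "d \<in> I" for c d
    unfolding kk_def
  proof (rule AC_loc_increment[OF I _ _ _ that(1)])
    show "{c..d} \<subseteq> I" using that einterval_Icc_subset unfolding I_def by blast
  qed (use AC k der in \<open>simp_all only: I_def\<close>)
  obtain x0 where x0: "a < ereal x0" "ereal x0 < b" using ereal_dense2[OF ab] by blast
  then have x0I: "x0 \<in> I" by (simp add: I_def einterval_def)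
  define l where "l = F x0 - (LINT x|lebesgue. indicator {..x0} x *\<^sub>R kk x)"
  define r where "r = F x0 + (LINT x|lebesgue. indicator {x0..} x *\<^sub>R kk x)"
  have "((\<lambda>t. F (real_of_ereal t)) \<longlongrightarrow> l) (at_right a)"
  proof (rule tendsto_at_right_sequentially[OF x0(1)])
    fix S assume S: "\<And>n. a < S n" "\<And>n. S n < ereal x0" "S \<longlonglongrightarrow> a"
    have S': "S n = ereal (real_of_ereal (S n))" for n
      using S(1)[of n] S(2)[of n] by (cases "S n") auto
    have SI: "real_of_ereal (S n) \<in> I" "real_of_ereal (S n) \<le> x0" for n
      using S(1)[of n] S(2)[of n] S'[of n] x0(2)
      by (auto simp: I_def einterval_def) (metis ereal_less_eq(3) less_imp_le less_trans)+
    \<comment> \<open>Dominated convergence: the indicators are eventually constant at each point of the interval.\<close>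
    have "(\<lambda>n. LINT x|lebesgue. indicator {real_of_ereal (S n)..x0} x *\<^sub>R kk x)
        \<longlonglongrightarrow> (LINT x|lebesgue. indicator {..x0} x *\<^sub>R kk x)"
    proof (rule integral_dominated_convergence[where w = "\<lambda>x. norm (kk x)"])
      show "AE x in lebesgue. (\<lambda>n. indicator {real_of_ereal (S n)..x0} x *\<^sub>R kk x)
          \<longlonglongrightarrow> indicator {..x0} x *\<^sub>R kk x"
      proof (rule AE_I2, rule tendsto_eventually)
        fix x
        show "\<forall>\<^sub>F n in sequentially. indicator {real_of_ereal (S n)..x0} x *\<^sub>R kk x = indicator {..x0} x *\<^sub>R kk x"
        proof (cases "x \<in> I")
          case True
          then have "a < ereal x" by (simp add: I_def einterval_def)
          from order_tendstoD(2)[OF S(3) this] show ?thesis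
          proof eventually_elim
            case (elim n)
            then have "real_of_ereal (S n) < x" using S'[of n] by (metis less_ereal.simps(1))
            then show ?case by (simp add: indicator_def)
          qed
        qed (simp add: kk_def)
      qed
      show "AE x in lebesgue. norm (indicator {real_of_ereal (S n)..x0} x *\<^sub>R kk x) \<le> norm (kk x)" for n
        by (rule AE_I2) (simp add: indicator_def)
    qed (use kk kki in \<open>auto intro: borel_measurable_integrable\<close>)
    then have "(\<lambda>n. F x0 - (LINT x|lebesgue. indicator {real_of_ereal (S n)..x0} x *\<^sub>R kk x)) \<longlonglongrightarrow> l"
      unfolding l_def by (intro tendsto_intros)
    moreover have "F x0 - (LINT x|lebesgue. indicator {real_of_ereal (S n)..x0} x *\<^sub>R kk x) = F (real_of_ereal (S n))" for n
      using inc[OF SI(2) SI(1) x0I, of n] by (simp add: algebra_simps)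
    ultimately show "(\<lambda>n. F (real_of_ereal (S n))) \<longlonglongrightarrow> l" by simp
  qed
  moreover have "((\<lambda>t. F (real_of_ereal t)) \<longlongrightarrow> r) (at_left b)"
  proof (rule tendsto_at_left_sequentially[OF x0(2)])
    fix S assume S: "\<And>n. S n < b" "\<And>n. ereal x0 < S n" "S \<longlonglongrightarrow> b"
    have S': "S n = ereal (real_of_ereal (S n))" for n
      using S(1)[of n] S(2)[of n] by (cases "S n") auto
    have SI: "real_of_ereal (S n) \<in> I" "x0 \<le> real_of_ereal (S n)" for n
      using S(1)[of n] S(2)[of n] S'[of n] x0(1)
      by (auto simp: I_def einterval_def) (metis ereal_less_eq(3) less_imp_le less_trans)+
    have "(\<lambda>n. LINT x|lebesgue. indicator {x0..real_of_ereal (S n)} x *\<^sub>R kk x)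
        \<longlonglongrightarrow> (LINT x|lebesgue. indicator {x0..} x *\<^sub>R kk x)"
    proof (rule integral_dominated_convergence[where w = "\<lambda>x. norm (kk x)"])
      show "AE x in lebesgue. (\<lambda>n. indicator {x0..real_of_ereal (S n)} x *\<^sub>R kk x)
          \<longlonglongrightarrow> indicator {x0..} x *\<^sub>R kk x"
      proof (rule AE_I2, rule tendsto_eventually)
        fix x
        show "\<forall>\<^sub>F n in sequentially. indicator {x0..real_of_ereal (S n)} x *\<^sub>R kk x = indicator {x0..} x *\<^sub>R kk x"
        proof (cases "x \<in> I")
          case True
          then have "ereal x < b" by (simp add: I_def einterval_def)
          from order_tendstoD(1)[OF S(3) this] show ?thesis
          proof eventually_elim
            case (elim n)
            then have "x < real_of_ereal (S n)" using S'[of n] by (metis less_ereal.simps(1))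
            then show ?case by (simp add: indicator_def)
          qed
        qed (simp add: kk_def)
      qed
      show "AE x in lebesgue. norm (indicator {x0..real_of_ereal (S n)} x *\<^sub>R kk x) \<le> norm (kk x)" for n
        by (rule AE_I2) (simp add: indicator_def)
    qed (use kk kki in \<open>auto intro: borel_measurable_integrable\<close>)
    then have "(\<lambda>n. F x0 + (LINT x|lebesgue. indicator {x0..real_of_ereal (S n)} x *\<^sub>R kk x)) \<longlonglongrightarrow> r"
      unfolding r_def by (intro tendsto_intros)
    moreover have "F x0 + (LINT x|lebesgue. indicator {x0..real_of_ereal (S n)} x *\<^sub>R kk x) = F (real_of_ereal (S n))" for n
      using inc[OF SI(2) x0I SI(1), of n] by (simp add: algebra_simps)
    ultimately show "(\<lambda>n. F (real_of_ereal (S n))) \<longlonglongrightarrow> r" by simp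
  qed
  moreover have "r - l = (LINT x|lebesgue_on I. k x)"
  proof -
    have "r - l = (LINT x|lebesgue. indicator {x0..} x *\<^sub>R kk x + indicator {..x0} x *\<^sub>R kk x)"
      unfolding r_def l_def by (subst Bochner_Integration.integral_add) (auto intro!: kki)
    also have "\<dots> = (LINT x|lebesgue. kk x)"
    proof (rule integral_cong_AE)
      have "AE x in lebesgue. x \<noteq> x0"
        by (rule AE_I'[of "{x0}"]) auto
      then show "AE x in lebesgue. indicator {x0..} x *\<^sub>R kk x + indicator {..x0} x *\<^sub>R kk x = kk x"
        by eventually_elim (auto simp: indicator_def)
      have "integrable lebesgue (\<lambda>x. indicator {x0..} x *\<^sub>R kk x + indicator {..x0} x *\<^sub>R kk x)"
        by (intro Bochner_Integration.integrable_add kki) auto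
      then show "(\<lambda>x. indicator {x0..} x *\<^sub>R kk x + indicator {..x0} x *\<^sub>R kk x) \<in> borel_measurable lebesgue"
        by (rule borel_measurable_integrable)
      show "kk \<in> borel_measurable lebesgue" using kk by (rule borel_measurable_integrable)
    qed
    also have "\<dots> = (LINT x|lebesgue_on I. k x)"
      unfolding kk_def using I by (subst integral_restrict_space) auto
    finally show ?thesis .
  qed
  ultimately show ?thesis unfolding I_def by blast
qed

section \<open>Locally absolutely continuous functions\<close>

lemma AC_loc_continuous_on:
  assumes "open A" "AC_loc A f"
  shows "continuous_on A f"
proof -
  have "isCont f x" if x: "x \<in> A" for x
  proof -
    obtain e where e: "0 < e" "cball x e \<subseteq> A" using assms(1) x open_contains_cball by blast
    then have "AC_on (x - e) (x + e) f"
      using assms(2) by (simp add: AC_loc_def cball_eq_atLeastAtMost)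
    then have "continuous_on {x - e..x + e} f" by (rule AC_on_continuous_on)
    then show ?thesis by (rule continuous_on_interior) (use e(1) in simp)
  qed
  then show ?thesis by (simp add: continuous_at_imp_continuous_on)
qed

lemma AC_loc_add_mult:
  assumes "AC_loc A f" "AC_loc A g" shows "AC_loc A (\<lambda>x. f x + c * g x)"
  unfolding AC_loc_def
proof (intro allI impI)
  fix u v assume "u \<le> v \<and> {u..v} \<subseteq> A"
  then have "AC_on u v f" "AC_on u v g" using assms unfolding AC_loc_def by auto
  then show "AC_on u v (\<lambda>x. f x + c * g x)" by (rule AC_on_add[OF _ AC_on_mult[OF AC_on_const]])
qed

lemma AC_loc_cnj:
  assumes "AC_loc A f" shows "AC_loc A (\<lambda>x. cnj (f x))"
  using assms unfolding AC_loc_def by (blast intro: AC_on_cnj)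

text \<open>
A nonempty open set is not negligible. Hence quasi-derivatives, and the representatives in
\<open>dom_max\<close>, are determined by their almost everywhere classes.
\<close>

lemma continuous_ae_eq_imp_eq:
  fixes f g :: "real \<Rightarrow> 'a::real_normed_vector"
  assumes A: "open A" and f: "continuous_on A f" and g: "continuous_on A g"
    and ae: "AE x in lebesgue_on A. f x = g x" and x: "x \<in> A"
  shows "f x = g x"
proof (rule ccontr)
  assume "f x \<noteq> g x"
  define U where "U = {x \<in> A. f x - g x \<noteq> 0}"
  have "U = A \<inter> (\<lambda>x. f x - g x) -` (- {0})" by (auto simp: U_def)
  moreover have "open (A \<inter> (\<lambda>x. f x - g x) -` (- {0}))"
    by (rule continuous_open_preimage[OF continuous_on_diff[OF f g] A]) (rule open_Compl[OF closed_singleton])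
  ultimately have "open U" by simp
  moreover have "x \<in> U" using x \<open>f x \<noteq> g x\<close> by (simp add: U_def)
  moreover obtain N where "negligible N" "\<forall>x\<in>A - N. f x = g x"
    using ae A by (subst (asm) AE_lebesgue_on_negligible) auto
  then have "negligible U" by (rule_tac negligible_subset[of N]) (auto simp: U_def)
  ultimately show False using open_not_negligible by blast
qed

lemma vector_derivative_cong_open:
  assumes "open A" "x \<in> A" "\<And>y. y \<in> A \<Longrightarrow> f y = g y"
  shows "vector_derivative f (at x) = vector_derivative g (at x)"
proof (rule vector_derivative_cong_eq[where A = UNIV and B = UNIV, OF _ refl refl])
  show "\<forall>\<^sub>F y in nhds x. y \<in> UNIV \<longrightarrow> f y = g y"
    using eventually_nhds_in_open[OF assms(1,2)] by eventually_elim (use assms(3) in simp)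
qed simp

section \<open>Sturm--Liouville expressions and the maximal domain\<close>

locale sl_problem =
  fixes S :: sl_expr
  assumes sl: "sturm_liouville S"
begin

abbreviation X :: "real set" where "X \<equiv> sl_int S"
abbreviation M :: "real measure" where "M \<equiv> sl_measure S"

lemma ends: "lend S < rend S" using sl by (simp add: sturm_liouville_def)

lemma open_X: "open X" by (simp add: sl_int_def)

lemma X_sets: "X \<in> sets lebesgue" using open_X by auto

lemma rcoef_measurable: "rcoef S \<in> borel_measurable (lebesgue_on X)"
  using sl by (simp add: sturm_liouville_def)

lemma rcoef_pos: "AE x in lebesgue_on X. 0 < rcoef S x"
  using sl by (simp add: sturm_liouville_def)

lemma pcoef_pos: "AE x in lebesgue_on X. 0 < pcoef S x"
  using sl by (simp add: sturm_liouville_def)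

text \<open>
As \<open>r > 0\<close> almost everywhere, \<open>r dx\<close> and Lebesgue measure have the same null sets.
\<close>

lemma AE_M: "(AE x in M. P x) \<longleftrightarrow> (AE x in lebesgue_on X. P x)"
proof -
  have "(AE x in M. P x) \<longleftrightarrow> (AE x in lebesgue_on X. 0 < ennreal (rcoef S x) \<longrightarrow> P x)"
    unfolding sl_measure_def using rcoef_measurable by (intro AE_density) simp
  also have "\<dots> \<longleftrightarrow> (AE x in lebesgue_on X. P x)"
  proof
    assume "AE x in lebesgue_on X. 0 < ennreal (rcoef S x) \<longrightarrow> P x"
    with rcoef_pos show "AE x in lebesgue_on X. P x" by eventually_elim simp
  next
    assume "AE x in lebesgue_on X. P x"
    then show "AE x in lebesgue_on X. 0 < ennreal (rcoef S x) \<longrightarrow> P x" by eventually_elim simp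
  qed
  finally show ?thesis .
qed

lemma borel_M: "borel_measurable M = (borel_measurable (lebesgue_on X) :: (real \<Rightarrow> 'a::topological_space) set)"
  unfolding sl_measure_def by (intro measurable_cong_sets) simp_all

lemma AE_X: "AE x in lebesgue_on X. x \<in> X"
  by (rule AE_I2) simp

text \<open>
The weighted measure is built on the completed \<open>\<sigma>\<close>-algebra, so that modification on a null set
keeps measurability.
\<close>

lemma measurable_AE_cong:
  fixes f g :: "real \<Rightarrow> 'a::euclidean_space"
  assumes f: "f \<in> borel_measurable M" and ae: "AE x in M. f x = g x"
  shows "g \<in> borel_measurable M"
proof -
  have "(\<lambda>x. indicator X x *\<^sub>R f x) \<in> borel_measurable lebesgue"
    using f X_sets unfolding borel_M by (subst (asm) borel_measurable_restrict_space_iff) auto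
  moreover have "AE x in lebesgue. x \<in> X \<longrightarrow> f x = g x"
    using ae X_sets unfolding AE_M by (simp add: AE_restrict_space_iff)
  then have "AE x in lebesgue. indicator X x *\<^sub>R f x = indicator X x *\<^sub>R g x"
    by eventually_elim (auto simp: indicator_def)
  ultimately have "(\<lambda>x. indicator X x *\<^sub>R g x) \<in> borel_measurable lebesgue"
    by (rule borel_measurable_AE)
  then show ?thesis using X_sets unfolding borel_M by (subst borel_measurable_restrict_space_iff) auto
qed

lemma L2_AE_cong:
  assumes f: "f \<in> L2 M" and ae: "AE x in M. f x = g x"
  shows "g \<in> L2 M"
proof -
  have g: "g \<in> borel_measurable M" using f ae by (auto simp: L2_def intro: measurable_AE_cong)
  have "integrable M (\<lambda>x. (cmod (g x))\<^sup>2) \<longleftrightarrow> integrable M (\<lambda>x. (cmod (f x))\<^sup>2)"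
  proof (rule integrable_cong_AE)
    show "AE x in M. (cmod (g x))\<^sup>2 = (cmod (f x))\<^sup>2" using ae by eventually_elim simp
  qed (use f g in \<open>auto simp: L2_def\<close>)
  then show ?thesis using f g by (simp add: L2_def)
qed

lemma L2_add_mult:
  assumes f: "f \<in> L2 M" and g: "g \<in> L2 M"
  shows "(\<lambda>x. f x + c * g x) \<in> L2 M"
proof -
  have fm: "f \<in> borel_measurable M" and gm: "g \<in> borel_measurable M" using f g by (auto simp: L2_def)
  have "integrable M (\<lambda>x. 2 * (cmod (f x))\<^sup>2 + 2 * ((cmod c)\<^sup>2 * (cmod (g x))\<^sup>2))"
    using f g by (simp add: L2_def)
  then have "integrable M (\<lambda>x. (cmod (f x + c * g x))\<^sup>2)"
  proof (rule Bochner_Integration.integrable_bound)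
    show "(\<lambda>x. (cmod (f x + c * g x))\<^sup>2) \<in> borel_measurable M" using fm gm by measurable
    show "AE x in M. norm ((cmod (f x + c * g x))\<^sup>2)
        \<le> norm (2 * (cmod (f x))\<^sup>2 + 2 * ((cmod c)\<^sup>2 * (cmod (g x))\<^sup>2))"
    proof (rule AE_I2)
      fix x
      have "(cmod (f x + c * g x))\<^sup>2 \<le> (cmod (f x) + cmod (c * g x))\<^sup>2"
        by (intro power_mono norm_triangle_ineq) simp
      also have "\<dots> \<le> 2 * (cmod (f x))\<^sup>2 + 2 * (cmod (c * g x))\<^sup>2"
        using sum_squares_ge_zero[of "cmod (f x) - cmod (c * g x)" 0]
        by (simp add: power2_eq_square algebra_simps)
      finally show "norm ((cmod (f x + c * g x))\<^sup>2)
        \<le> norm (2 * (cmod (f x))\<^sup>2 + 2 * ((cmod c)\<^sup>2 * (cmod (g x))\<^sup>2))"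
        by (simp add: norm_mult power_mult_distrib)
    qed
  qed
  then show ?thesis using fm gm by (auto simp: L2_def)
qed

lemma L2_scale: "f \<in> L2 M \<Longrightarrow> (\<lambda>x. c * f x) \<in> L2 M"
  \<comment> \<open>\<open>c f = f + (c - 1) f\<close>\<close>
  using L2_add_mult[of f f "c - 1"] by (simp add: algebra_simps)

lemma L2_cnj:
  assumes "f \<in> L2 M" shows "(\<lambda>x. cnj (f x)) \<in> L2 M"
proof -
  have "(\<lambda>x. cnj (f x)) \<in> borel_measurable M"
    using assms by (intro borel_measurable_continuous_on[of cnj]) (simp_all add: L2_def continuous_on_cnj)
  then show ?thesis using assms by (simp add: L2_def)
qed

lemma L2_mult_integrable:
  assumes f: "f \<in> L2 M" and g: "g \<in> L2 M"
  shows "integrable M (\<lambda>x. f x * g x)"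
proof (rule Bochner_Integration.integrable_bound)
  show "integrable M (\<lambda>x. (cmod (f x))\<^sup>2 + (cmod (g x))\<^sup>2)" using f g by (simp add: L2_def)
  show "(\<lambda>x. f x * g x) \<in> borel_measurable M" using f g by (auto simp: L2_def)
  show "AE x in M. norm (f x * g x) \<le> norm ((cmod (f x))\<^sup>2 + (cmod (g x))\<^sup>2)"
  proof (rule AE_I2)
    fix x
    have "2 * (cmod (f x) * cmod (g x)) \<le> (cmod (f x))\<^sup>2 + (cmod (g x))\<^sup>2"
      using sum_squares_bound[of "cmod (f x)" "cmod (g x)"] by simp
    moreover have "0 \<le> cmod (f x) * cmod (g x)" by simp
    ultimately have "cmod (f x) * cmod (g x) \<le> (cmod (f x))\<^sup>2 + (cmod (g x))\<^sup>2" by linarith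
    then show "norm (f x * g x) \<le> norm ((cmod (f x))\<^sup>2 + (cmod (g x))\<^sup>2)"
      by (simp add: norm_mult)
  qed
qed

lemma quasi_deriv_unique:
  assumes "is_quasi_deriv S f h" "is_quasi_deriv S f k" "x \<in> X"
  shows "h x = k x"
proof (rule continuous_ae_eq_imp_eq[OF open_X _ _ _ assms(3)])
  show "continuous_on X h" "continuous_on X k"
    using assms AC_loc_continuous_on[OF open_X] by (auto simp: is_quasi_deriv_def)
  have "AE x in lebesgue_on X. h x = of_real (pcoef S x) * vector_derivative f (at x)"
    "AE x in lebesgue_on X. k x = of_real (pcoef S x) * vector_derivative f (at x)"
    using assms by (auto simp: is_quasi_deriv_def)
  then show "AE x in lebesgue_on X. h x = k x" by eventually_elim simp
qed

lemma quasi_deriv: "f \<in> sl_D S \<Longrightarrow> is_quasi_deriv S f (quasi_deriv S f)"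
proof -
  assume "f \<in> sl_D S"
  then have "\<exists>h. is_quasi_deriv S f h" unfolding sl_D_def by blast
  then show ?thesis unfolding quasi_deriv_def by (rule someI_ex)
qed

lemma quasi_deriv_eq: "is_quasi_deriv S f h \<Longrightarrow> x \<in> X \<Longrightarrow> quasi_deriv S f x = h x"
  unfolding quasi_deriv_def by (rule quasi_deriv_unique[OF someI[of "is_quasi_deriv S f" h]])

lemma is_quasi_deriv_cong:
  assumes "\<And>x. x \<in> X \<Longrightarrow> f x = g x"
  shows "is_quasi_deriv S f h \<longleftrightarrow> is_quasi_deriv S g h"
proof -
  have "(AE x in lebesgue_on X. h x = of_real (pcoef S x) * vector_derivative f (at x)) \<longleftrightarrow>
      (AE x in lebesgue_on X. h x = of_real (pcoef S x) * vector_derivative g (at x))"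
    by (rule AE_cong) (use vector_derivative_cong_open[OF open_X _ assms] in simp)
  then show ?thesis by (simp add: is_quasi_deriv_def)
qed

text \<open>
The choice behind \<open>quasi_deriv\<close> depends only on the values of the function on \<open>(a,b)\<close>.
\<close>

lemma quasi_deriv_cong:
  assumes "\<And>x. x \<in> X \<Longrightarrow> f x = g x"
  shows "quasi_deriv S f = quasi_deriv S g"
  proof -
  have "is_quasi_deriv S f = is_quasi_deriv S g" using assms by (intro ext is_quasi_deriv_cong)
  then show ?thesis by (simp add: quasi_deriv_def)
qed

lemma sl_tau_cong:
  assumes "\<And>x. x \<in> X \<Longrightarrow> f x = g x" "x \<in> X"
  shows "sl_tau S f x = sl_tau S g x"
proof -
  have "quasi_deriv S f = quasi_deriv S g" by (rule quasi_deriv_cong) (rule assms(1))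
  then show ?thesis using assms(1)[OF assms(2)] by (simp only: sl_tau_def)
qed

lemma sl_D_AC:
  assumes "f \<in> sl_D S"
  shows "AC_loc X f" "AC_loc X (quasi_deriv S f)"
proof -
  show "AC_loc X f" using assms unfolding sl_D_def by blast
  show "AC_loc X (quasi_deriv S f)" using quasi_deriv[OF assms] unfolding is_quasi_deriv_def by blast
qed

lemma sl_D_continuous:
  assumes "f \<in> sl_D S"
  shows "continuous_on X f" "continuous_on X (quasi_deriv S f)"
  by (rule AC_loc_continuous_on[OF open_X sl_D_AC(1)[OF assms]],
      rule AC_loc_continuous_on[OF open_X sl_D_AC(2)[OF assms]])

text \<open>
The Sturm--Liouville expression as a first-order system for \<open>f\<close> and \<open>pf'\<close>, with honest derivatives
almost everywhere. The function \<open>vector_derivative\<close> has an arbitrary value where there is no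
derivative, so this needs the almost everywhere differentiability of absolutely continuous
functions; linearity and conjugation, and the Lagrange identity, rest on it.
\<close>

lemma sl_D_AE_derivatives:
  assumes f: "f \<in> sl_D S"
  shows "AE x in lebesgue_on X. (f has_vector_derivative quasi_deriv S f x / of_real (pcoef S x)) (at x) \<and>
    (quasi_deriv S f has_vector_derivative
       of_real (qcoef S x) * f x - of_real (rcoef S x) * sl_tau S f x) (at x)"
proof -
  have "AE x in lebesgue_on X. quasi_deriv S f x = of_real (pcoef S x) * vector_derivative f (at x)"
    using quasi_deriv[OF f] by (simp add: is_quasi_deriv_def)
  with AC_loc_differentiable_ae[OF open_X sl_D_AC(1)[OF f]]
    AC_loc_differentiable_ae[OF open_X sl_D_AC(2)[OF f]] pcoef_pos rcoef_pos
  show ?thesis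
  proof eventually_elim
    case (elim x)
    have "vector_derivative f (at x) = quasi_deriv S f x / of_real (pcoef S x)"
      using elim by simp
    moreover have "vector_derivative (quasi_deriv S f) (at x) =
        of_real (qcoef S x) * f x - of_real (rcoef S x) * sl_tau S f x"
      using elim by (simp add: sl_tau_def)
    ultimately show ?case using elim vector_derivative_works by metis
  qed
qed

lemma is_quasi_derivI:
  assumes "AC_loc X h"
    and "AE x in lebesgue_on X. (f has_vector_derivative h x / of_real (pcoef S x)) (at x)"
  shows "is_quasi_deriv S f h"
proof -
  have "AE x in lebesgue_on X. h x = of_real (pcoef S x) * vector_derivative f (at x)"
    using assms(2) pcoef_pos
  proof eventually_elim
    case (elim x)
    then have "vector_derivative f (at x) = h x / of_real (pcoef S x)" by (simp add: vector_derivative_at)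
    then show ?case using elim by simp
  qed
  then show ?thesis using assms(1) by (simp add: is_quasi_deriv_def)
qed

lemma sl_tau_AE_eq:
  assumes "AE x in lebesgue_on X. (quasi_deriv S f has_vector_derivative
       of_real (qcoef S x) * f x - of_real (rcoef S x) * k x) (at x)"
  shows "AE x in lebesgue_on X. sl_tau S f x = k x"
  using assms rcoef_pos
proof eventually_elim
  case (elim x)
  then show ?case by (simp add: sl_tau_def vector_derivative_at)
qed

lemma has_vector_derivative_cong_X:
  assumes "x \<in> X" "\<And>y. y \<in> X \<Longrightarrow> f y = g y" "(g has_vector_derivative D) (at x)"
  shows "(f has_vector_derivative D) (at x)"
  by (rule has_vector_derivative_transform_within_open[OF assms(3) open_X assms(1)]) (simp add: assms(2))

lemma sl_D_add_mult:
  assumes f: "f \<in> sl_D S" and g: "g \<in> sl_D S"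
  shows "(\<lambda>x. f x + c * g x) \<in> sl_D S" (is "?h \<in> _")
    and "\<And>x. x \<in> X \<Longrightarrow> quasi_deriv S (\<lambda>x. f x + c * g x) x = quasi_deriv S f x + c * quasi_deriv S g x"
    and "AE x in lebesgue_on X. sl_tau S (\<lambda>x. f x + c * g x) x = sl_tau S f x + c * sl_tau S g x"
proof -
  note F = sl_D_AE_derivatives[OF f] and G = sl_D_AE_derivatives[OF g]
  have q: "is_quasi_deriv S ?h (\<lambda>x. quasi_deriv S f x + c * quasi_deriv S g x)"
  proof (rule is_quasi_derivI)
    show "AC_loc X (\<lambda>x. quasi_deriv S f x + c * quasi_deriv S g x)"
      by (rule AC_loc_add_mult[OF sl_D_AC(2)[OF f] sl_D_AC(2)[OF g]])
    show "AE x in lebesgue_on X. (?h has_vector_derivative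
        (quasi_deriv S f x + c * quasi_deriv S g x) / of_real (pcoef S x)) (at x)"
      using F G
    proof eventually_elim
      case (elim x)
      then have "(?h has_vector_derivative quasi_deriv S f x / of_real (pcoef S x) +
          c * (quasi_deriv S g x / of_real (pcoef S x))) (at x)"
        by (intro has_vector_derivative_add has_vector_derivative_mult_right) auto
      then show ?case by (simp add: add_divide_distrib)
    qed
  qed
  show h: "?h \<in> sl_D S"
    using q AC_loc_add_mult[OF sl_D_AC(1)[OF f] sl_D_AC(1)[OF g]] by (auto simp: sl_D_def)
  show eq: "quasi_deriv S ?h x = quasi_deriv S f x + c * quasi_deriv S g x" if "x \<in> X" for x
    by (rule quasi_deriv_eq[OF q that])
  show "AE x in lebesgue_on X. sl_tau S ?h x = sl_tau S f x + c * sl_tau S g x"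
  proof (rule sl_tau_AE_eq)
    show "AE x in lebesgue_on X. (quasi_deriv S ?h has_vector_derivative of_real (qcoef S x) * ?h x -
        of_real (rcoef S x) * (sl_tau S f x + c * sl_tau S g x)) (at x)"
      using F G AE_X
    proof eventually_elim
      case (elim x)
      have "((\<lambda>x. quasi_deriv S f x + c * quasi_deriv S g x) has_vector_derivative
          (of_real (qcoef S x) * f x - of_real (rcoef S x) * sl_tau S f x) +
          c * (of_real (qcoef S x) * g x - of_real (rcoef S x) * sl_tau S g x)) (at x)"
        using elim by (intro has_vector_derivative_add has_vector_derivative_mult_right) auto
      then have D: "((\<lambda>x. quasi_deriv S f x + c * quasi_deriv S g x) has_vector_derivative
          of_real (qcoef S x) * ?h x - of_real (rcoef S x) * (sl_tau S f x + c * sl_tau S g x)) (at x)"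
        by (simp add: algebra_simps)
      show ?case by (rule has_vector_derivative_cong_X[OF elim(3) eq D])
    qed
  qed
qed

lemma sl_D_cnj:
  assumes f: "f \<in> sl_D S"
  shows "(\<lambda>x. cnj (f x)) \<in> sl_D S" (is "?h \<in> _")
    and "\<And>x. x \<in> X \<Longrightarrow> quasi_deriv S (\<lambda>x. cnj (f x)) x = cnj (quasi_deriv S f x)"
    and "AE x in lebesgue_on X. sl_tau S (\<lambda>x. cnj (f x)) x = cnj (sl_tau S f x)"
proof -
  note F = sl_D_AE_derivatives[OF f]
  have q: "is_quasi_deriv S ?h (\<lambda>x. cnj (quasi_deriv S f x))"
  proof (rule is_quasi_derivI)
    show "AC_loc X (\<lambda>x. cnj (quasi_deriv S f x))" by (rule AC_loc_cnj[OF sl_D_AC(2)[OF f]])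
    show "AE x in lebesgue_on X. (?h has_vector_derivative cnj (quasi_deriv S f x) / of_real (pcoef S x)) (at x)"
      using F
    proof eventually_elim
      case (elim x)
      then have "(?h has_vector_derivative cnj (quasi_deriv S f x / of_real (pcoef S x))) (at x)"
        using has_vector_derivative_cnj by blast
      then show ?case by simp
    qed
  qed
  show h: "?h \<in> sl_D S"
    using q AC_loc_cnj[OF sl_D_AC(1)[OF f]] by (auto simp: sl_D_def)
  show eq: "quasi_deriv S ?h x = cnj (quasi_deriv S f x)" if "x \<in> X" for x
    by (rule quasi_deriv_eq[OF q that])
  show "AE x in lebesgue_on X. sl_tau S ?h x = cnj (sl_tau S f x)"
  proof (rule sl_tau_AE_eq)
    show "AE x in lebesgue_on X. (quasi_deriv S ?h has_vector_derivative of_real (qcoef S x) * ?h x -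
        of_real (rcoef S x) * cnj (sl_tau S f x)) (at x)"
      using F AE_X
    proof eventually_elim
      case (elim x)
      have "((\<lambda>x. cnj (quasi_deriv S f x)) has_vector_derivative
          cnj (of_real (qcoef S x) * f x - of_real (rcoef S x) * sl_tau S f x)) (at x)"
        using elim has_vector_derivative_cnj by blast
      then have D: "((\<lambda>x. cnj (quasi_deriv S f x)) has_vector_derivative
          of_real (qcoef S x) * ?h x - of_real (rcoef S x) * cnj (sl_tau S f x)) (at x)"
        by simp
      show ?case by (rule has_vector_derivative_cong_X[OF elim(2) eq D])
    qed
  qed
qed

lemma dom_max_D: "f \<in> dom_max S \<Longrightarrow> f \<in> sl_D S"
  by (simp add: dom_max_def)

lemma dom_max_add_mult:
  assumes f: "f \<in> dom_max S" and g: "g \<in> dom_max S"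
  shows "(\<lambda>x. f x + c * g x) \<in> dom_max S"
proof -
  note L = sl_D_add_mult[OF dom_max_D[OF f] dom_max_D[OF g], where c = c]
  have "AE x in M. sl_tau S f x + c * sl_tau S g x = sl_tau S (\<lambda>x. f x + c * g x) x"
    using L(3) unfolding AE_M by eventually_elim simp
  moreover have "(\<lambda>x. sl_tau S f x + c * sl_tau S g x) \<in> L2 M"
    using f g by (intro L2_add_mult) (auto simp: dom_max_def)
  ultimately have "sl_tau S (\<lambda>x. f x + c * g x) \<in> L2 M" by (rule L2_AE_cong[rotated])
  moreover have "(\<lambda>x. f x + c * g x) \<in> L2 M"
    using f g by (intro L2_add_mult) (auto simp: dom_max_def)
  ultimately show ?thesis using L(1) by (simp add: dom_max_def)
qed

lemma dom_max_cnj: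
  assumes f: "f \<in> dom_max S"
  shows "(\<lambda>x. cnj (f x)) \<in> dom_max S"
proof -
  note L = sl_D_cnj[OF dom_max_D[OF f]]
  have "AE x in M. cnj (sl_tau S f x) = sl_tau S (\<lambda>x. cnj (f x)) x"
    using L(3) unfolding AE_M by eventually_elim simp
  moreover have "(\<lambda>x. cnj (sl_tau S f x)) \<in> L2 M"
    using f by (intro L2_cnj) (auto simp: dom_max_def)
  ultimately have "sl_tau S (\<lambda>x. cnj (f x)) \<in> L2 M" by (rule L2_AE_cong[rotated])
  moreover have "(\<lambda>x. cnj (f x)) \<in> L2 M" using f by (intro L2_cnj) (auto simp: dom_max_def)
  ultimately show ?thesis using L(1) by (simp add: dom_max_def)
qed

lemma dom_max_AE_eq:
  assumes "f \<in> dom_max S" "g \<in> dom_max S" "AE x in M. f x = g x" "x \<in> X"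
  shows "f x = g x"
proof (rule continuous_ae_eq_imp_eq[OF open_X _ _ _ assms(4)])
  show "continuous_on X f" "continuous_on X g"
    using assms(1,2) dom_max_D sl_D_continuous(1) by auto
  show "AE x in lebesgue_on X. f x = g x" using assms(3) unfolding AE_M .
qed

end

section \<open>The Lagrange bracket at the endpoints\<close>

text \<open>
Both boundary values of the bracket in one notation: the filter \<open>E\<close> tells the endpoint, so that
everything that holds at either endpoint needs only one proof.
\<close>

definition bdry :: "sl_expr \<Rightarrow> ereal filter \<Rightarrow> (real \<Rightarrow> complex) \<Rightarrow> (real \<Rightarrow> complex) \<Rightarrow> complex" where
  "bdry S E f g = Lim E (\<lambda>t. bracket S f g (real_of_ereal t))"

lemma bracket_l_bdry: "bracket_l S f g = bdry S (at_right (lend S)) f g"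
  by (simp add: bracket_l_def bdry_def)

lemma bracket_r_bdry: "bracket_r S f g = bdry S (at_left (rend S)) f g"
  by (simp add: bracket_r_def bdry_def)

context sl_problem
begin

definition is_end :: "ereal filter \<Rightarrow> bool" where
  "is_end E \<longleftrightarrow> E = at_right (lend S) \<or> E = at_left (rend S)"

lemma real_of_ereal_in_X:
  assumes "lend S < t" "t < rend S"
  shows "real_of_ereal t \<in> X"
proof -
  have "ereal (real_of_ereal t) = t" using assms by (cases t) auto
  then show ?thesis using assms by (simp add: sl_int_def einterval_def)
qed

lemma end_in_X:
  assumes "is_end E"
  shows "\<forall>\<^sub>F t in E. real_of_ereal t \<in> X"
proof -
  have "\<forall>\<^sub>F t in at_right (lend S). real_of_ereal t \<in> X"
    unfolding eventually_at_right[OF ends] using real_of_ereal_in_X ends by blast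
  moreover have "\<forall>\<^sub>F t in at_left (rend S). real_of_ereal t \<in> X"
    unfolding eventually_at_left[OF ends] using real_of_ereal_in_X ends by blast
  ultimately show ?thesis using assms unfolding is_end_def by blast
qed

lemma end_nontrivial:
  assumes "is_end E"
  shows "E \<noteq> bot"
proof -
  have "at_right (lend S) \<noteq> bot"
  proof
    assume "at_right (lend S) = bot"
    then have "\<forall>\<^sub>F t in at_right (lend S). False" by simp
    then show False unfolding eventually_at_right[OF ends] using dense by blast
  qed
  moreover have "at_left (rend S) \<noteq> bot"
  proof
    assume "at_left (rend S) = bot"
    then have "\<forall>\<^sub>F t in at_left (rend S). False" by simp
    then show False unfolding eventually_at_left[OF ends] using dense by blast
  qed
  ultimately show ?thesis using assms unfolding is_end_def by metis
qed

lemma AC_loc_bracket: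
  assumes f: "f \<in> sl_D S" and g: "g \<in> sl_D S"
  shows "AC_loc X (bracket S f g)"
  unfolding AC_loc_def
proof (intro allI impI)
  fix u v assume uv: "u \<le> v \<and> {u..v} \<subseteq> X"
  have on: "AC_on u v h" if "AC_loc X h" for h using that uv unfolding AC_loc_def by blast
  note F = on[OF sl_D_AC(1)[OF f]] on[OF sl_D_AC(2)[OF f]]
  note G = on[OF sl_D_AC(1)[OF g]] on[OF sl_D_AC(2)[OF g]]
  have "AC_on u v (\<lambda>x. f x * cnj (quasi_deriv S g x) + (-1) * (quasi_deriv S f x * cnj (g x)))"
    by (rule AC_on_add[OF AC_on_mult[OF F(1) AC_on_cnj[OF G(2)]]
          AC_on_mult[OF AC_on_const AC_on_mult[OF F(2) AC_on_cnj[OF G(1)]]]])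
  then show "AC_on u v (bracket S f g)" by (simp add: bracket_def[abs_def])
qed

text \<open>
Lagrange's identity in differential form. The terms with \<open>1/p\<close> and with \<open>q\<close> cancel because the
coefficients are real.
\<close>

lemma bracket_derivative:
  assumes f: "f \<in> sl_D S" and g: "g \<in> sl_D S"
  shows "AE x in lebesgue_on X. (bracket S f g has_vector_derivative
    rcoef S x *\<^sub>R (sl_tau S f x * cnj (g x) - f x * cnj (sl_tau S g x))) (at x)"
  using sl_D_AE_derivatives[OF f] sl_D_AE_derivatives[OF g]
proof eventually_elim
  case (elim x)
  let ?p = "complex_of_real (pcoef S x)" and ?q = "complex_of_real (qcoef S x)"
    and ?r = "complex_of_real (rcoef S x)"
  have F1: "(f has_vector_derivative quasi_deriv S f x / ?p) (at x)"
    and F2: "(quasi_deriv S f has_vector_derivative ?q * f x - ?r * sl_tau S f x) (at x)"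
    and G1: "((\<lambda>x. cnj (g x)) has_vector_derivative cnj (quasi_deriv S g x / ?p)) (at x)"
    and G2: "((\<lambda>x. cnj (quasi_deriv S g x)) has_vector_derivative
        cnj (?q * g x - ?r * sl_tau S g x)) (at x)"
    using elim has_vector_derivative_cnj by blast+
  have "((\<lambda>x. f x * cnj (quasi_deriv S g x) - quasi_deriv S f x * cnj (g x)) has_vector_derivative
      (f x * cnj (?q * g x - ?r * sl_tau S g x) + quasi_deriv S f x / ?p * cnj (quasi_deriv S g x)) -
      (quasi_deriv S f x * cnj (quasi_deriv S g x / ?p) + (?q * f x - ?r * sl_tau S f x) * cnj (g x))) (at x)"
    by (intro has_vector_derivative_diff has_vector_derivative_mult F1 F2 G1 G2)
  moreover have "(f x * cnj (?q * g x - ?r * sl_tau S g x) + quasi_deriv S f x / ?p * cnj (quasi_deriv S g x)) -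
      (quasi_deriv S f x * cnj (quasi_deriv S g x / ?p) + (?q * f x - ?r * sl_tau S f x) * cnj (g x)) =
      rcoef S x *\<^sub>R (sl_tau S f x * cnj (g x) - f x * cnj (sl_tau S g x))"
    by (simp add: scaleR_conv_of_real algebra_simps)
  ultimately show ?case by (simp add: bracket_def[abs_def])
qed

lemma bracket_limits:
  assumes f: "f \<in> dom_max S" and g: "g \<in> dom_max S"
  shows "\<exists>l r. ((\<lambda>t. bracket S f g (real_of_ereal t)) \<longlongrightarrow> l) (at_right (lend S)) \<and>
    ((\<lambda>t. bracket S f g (real_of_ereal t)) \<longlongrightarrow> r) (at_left (rend S)) \<and>
    r - l = (LINT x|M. sl_tau S f x * cnj (g x) - f x * cnj (sl_tau S g x))"
proof -
  define w where "w = (\<lambda>x. sl_tau S f x * cnj (g x) - f x * cnj (sl_tau S g x))"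
  have L: "f \<in> L2 M" "g \<in> L2 M" "sl_tau S f \<in> L2 M" "sl_tau S g \<in> L2 M"
    using f g by (auto simp: dom_max_def)
  have w: "integrable M w"
    unfolding w_def using L by (intro Bochner_Integration.integrable_diff L2_mult_integrable L2_cnj)
  then have wm: "w \<in> borel_measurable (lebesgue_on X)"
    using borel_measurable_integrable borel_M by blast
  have nn: "AE x in lebesgue_on X. 0 \<le> rcoef S x" using rcoef_pos by eventually_elim simp
  have k: "integrable (lebesgue_on X) (\<lambda>x. rcoef S x *\<^sub>R w x)"
    using w integrable_density[OF wm rcoef_measurable nn] unfolding sl_measure_def by simp
  have eq: "(LINT x|M. w x) = (LINT x|lebesgue_on X. rcoef S x *\<^sub>R w x)"
    unfolding sl_measure_def by (rule integral_density[OF wm rcoef_measurable nn])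
  note fD = dom_max_D[OF f] and gD = dom_max_D[OF g]
  show ?thesis
    using AC_loc_endpoint_limits[OF ends, of "bracket S f g" "\<lambda>x. rcoef S x *\<^sub>R w x"]
      AC_loc_bracket[OF fD gD] k bracket_derivative[OF fD gD] eq
    unfolding w_def sl_int_def by simp
qed

lemma bracket_tendsto:
  assumes E: "is_end E" and f: "f \<in> dom_max S" and g: "g \<in> dom_max S"
  shows "((\<lambda>t. bracket S f g (real_of_ereal t)) \<longlongrightarrow> bdry S E f g) E"
proof -
  obtain l where "((\<lambda>t. bracket S f g (real_of_ereal t)) \<longlongrightarrow> l) E"
    using bracket_limits[OF f g] E unfolding is_end_def by blast
  then show ?thesis using tendsto_Lim[OF end_nontrivial[OF E]] unfolding bdry_def by metis
qed

lemma bdry_eqI: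
  assumes E: "is_end E" and lim: "(F \<longlongrightarrow> L) E"
    and eq: "\<And>t. real_of_ereal t \<in> X \<Longrightarrow> F t = bracket S f g (real_of_ereal t)"
  shows "bdry S E f g = L"
proof -
  have "\<forall>\<^sub>F t in E. F t = bracket S f g (real_of_ereal t)"
    using end_in_X[OF E] by eventually_elim (rule eq)
  then have "((\<lambda>t. bracket S f g (real_of_ereal t)) \<longlongrightarrow> L) E"
    using lim by (rule Lim_transform_eventually[rotated])
  then show ?thesis unfolding bdry_def by (rule tendsto_Lim[OF end_nontrivial[OF E]])
qed

lemma green:
  assumes f: "f \<in> dom_max S" and g: "g \<in> dom_max S"
  shows "bracket_r S f g - bracket_l S f g =
    (LINT x|M. sl_tau S f x * cnj (g x) - f x * cnj (sl_tau S g x))"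
proof -
  obtain l r where lr: "((\<lambda>t. bracket S f g (real_of_ereal t)) \<longlongrightarrow> l) (at_right (lend S))"
    "((\<lambda>t. bracket S f g (real_of_ereal t)) \<longlongrightarrow> r) (at_left (rend S))"
    "r - l = (LINT x|M. sl_tau S f x * cnj (g x) - f x * cnj (sl_tau S g x))"
    using bracket_limits[OF f g] by blast
  have "bracket_l S f g = l"
    unfolding bracket_l_bdry by (rule bdry_eqI[OF _ lr(1)]) (auto simp: is_end_def)
  moreover have "bracket_r S f g = r"
    unfolding bracket_r_bdry by (rule bdry_eqI[OF _ lr(2)]) (auto simp: is_end_def)
  ultimately show ?thesis using lr(3) by simp
qed

lemma bdry_add_mult:
  assumes E: "is_end E" and f: "f \<in> dom_max S" and g: "g \<in> dom_max S" and h: "h \<in> dom_max S"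
  shows "bdry S E (\<lambda>x. f x + c * g x) h = bdry S E f h + c * bdry S E g h"
proof (rule bdry_eqI[OF E])
  show "((\<lambda>t. bracket S f h (real_of_ereal t) + c * bracket S g h (real_of_ereal t)) \<longlongrightarrow>
      bdry S E f h + c * bdry S E g h) E"
    by (intro tendsto_intros bracket_tendsto E f g h)
  fix t :: ereal assume "real_of_ereal t \<in> X"
  then show "bracket S f h (real_of_ereal t) + c * bracket S g h (real_of_ereal t) =
      bracket S (\<lambda>x. f x + c * g x) h (real_of_ereal t)"
    using sl_D_add_mult(2)[OF dom_max_D[OF f] dom_max_D[OF g]] by (simp add: bracket_def algebra_simps)
qed

lemma bdry_cong:
  assumes E: "is_end E" and f: "f \<in> dom_max S" and h: "h \<in> dom_max S"
    and eq: "\<And>x. x \<in> X \<Longrightarrow> g x = f x"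
  shows "bdry S E g h = bdry S E f h"
proof (rule bdry_eqI[OF E bracket_tendsto[OF E f h]])
  fix t :: ereal assume "real_of_ereal t \<in> X"
  moreover have "quasi_deriv S g = quasi_deriv S f" by (rule quasi_deriv_cong) (rule eq)
  ultimately show "bracket S f h (real_of_ereal t) = bracket S g h (real_of_ereal t)"
    by (simp add: bracket_def eq)
qed

text \<open>
The conjugate of a quasi-derivative is a quasi-derivative of the conjugate, and quasi-derivatives
are unique.
\<close>

lemma quasi_deriv_real:
  assumes f: "f \<in> sl_D S" and real: "\<And>x. x \<in> X \<Longrightarrow> f x \<in> \<real>" and x: "x \<in> X"
  shows "cnj (quasi_deriv S f x) = quasi_deriv S f x"
proof -
  have "quasi_deriv S (\<lambda>x. cnj (f x)) = quasi_deriv S f"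
    by (rule quasi_deriv_cong) (use real Reals_cnj_iff in blast)
  then show ?thesis using sl_D_cnj(2)[OF f x] by simp
qed

lemma bdry_cnj:
  assumes E: "is_end E" and f: "f \<in> dom_max S" and h: "h \<in> dom_max S"
    and real: "\<And>x. x \<in> X \<Longrightarrow> h x \<in> \<real>"
  shows "bdry S E (\<lambda>x. cnj (f x)) h = cnj (bdry S E f h)"
proof (rule bdry_eqI[OF E])
  show "((\<lambda>t. cnj (bracket S f h (real_of_ereal t))) \<longlongrightarrow> cnj (bdry S E f h)) E"
    by (intro tendsto_cnj bracket_tendsto E f h)
  fix t :: ereal assume t: "real_of_ereal t \<in> X"
  have "cnj (h (real_of_ereal t)) = h (real_of_ereal t)" using real[OF t] Reals_cnj_iff by blast
  then show "cnj (bracket S f h (real_of_ereal t)) = bracket S (\<lambda>x. cnj (f x)) h (real_of_ereal t)"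
    using sl_D_cnj(2)[OF dom_max_D[OF f] t] quasi_deriv_real[OF dom_max_D[OF h] real t]
    by (simp add: bracket_def)
qed

text \<open>
A bracket at an endpoint is expressed by the boundary values with respect to a boundary condition
basis. At each point, with \<open>W(f,g) = f (pg') - (pf') g\<close>, this is the Pluecker identity
\<open>W(f,g) W(h,k) = W(f,h) W(g,k) - W(f,k) W(g,h)\<close> for \<open>2\<times>2\<close> determinants, taken for the conjugate of \<open>u\<close> in the place of \<open>g\<close> and
for real \<open>h = \<psi>\<close>, \<open>k = \<phi>\<close>; both sides converge.
\<close>

lemma bdry_pluecker:
  assumes E: "is_end E" and f: "f \<in> dom_max S" and u: "u \<in> dom_max S"
    and \<phi>: "\<phi> \<in> dom_max S" "\<And>x. x \<in> X \<Longrightarrow> \<phi> x \<in> \<real>"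
    and \<psi>: "\<psi> \<in> dom_max S" "\<And>x. x \<in> X \<Longrightarrow> \<psi> x \<in> \<real>"
    and one: "bdry S E \<psi> \<phi> = 1"
  shows "bdry S E f u = bdry S E f \<psi> * cnj (bdry S E u \<phi>) - bdry S E f \<phi> * cnj (bdry S E u \<psi>)"
proof -
  let ?B = "\<lambda>f g t. bracket S f g (real_of_ereal t)"
  have t1: "((\<lambda>t. ?B f u t * ?B \<psi> \<phi> t) \<longlongrightarrow> bdry S E f u * bdry S E \<psi> \<phi>) E"
    by (intro tendsto_intros bracket_tendsto E f u \<phi>(1) \<psi>(1))
  have t2: "((\<lambda>t. ?B f \<psi> t * cnj (?B u \<phi> t) - ?B f \<phi> t * cnj (?B u \<psi> t)) \<longlongrightarrow>
      bdry S E f \<psi> * cnj (bdry S E u \<phi>) - bdry S E f \<phi> * cnj (bdry S E u \<psi>)) E"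
    by (intro tendsto_intros tendsto_cnj bracket_tendsto E f u \<phi>(1) \<psi>(1))
  have ev: "\<forall>\<^sub>F t in E. ?B f u t * ?B \<psi> \<phi> t = ?B f \<psi> t * cnj (?B u \<phi> t) - ?B f \<phi> t * cnj (?B u \<psi> t)"
    using end_in_X[OF E]
  proof eventually_elim
    case (elim t)
    have "cnj (\<phi> (real_of_ereal t)) = \<phi> (real_of_ereal t)" "cnj (\<psi> (real_of_ereal t)) = \<psi> (real_of_ereal t)"
      using \<phi>(2)[OF elim] \<psi>(2)[OF elim] Reals_cnj_iff by blast+
    then show ?case
      using quasi_deriv_real[OF dom_max_D[OF \<phi>(1)] \<phi>(2) elim] quasi_deriv_real[OF dom_max_D[OF \<psi>(1)] \<psi>(2) elim]
      by (simp add: bracket_def algebra_simps)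
  qed
  have "bdry S E f u * bdry S E \<psi> \<phi> =
      bdry S E f \<psi> * cnj (bdry S E u \<phi>) - bdry S E f \<phi> * cnj (bdry S E u \<psi>)"
    by (rule tendsto_unique[OF end_nontrivial[OF E] t1 t2[folded tendsto_cong[OF ev]]])
  then show ?thesis by (simp add: one)
qed

section \<open>Square integrability of solutions in the limit circle case\<close>

lemma X_Icc_subset: "c \<in> X \<Longrightarrow> d \<in> X \<Longrightarrow> {c..d} \<subseteq> X"
  unfolding sl_int_def by (rule einterval_Icc_subset)

lemma continuous_integrable_Icc:
  assumes u: "continuous_on X u" and cd: "c \<in> X" "d \<in> X"
  shows "set_integrable M {c..d} (u :: real \<Rightarrow> real)"
proof -
  have sub: "{c..d} \<subseteq> X" by (rule X_Icc_subset[OF cd])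
  have "L1_loc X (rcoef S)" using sl by (simp add: sturm_liouville_def)
  then have "set_integrable lebesgue {c..d} (rcoef S)" unfolding L1_loc_def using sub by simp
  then have r: "integrable lebesgue (\<lambda>x. indicator {c..d} x *\<^sub>R rcoef S x)" unfolding set_integrable_def .
  have "bounded (u ` {c..d})"
    by (rule compact_imp_bounded[OF compact_continuous_image[OF continuous_on_subset[OF u sub]]]) simp
  then obtain B where B: "\<And>x. x \<in> {c..d} \<Longrightarrow> \<bar>u x\<bar> \<le> B" unfolding bounded_iff real_norm_def by blast
  have um: "u \<in> borel_measurable (lebesgue_on X)"
    by (rule continuous_imp_measurable_on_sets_lebesgue[OF u X_sets])
  have iset: "{c..d} \<in> sets (lebesgue_on X)" using sub X_sets by (simp add: sets_restrict_space_iff)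
  have im: "(\<lambda>x. indicator {c..d} x *\<^sub>R u x) \<in> borel_measurable (lebesgue_on X)"
    using um iset by measurable
  have rX: "integrable (lebesgue_on X) (\<lambda>x. B * (indicator {c..d} x *\<^sub>R rcoef S x))"
  proof -
    have "(\<lambda>x. indicator X x *\<^sub>R (indicator {c..d} x *\<^sub>R rcoef S x)) = (\<lambda>x. indicator {c..d} x *\<^sub>R rcoef S x)"
      using sub by (auto simp: indicator_def fun_eq_iff)
    then show ?thesis using r X_sets by (simp add: integrable_restrict_space)
  qed
  have nn: "AE x in lebesgue_on X. 0 \<le> rcoef S x" using rcoef_pos by eventually_elim simp
  have "integrable (lebesgue_on X) (\<lambda>x. rcoef S x *\<^sub>R (indicator {c..d} x *\<^sub>R u x))"
  proof (rule Bochner_Integration.integrable_bound[OF rX])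
    show "(\<lambda>x. rcoef S x *\<^sub>R (indicator {c..d} x *\<^sub>R u x)) \<in> borel_measurable (lebesgue_on X)"
      using im rcoef_measurable by measurable
    show "AE x in lebesgue_on X. norm (rcoef S x *\<^sub>R (indicator {c..d} x *\<^sub>R u x))
        \<le> norm (B * (indicator {c..d} x *\<^sub>R rcoef S x))"
    proof (rule AE_I2)
      fix x
      show "norm (rcoef S x *\<^sub>R (indicator {c..d} x *\<^sub>R u x)) \<le> norm (B * (indicator {c..d} x *\<^sub>R rcoef S x))"
      proof (cases "x \<in> {c..d}")
        case True
        have "\<bar>rcoef S x\<bar> * \<bar>u x\<bar> \<le> \<bar>rcoef S x\<bar> * \<bar>B\<bar>"
          using B[OF True] by (intro mult_left_mono) auto
        then show ?thesis using True by (simp add: abs_mult mult.commute)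
      qed simp
    qed
  qed
  then show ?thesis
    unfolding set_integrable_def sl_measure_def using integrable_density[OF im rcoef_measurable nn] by simp
qed

text \<open>
The limit circle condition gives square integrability near both ends; in between, solutions are
bounded and \<open>r\<close> is integrable.
\<close>

lemma solution_dom_max:
  assumes lcl: "limit_circle_l S" and lcr: "limit_circle_r S" and u: "sl_solution S z u"
  shows "u \<in> dom_max S" and "AE x in M. sl_tau S u x = z * u x"
proof -
  have uD: "u \<in> sl_D S" and ae: "AE x in lebesgue_on X. sl_tau S u x = z * u x"
    using u by (auto simp: sl_solution_def)
  show aeM: "AE x in M. sl_tau S u x = z * u x" using ae by (simp add: AE_M)
  have cont: "continuous_on X u" by (rule sl_D_continuous(1)[OF uD])
  have um: "u \<in> borel_measurable M"
    unfolding borel_M by (rule continuous_imp_measurable_on_sets_lebesgue[OF cont X_sets])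
  obtain c where c: "c \<in> X" "set_integrable M (einterval (lend S) (ereal c)) (\<lambda>x. (cmod (u x))\<^sup>2)"
    using lcl u unfolding limit_circle_l_def by blast
  obtain d where d: "d \<in> X" "set_integrable M (einterval (ereal d) (rend S)) (\<lambda>x. (cmod (u x))\<^sup>2)"
    using lcr u unfolding limit_circle_r_def by blast
  \<comment> \<open>If \<open>d < c\<close>, the middle interval is empty and the outer two already cover \<open>(a,b)\<close>.\<close>
  have mid: "set_integrable M {c..d} (\<lambda>x. (cmod (u x))\<^sup>2)"
    by (rule continuous_integrable_Icc[OF _ c(1) d(1)]) (intro continuous_intros cont)
  have cX: "lend S < ereal c" "ereal c < rend S" "lend S < ereal d" "ereal d < rend S"
    using c(1) d(1) by (auto simp: sl_int_def einterval_def)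
  have sets: "A \<in> sets M" if "A \<in> sets lebesgue" "A \<subseteq> X" for A
    using that X_sets unfolding sl_measure_def by (simp add: sets_restrict_space_iff)
  have sub: "einterval (lend S) (ereal c) \<subseteq> X" "einterval (ereal d) (rend S) \<subseteq> X" "{c..d} \<subseteq> X"
  proof -
    have "ereal x < rend S" if "x < c" for x using less_trans[of "ereal x" "ereal c"] that cX by simp
    then show "einterval (lend S) (ereal c) \<subseteq> X" by (auto simp: sl_int_def einterval_def)
    have "lend S < ereal x" if "d < x" for x using less_trans[of _ "ereal d" "ereal x"] that cX by simp
    then show "einterval (ereal d) (rend S) \<subseteq> X" by (auto simp: sl_int_def einterval_def)
    show "{c..d} \<subseteq> X" by (rule X_Icc_subset[OF c(1) d(1)])
  qed
  have "set_integrable M (einterval (lend S) (ereal c) \<union> {c..d} \<union> einterval (ereal d) (rend S)) (\<lambda>x. (cmod (u x))\<^sup>2)"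
    using c(2) d(2) mid sub by (intro set_integrable_Un sets.Un sets) auto
  moreover have "einterval (lend S) (ereal c) \<union> {c..d} \<union> einterval (ereal d) (rend S) = X"
  proof
    show "X \<subseteq> einterval (lend S) (ereal c) \<union> {c..d} \<union> einterval (ereal d) (rend S)"
      by (auto simp: sl_int_def einterval_def)
  qed (use sub in blast)
  ultimately have "set_integrable M X (\<lambda>x. (cmod (u x))\<^sup>2)" by simp
  moreover have "integrable M (\<lambda>x. indicator X x *\<^sub>R (cmod (u x))\<^sup>2) = integrable M (\<lambda>x. (cmod (u x))\<^sup>2)"
    by (rule Bochner_Integration.integrable_cong) (auto simp: sl_measure_def)
  ultimately have uL: "u \<in> L2 M" using um unfolding set_integrable_def L2_def by simp
  have "AE x in M. z * u x = sl_tau S u x" using aeM by eventually_elim simp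
  then have "sl_tau S u \<in> L2 M" by (rule L2_AE_cong[OF L2_scale[OF uL]])
  then show "u \<in> dom_max S" using uD uL by (simp add: dom_max_def)
qed

end

section \<open>Realizations, common parts and resolvents\<close>

lemma op_shift_iff: "(f, k) \<in> op_shift T z \<longleftrightarrow> (f, \<lambda>x. k x + z * f x) \<in> T"
proof
  assume "(f, k) \<in> op_shift T z"
  then obtain h where "k = (\<lambda>x. h x - z * f x)" "(f, h) \<in> T" by (auto simp: op_shift_def)
  then show "(f, \<lambda>x. k x + z * f x) \<in> T" by simp
next
  assume T: "(f, \<lambda>x. k x + z * f x) \<in> T"
  define h where "h = (\<lambda>x. k x + z * f x)"
  have "(f, \<lambda>x. h x - z * f x) \<in> op_shift T z"
    unfolding op_shift_def
    by (rule CollectI, rule exI[of _ f], rule exI[of _ h]) (use T in \<open>simp add: h_def\<close>)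
  then show "(f, k) \<in> op_shift T z" by (simp add: h_def)
qed

lemma op_add_iff:
  "p \<in> op_add A B \<longleftrightarrow> (\<exists>f g h. p = (f, \<lambda>x. g x + h x) \<and> (f, g) \<in> A \<and> (f, h) \<in> B)"
  unfolding op_add_def by simp

context sl_problem
begin

text \<open>
The restriction of the maximal operator by a boundary condition \<open>P\<close>. In contrast to
\<open>op_restrict\<close>, one and the same representative serves for membership in the domain, for the
value of the operator and for the boundary condition.
\<close>

definition realization :: "((real \<Rightarrow> complex) \<Rightarrow> bool) \<Rightarrow> l2op" where
  "realization P = {(f, h). f \<in> L2 M \<and> h \<in> L2 M \<and>
     (\<exists>g\<in>dom_max S. P g \<and> (AE x in M. f x = g x) \<and> (AE x in M. h x = sl_tau S g x))}"

lemma realization_iff: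
  "(f, h) \<in> realization P \<longleftrightarrow> f \<in> L2 M \<and> h \<in> L2 M \<and>
     (\<exists>g. g \<in> dom_max S \<and> P g \<and> (AE x in M. f x = g x) \<and> (AE x in M. h x = sl_tau S g x))"
  unfolding realization_def Bex_def mem_Collect_eq case_prod_conv by (rule refl)

lemma realizationI:
  assumes "f \<in> L2 M" "h \<in> L2 M" "g \<in> dom_max S" "P g"
    "AE x in M. f x = g x" "AE x in M. h x = sl_tau S g x"
  shows "(f, h) \<in> realization P"
  unfolding realization_iff
proof (intro conjI exI[of _ g])
qed (fact assms)+

lemma realizationE:
  assumes "(f, h) \<in> realization P"
  obtains g where "f \<in> L2 M" "h \<in> L2 M" "g \<in> dom_max S" "P g"
    "AE x in M. f x = g x" "AE x in M. h x = sl_tau S g x"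
proof -
  note fh = assms[unfolded realization_iff]
  from conjunct2[OF conjunct2[OF fh]] obtain g where g: "g \<in> dom_max S \<and> P g \<and>
    (AE x in M. f x = g x) \<and> (AE x in M. h x = sl_tau S g x)" by (rule exE)
  show thesis
    by (rule that[of g]) (simp_all only: fh g)
qed

lemma AE_eq_trans:
  assumes "AE x in M. f x = g x" "AE x in M. f x = h x"
  shows "AE x in M. g x = h x"
  using assms by eventually_elim simp

text \<open>
Two members of \<open>dom_max\<close> that agree almost everywhere agree on \<open>(a,b)\<close>, so the representative
that defines the value of \<open>T_max\<close> and the one that satisfies \<open>P\<close> have the same image under \<open>\<tau>\<close>.
\<close>

lemma op_restrict_realization:
  "op_restrict M (T_max S) {g \<in> dom_max S. P g} = realization P"
proof (intro set_eqI iffI)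
  fix p assume "p \<in> op_restrict M (T_max S) {g \<in> dom_max S. P g}"
  then obtain f h g g0 where p: "p = (f, h)" "f \<in> L2 M" "h \<in> L2 M"
    and g: "g \<in> dom_max S" "P g" "AE x in M. f x = g x"
    and g0: "g0 \<in> dom_max S" "AE x in M. f x = g0 x" "AE x in M. h x = sl_tau S g0 x"
    unfolding op_restrict_def T_max_def by blast
  have eq: "g0 x = g x" if "x \<in> X" for x
    by (rule dom_max_AE_eq[OF g0(1) g(1) AE_eq_trans[OF g0(2) g(3)] that])
  have "AE x in M. x \<in> X" unfolding AE_M by (rule AE_X)
  with g0(3) have hg: "AE x in M. h x = sl_tau S g x"
  proof eventually_elim
    case (elim x)
    have "sl_tau S g0 x = sl_tau S g x" by (rule sl_tau_cong[OF eq elim(2)])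
    with elim show ?case by simp
  qed
  show "p \<in> realization P" unfolding p(1) by (rule realizationI[of f h g P, OF p(2,3) g hg])
next
  fix p assume p: "p \<in> realization P"
  obtain f h where fh: "p = (f, h)" by (cases p)
  obtain g where g: "f \<in> L2 M" "h \<in> L2 M" "g \<in> dom_max S" "P g"
    "AE x in M. f x = g x" "AE x in M. h x = sl_tau S g x"
    using p unfolding fh by (rule realizationE) (rule that)
  have "(f, h) \<in> T_max S" using g(1-3,5,6) unfolding T_max_def by auto
  then show "p \<in> op_restrict M (T_max S) {g \<in> dom_max S. P g}"
    unfolding op_restrict_def fh using g(3-5) by auto
qed

text \<open>
Both operators act as \<open>\<tau>\<close>, so they agree wherever both are defined. The second condition is
tested on a representative that may differ off \<open>(a,b)\<close>, which is why it has to depend on the values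
on \<open>(a,b)\<close> only.
\<close>

lemma common_part_realization:
  assumes inv: "\<And>f g. \<lbrakk>f \<in> dom_max S; g \<in> dom_max S; \<And>x. x \<in> X \<Longrightarrow> f x = g x; Q f\<rbrakk> \<Longrightarrow> Q g"
  shows "max_common_part M (realization P) (realization Q) = realization (\<lambda>g. P g \<and> Q g)"
proof (intro set_eqI iffI)
  fix p assume "p \<in> max_common_part M (realization P) (realization Q)"
  then obtain f h f' h' where p: "p = (f, h)" and P: "(f, h) \<in> realization P"
    and Q: "(f', h') \<in> realization Q" and ff': "AE x in M. f x = f' x"
    unfolding max_common_part_def op_restrict_def by blast
  obtain g where g: "f \<in> L2 M" "h \<in> L2 M" "g \<in> dom_max S" "P g" "AE x in M. f x = g x"
      "AE x in M. h x = sl_tau S g x"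
    using P by (rule realizationE) (rule that)
  obtain g' where g': "g' \<in> dom_max S" "Q g'" "AE x in M. f' x = g' x"
    using Q by (rule realizationE) (rule that)
  have "AE x in M. g' x = g x" using ff' g(5) g'(3) by eventually_elim simp
  then have "Q g" by (intro inv[OF g'(1) g(3) _ g'(2)] dom_max_AE_eq[OF g'(1) g(3)])
  with g(4) have PQ: "P g \<and> Q g" by blast
  show "p \<in> realization (\<lambda>g. P g \<and> Q g)"
    unfolding p by (rule realizationI[of f h g "\<lambda>g. P g \<and> Q g", OF g(1-3) PQ g(5,6)])
next
  fix p assume p: "p \<in> realization (\<lambda>g. P g \<and> Q g)"
  obtain f h where fh: "p = (f, h)" by (cases p)
  obtain g where g: "f \<in> L2 M" "h \<in> L2 M" "g \<in> dom_max S" "P g \<and> Q g"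
    "AE x in M. f x = g x" "AE x in M. h x = sl_tau S g x"
    using p unfolding fh by (rule realizationE) (rule that)
  have PQ: "(f, h) \<in> realization P" "(f, h) \<in> realization Q"
    by (rule realizationI[of f h g P, OF g(1-3) conjunct1[OF g(4)] g(5,6)],
        rule realizationI[of f h g Q, OF g(1-3) conjunct2[OF g(4)] g(5,6)])
  have f: "f \<in> {f. \<exists>h. (f, h) \<in> realization P \<and> (f, h) \<in> realization Q}"
    by (intro CollectI exI[of _ h] conjI PQ)
  show "p \<in> max_common_part M (realization P) (realization Q)"
    unfolding max_common_part_def op_restrict_def fh
    using PQ(1) bexI[OF _ f, of "\<lambda>g. AE x in M. f x = g x"] by simp
qed

lemma shift_realizationI:
  assumes "f \<in> L2 M" "k \<in> L2 M" "g \<in> dom_max S" "P g"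
    "AE x in M. f x = g x" "AE x in M. k x = sl_tau S g x - z * g x"
  shows "(f, k) \<in> op_shift (realization P) z"
  unfolding op_shift_iff
proof (rule realizationI[of f _ g P, OF assms(1) _ assms(3-5)])
  show "(\<lambda>x. k x + z * f x) \<in> L2 M" by (rule L2_add_mult[OF assms(2,1)])
  show "AE x in M. k x + z * f x = sl_tau S g x" using assms(5,6) by eventually_elim simp
qed

lemma shift_realizationE:
  assumes "(f, k) \<in> op_shift (realization P) z"
  obtains g where "f \<in> L2 M" "k \<in> L2 M" "g \<in> dom_max S" "P g"
    "AE x in M. f x = g x" "AE x in M. k x = sl_tau S g x - z * g x"
proof -
  obtain g where g: "f \<in> L2 M" "(\<lambda>x. k x + z * f x) \<in> L2 M" "g \<in> dom_max S" "P g"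
     "AE x in M. f x = g x" "AE x in M. k x + z * f x = sl_tau S g x"
    using assms unfolding op_shift_iff by (rule realizationE) (rule that)
  have "(\<lambda>x. (k x + z * f x) + (- z) * f x) \<in> L2 M" by (rule L2_add_mult[OF g(2,1)])
  then have kL: "k \<in> L2 M" by simp
  have ae: "AE x in M. k x = sl_tau S g x - z * g x"
    using g(5,6)
  proof eventually_elim
    case (elim x)
    then have "k x = sl_tau S g x - z * f x" by (simp add: eq_diff_eq)
    with elim show ?case by simp
  qed
  show thesis by (rule that[OF g(1) kL g(3-5) ae])
qed

lemma shift_realization_cnj:
  assumes P: "\<And>g. \<lbrakk>g \<in> dom_max S; P g\<rbrakk> \<Longrightarrow> P (\<lambda>x. cnj (g x))"
    and fk: "(f, k) \<in> op_shift (realization P) z"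
  shows "(\<lambda>x. cnj (f x), \<lambda>x. cnj (k x)) \<in> op_shift (realization P) (cnj z)"
proof -
  obtain g where g: "f \<in> L2 M" "k \<in> L2 M" "g \<in> dom_max S" "P g"
     "AE x in M. f x = g x" "AE x in M. k x = sl_tau S g x - z * g x"
    using fk by (rule shift_realizationE) (rule that)
  have fg: "AE x in M. cnj (f x) = cnj (g x)" using g(5) by eventually_elim simp
  have "AE x in M. sl_tau S (\<lambda>x. cnj (g x)) x = cnj (sl_tau S g x)"
    unfolding AE_M by (rule sl_D_cnj(3)[OF dom_max_D[OF g(3)]])
  with g(6) have kg: "AE x in M. cnj (k x) = sl_tau S (\<lambda>x. cnj (g x)) x - cnj z * cnj (g x)"
    by eventually_elim simp
  show ?thesis
    by (rule shift_realizationI[where P = P, OF L2_cnj[OF g(1)] L2_cnj[OF g(2)] dom_max_cnj[OF g(3)]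
          P[OF g(3,4)] fg kg])
qed

text \<open>
The coefficients being real, complex conjugation carries \<open>T - z\<close> over to \<open>T - cnj z\<close> whenever the
boundary condition is real.
\<close>

lemma resolvent_set_cnj:
  assumes P: "\<And>g. \<lbrakk>g \<in> dom_max S; P g\<rbrakk> \<Longrightarrow> P (\<lambda>x. cnj (g x))"
    and z: "z \<in> resolvent_set M (realization P)"
  shows "cnj z \<in> resolvent_set M (realization P)"
proof -
  let ?R = "op_shift (realization P)"
  note z' = z[unfolded resolvent_set_def mem_Collect_eq]
  have surj: "\<exists>f. (f, g) \<in> ?R z" if "g \<in> L2 M" for g
    by (rule bspec[OF conjunct1[OF z'] that])
  have inj: "AE x in M. f x = f' x" if "(f, g) \<in> ?R z" "(f', g) \<in> ?R z" for f f' g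
    using z'[THEN conjunct2, THEN conjunct1, rule_format, OF conjI[OF that]] .
  obtain C where C: "\<forall>(f, g)\<in>?R z. L2_norm M f \<le> C * L2_norm M g"
    using conjunct2[OF conjunct2[OF z']] by (elim exE)
  have flip: "(\<lambda>x. cnj (f x), \<lambda>x. cnj (g x)) \<in> ?R (cnj y)" if "(f, g) \<in> ?R y" for f g y
    by (rule shift_realization_cnj[OF _ that]) (rule P)
  have flip': "(\<lambda>x. cnj (f x), \<lambda>x. cnj (g x)) \<in> ?R z" if "(f, g) \<in> ?R (cnj z)" for f g
    using flip[OF that] by simp
  show ?thesis
    unfolding resolvent_set_def
  proof (intro CollectI conjI ballI allI impI)
    fix g assume g: "g \<in> L2 M"
    obtain f where "(f, \<lambda>x. cnj (g x)) \<in> ?R z" using surj[OF L2_cnj[OF g]] by (elim exE)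
    from flip[OF this] have "(\<lambda>x. cnj (f x), g) \<in> ?R (cnj z)" by simp
    then show "\<exists>f. (f, g) \<in> ?R (cnj z)" by blast
  next
    fix f f' g assume "(f, g) \<in> ?R (cnj z) \<and> (f', g) \<in> ?R (cnj z)"
    then have "AE x in M. cnj (f x) = cnj (f' x)"
      by (intro inj[of "\<lambda>x. cnj (f x)" "\<lambda>x. cnj (g x)" "\<lambda>x. cnj (f' x)"] flip') simp_all
    then show "AE x in M. f x = f' x" by eventually_elim simp
  next
    have "L2_norm M f \<le> C * L2_norm M g" if "(f, g) \<in> ?R (cnj z)" for f g
      using bspec[OF C flip'[OF that]] by (simp add: L2_norm_def)
    then show "\<exists>C. \<forall>(f, g)\<in>?R (cnj z). L2_norm M f \<le> C * L2_norm M g"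
      by (intro exI[of _ C]) (simp add: case_prod_beta)
  qed
qed

text \<open>
What the resolvent formula uses of the maps \<open>g \<mapsto> [g,\<phi>](c)\<close>: linearity on \<open>dom_max\<close>, dependence
on the values on \<open>(a,b)\<close> only, and reality.
\<close>

definition boundary_functional :: "((real \<Rightarrow> complex) \<Rightarrow> complex) \<Rightarrow> bool" where
  "boundary_functional l \<longleftrightarrow>
     (\<forall>f\<in>dom_max S. \<forall>g\<in>dom_max S. \<forall>c. l (\<lambda>x. f x + c * g x) = l f + c * l g) \<and>
     (\<forall>f\<in>dom_max S. \<forall>g\<in>dom_max S. (\<forall>x\<in>X. f x = g x) \<longrightarrow> l f = l g) \<and>
     (\<forall>f\<in>dom_max S. l (\<lambda>x. cnj (f x)) = cnj (l f))"

lemma boundary_functionalD: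
  assumes "boundary_functional l"
  shows "\<And>f g c. f \<in> dom_max S \<Longrightarrow> g \<in> dom_max S \<Longrightarrow> l (\<lambda>x. f x + c * g x) = l f + c * l g"
    and "\<And>f g. f \<in> dom_max S \<Longrightarrow> g \<in> dom_max S \<Longrightarrow> (\<And>x. x \<in> X \<Longrightarrow> f x = g x) \<Longrightarrow> l f = l g"
    and "\<And>f. f \<in> dom_max S \<Longrightarrow> l (\<lambda>x. cnj (f x)) = cnj (l f)"
proof -
  note D = assms[unfolded boundary_functional_def]
  show "l (\<lambda>x. f x + c * g x) = l f + c * l g" if "f \<in> dom_max S" "g \<in> dom_max S" for f g c
    using D[THEN conjunct1] that by simp
  show "l f = l g" if "f \<in> dom_max S" "g \<in> dom_max S" "\<And>x. x \<in> X \<Longrightarrow> f x = g x" for f g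
    using D[THEN conjunct2, THEN conjunct1, rule_format, OF that(1,2)] that(3) .
  show "l (\<lambda>x. cnj (f x)) = cnj (l f)" if "f \<in> dom_max S" for f
    using D[THEN conjunct2, THEN conjunct2] that by simp
qed

lemma bdry_boundary_functional:
  assumes E: "is_end E" and h: "h \<in> dom_max S" and real: "\<And>x. x \<in> X \<Longrightarrow> h x \<in> \<real>"
  shows "boundary_functional (\<lambda>g. bdry S E g h)"
  unfolding boundary_functional_def
proof (intro conjI ballI allI impI)
  fix f assume f: "f \<in> dom_max S"
  show "bdry S E (\<lambda>x. cnj (f x)) h = cnj (bdry S E f h)" by (rule bdry_cnj[OF E f h real])
  fix g assume g: "g \<in> dom_max S"
  show "bdry S E (\<lambda>x. f x + c * g x) h = bdry S E f h + c * bdry S E g h" for c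
    by (rule bdry_add_mult[OF E f g h])
  assume "\<forall>x\<in>X. f x = g x"
  then show "bdry S E f h = bdry S E g h" by (intro bdry_cong[OF E g h]) blast
qed

lemma dom_max_solution_add_mult:
  assumes g: "g \<in> dom_max S" and u: "u \<in> dom_max S" and ae: "AE x in M. sl_tau S u x = z * u x"
  shows "AE x in M. sl_tau S (\<lambda>x. g x + c * u x) x - z * (g x + c * u x) = sl_tau S g x - z * g x"
proof -
  have "AE x in M. sl_tau S (\<lambda>x. g x + c * u x) x = sl_tau S g x + c * sl_tau S u x"
    unfolding AE_M by (rule sl_D_add_mult(3)[OF dom_max_D[OF g] dom_max_D[OF u]])
  then show ?thesis using ae
  proof eventually_elim
    case (elim x)
    show ?case unfolding elim by (simp add: algebra_simps)
  qed
qed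

text \<open>
The rank one resolvent formula, freed from the choice of the endpoint. The functional \<open>l\<close> gives the
boundary condition that both operators share, \<open>m\<close> the other condition of \<open>T0\<close>, and \<open>T1\<close> has
\<open>c m + s n = 0\<close> in the place of \<open>m = 0\<close>.

Let \<open>f = (T0 - z)\<inverse> k\<close>. Then \<open>f + \<kappa> u\<close> solves \<open>(\<tau> - z) y = k\<close> and satisfies \<open>l y = 0\<close> for every \<open>\<kappa>\<close>, and
the other condition of \<open>T1\<close> becomes \<open>\<kappa> (c + s (n u)) + s (n f) = 0\<close>. By the hypothesis \<open>green\<close>,
\<open>n f\<close> is, up to the sign \<open>\<sigma>\<close>, the inner product of \<open>v\<close> and \<open>k\<close>, so \<open>\<kappa>\<close> is \<open>inverse K\<close> times this inner
product. As \<open>T1 - z\<close> is injective, no other solution exists.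

For the second boundary condition at \<open>b\<close> the sign is \<open>\<sigma> = 1\<close>, at \<open>a\<close> it is \<open>\<sigma> = -1\<close>: these are the
signs of the boundary terms in Green's formula.
\<close>

lemma krein_resolvent_formula:
  fixes l m n :: "(real \<Rightarrow> complex) \<Rightarrow> complex" and c s \<sigma> z :: complex
  defines "T0 \<equiv> realization (\<lambda>g. l g = 0 \<and> m g = 0)"
    and "T1 \<equiv> realization (\<lambda>g. l g = 0 \<and> c * m g + s * n g = 0)"
  assumes l: "boundary_functional l" and m: "boundary_functional m" and n: "boundary_functional n"
    and s: "s \<noteq> 0" and \<sigma>: "\<sigma> * \<sigma> = 1"
    and z0: "z \<in> resolvent_set M T0" and z1: "z \<in> resolvent_set M T1"
    and u: "u \<in> dom_max S" "AE x in M. sl_tau S u x = z * u x" "l u = 0" "m u = 1"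
    and v: "v \<in> dom_max S" "AE x in M. sl_tau S v x = cnj z * v x"
    and green: "\<And>f. \<lbrakk>f \<in> dom_max S; l f = 0; m f = 0\<rbrakk> \<Longrightarrow>
      (LINT x|M. sl_tau S f x * cnj (v x) - f x * cnj (sl_tau S v x)) = \<sigma> * n f"
    and K: "K = - \<sigma> * (c / s + n u)"
  shows "K \<noteq> 0 \<and> (op_shift T1 z)\<inverse> = op_add ((op_shift T0 z)\<inverse>) (rank_one_op M (inverse K) v u)"
proof -
  have csK: "c + s * n u = - \<sigma> * s * K"
  proof -
    have "- \<sigma> * s * K = (\<sigma> * \<sigma>) * (s * (c / s) + s * n u)" unfolding K by (simp add: algebra_simps)
    then show ?thesis using \<sigma> s by simp
  qed
  have uL: "u \<in> L2 M" using u(1) by (simp add: dom_max_def)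
  have inj: "AE x in M. f x = f' x" if "(f, k) \<in> op_shift T1 z" "(f', k) \<in> op_shift T1 z" for f f' k
    using z1 that unfolding resolvent_set_def by blast
  have K0: "K \<noteq> 0"
  proof
    assume "K = 0"
    then have cs: "c + s * n u = 0" using csK by simp
    \<comment> \<open>If \<open>K = 0\<close>, then \<open>u\<close> satisfies the second boundary condition of \<open>T1\<close>, so \<open>u\<close> and \<open>w = 2u\<close> both
      solve \<open>(T1 - z) y = 0\<close>. Injectivity gives \<open>u = 2u\<close>, against \<open>m u = 1\<close>.\<close>
    define w where "w = (\<lambda>x. u x + 1 * u x)"
    have w: "w \<in> dom_max S" unfolding w_def by (rule dom_max_add_mult[OF u(1) u(1)])
    have wv: "l w = 0" "m w = 2" "n w = 2 * n u"
      using boundary_functionalD(1)[OF l u(1) u(1), of 1] boundary_functionalD(1)[OF m u(1) u(1), of 1]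
        boundary_functionalD(1)[OF n u(1) u(1), of 1] u(3,4) unfolding w_def by simp_all
    have zero: "(\<lambda>x. 0) \<in> L2 M" by (simp add: L2_def)
    have 0: "AE x in M. 0 = sl_tau S u x - z * u x" using u(2) by eventually_elim simp
    have 1: "(u, \<lambda>x. 0) \<in> op_shift T1 z"
      unfolding T1_def by (rule shift_realizationI[where g = u, OF uL zero u(1) _ _ 0]) (simp_all add: u(3,4) cs)
    have tw: "AE x in M. 0 = sl_tau S w x - z * w x"
      using dom_max_solution_add_mult[OF u(1) u(1) u(2), of 1] u(2) unfolding w_def by eventually_elim simp
    have "c * m w + s * n w = 2 * (c + s * n u)" using wv by (simp add: algebra_simps)
    then have bw: "l w = 0 \<and> c * m w + s * n w = 0" using wv(1) cs by simp
    have wL: "w \<in> L2 M" using w by (simp add: dom_max_def)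
    have 2: "(w, \<lambda>x. 0) \<in> op_shift T1 z"
      unfolding T1_def by (rule shift_realizationI[where g = w, OF wL zero w _ _ tw]) (use bw in simp_all)
    have "m u = m w"
      by (rule boundary_functionalD(2)[OF m u(1) w]) (rule dom_max_AE_eq[OF u(1) w inj[OF 1 2]])
    then show False using u(4) wv by simp
  qed
  have key: "(\<lambda>x. f x + e x, k) \<in> op_shift T1 z"
    if fk: "(f, k) \<in> op_shift T0 z" and e: "e \<in> L2 M" "AE x in M. e x = inverse K * L2_inner M v k * u x"
    for f k e
  proof -
    obtain g where g0: "f \<in> L2 M" "k \<in> L2 M" "g \<in> dom_max S" "l g = 0 \<and> m g = 0"
       "AE x in M. f x = g x" "AE x in M. k x = sl_tau S g x - z * g x"
      using fk unfolding T0_def by (rule shift_realizationE) (rule that)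
    note g = g0(1-3) g0(4)[THEN conjunct1] g0(4)[THEN conjunct2] g0(5,6)
    have vL: "v \<in> L2 M" "sl_tau S v \<in> L2 M" and gL: "g \<in> L2 M" "sl_tau S g \<in> L2 M"
      using v(1) g(3) by (auto simp: dom_max_def)
    have "L2_inner M v k = (LINT x|M. sl_tau S g x * cnj (v x) - g x * cnj (sl_tau S v x))"
      unfolding L2_inner_def
    proof (rule integral_cong_AE)
      show "AE x in M. cnj (v x) * k x = sl_tau S g x * cnj (v x) - g x * cnj (sl_tau S v x)"
        using g(7) v(2)
      proof eventually_elim
        case (elim x)
        show ?case unfolding elim by (simp add: algebra_simps)
      qed
      show "(\<lambda>x. cnj (v x) * k x) \<in> borel_measurable M"
        by (rule borel_measurable_integrable[OF L2_mult_integrable[OF L2_cnj[OF vL(1)] g(2)]])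
      show "(\<lambda>x. sl_tau S g x * cnj (v x) - g x * cnj (sl_tau S v x)) \<in> borel_measurable M"
        by (rule borel_measurable_integrable[OF Bochner_Integration.integrable_diff[OF
              L2_mult_integrable[OF gL(2) L2_cnj[OF vL(1)]] L2_mult_integrable[OF gL(1) L2_cnj[OF vL(2)]]]])
    qed
    also have "\<dots> = \<sigma> * n g" by (rule green[OF g(3-5)])
    finally have inner: "L2_inner M v k = \<sigma> * n g" .
    \<comment> \<open>The multiple of \<open>u\<close> for which \<open>g + \<kappa> u\<close> satisfies the second boundary condition of \<open>T1\<close>.\<close>
    define \<kappa> where "\<kappa> = inverse K * L2_inner M v k"
    define h where "h = (\<lambda>x. g x + \<kappa> * u x)"
    have h: "h \<in> dom_max S" unfolding h_def by (rule dom_max_add_mult[OF g(3) u(1)])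
    have hv: "l h = 0" "m h = \<kappa>" "n h = n g + \<kappa> * n u"
      using boundary_functionalD(1)[OF l g(3) u(1), of \<kappa>] boundary_functionalD(1)[OF m g(3) u(1), of \<kappa>]
        boundary_functionalD(1)[OF n g(3) u(1), of \<kappa>] u(3,4) g(4,5) unfolding h_def by simp_all
    have "c * m h + s * n h = \<kappa> * (c + s * n u) + s * n g" unfolding hv by (simp add: algebra_simps)
    also have "\<dots> = - (\<sigma> * s) * (K * \<kappa>) + s * n g" unfolding csK by (simp add: algebra_simps)
    also have "K * \<kappa> = \<sigma> * n g" unfolding \<kappa>_def inner using K0 by simp
    also have "- (\<sigma> * s) * (\<sigma> * n g) + s * n g = s * n g * (1 - \<sigma> * \<sigma>)" by (simp add: algebra_simps)
    finally have bc: "c * m h + s * n h = 0" using \<sigma> by simp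
    have "(\<lambda>x. f x + 1 * e x) \<in> L2 M" by (rule L2_add_mult[OF g(1) e(1)])
    then have feL: "(\<lambda>x. f x + e x) \<in> L2 M" by simp
    have fh: "AE x in M. f x + e x = h x"
      using g(6) e(2) unfolding h_def \<kappa>_def by eventually_elim simp
    have kh: "AE x in M. k x = sl_tau S h x - z * h x"
      using g(7) dom_max_solution_add_mult[OF g(3) u(1,2), of \<kappa>] unfolding h_def by eventually_elim simp
    show ?thesis
      unfolding T1_def by (rule shift_realizationI[where P = "\<lambda>g. l g = 0 \<and> c * m g + s * n g = 0",
            OF feL g(2) h conjI[OF hv(1) bc] fh kh])
  qed
  have "(op_shift T1 z)\<inverse> = op_add ((op_shift T0 z)\<inverse>) (rank_one_op M (inverse K) v u)"
  proof (intro set_eqI iffI)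
    fix p assume "p \<in> (op_shift T1 z)\<inverse>"
    then obtain k h where p: "p = (k, h)" and hk: "(h, k) \<in> op_shift T1 z" by auto
    have L: "h \<in> L2 M" "k \<in> L2 M" using hk unfolding T1_def by (auto elim: shift_realizationE)
    obtain f where f: "(f, k) \<in> op_shift T0 z" using z0 L(2) unfolding resolvent_set_def by blast
    have fL: "f \<in> L2 M" using f unfolding T0_def by (rule shift_realizationE)
    define e where "e = (\<lambda>x. inverse K * L2_inner M v k * u x)"
    have "e \<in> L2 M" unfolding e_def by (rule L2_scale[OF uL])
    then have "(\<lambda>x. f x + e x, k) \<in> op_shift T1 z" by (rule key[OF f]) (simp add: e_def)
    then have "AE x in M. h x = f x + e x" by (rule inj[OF hk])
    then have "AE x in M. h x + (- 1) * f x = inverse K * L2_inner M v k * u x"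
      unfolding e_def by eventually_elim simp
    then have "(k, \<lambda>x. h x + (- 1) * f x) \<in> rank_one_op M (inverse K) v u"
      using L2_add_mult[OF L(1) fL, of "- 1"] L(2) unfolding rank_one_op_def by blast
    moreover have "(k, f) \<in> (op_shift T0 z)\<inverse>" using f by simp
    moreover have "p = (k, \<lambda>x. f x + (h x + (- 1) * f x))" unfolding p by simp
    ultimately have W: "p = (k, \<lambda>x. f x + (h x + (- 1) * f x)) \<and> (k, f) \<in> (op_shift T0 z)\<inverse> \<and>
        (k, \<lambda>x. h x + (- 1) * f x) \<in> rank_one_op M (inverse K) v u" by simp
    show "p \<in> op_add ((op_shift T0 z)\<inverse>) (rank_one_op M (inverse K) v u)"
      unfolding op_add_iff
      by (rule exI[of _ k], rule exI[of _ f], rule exI[of _ "\<lambda>x. h x + (- 1) * f x"], rule W)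
  next
    fix p assume "p \<in> op_add ((op_shift T0 z)\<inverse>) (rank_one_op M (inverse K) v u)"
    then obtain k f e where p: "p = (k, \<lambda>x. f x + e x)" and f: "(k, f) \<in> (op_shift T0 z)\<inverse>"
      and e: "(k, e) \<in> rank_one_op M (inverse K) v u"
      unfolding op_add_iff by (elim exE conjE) (rule that)
    have e': "e \<in> L2 M" "AE x in M. e x = inverse K * L2_inner M v k * u x"
      using e by (simp_all add: rank_one_op_def)
    have "(f, k) \<in> op_shift T0 z" using f by simp
    then have "(\<lambda>x. f x + e x, k) \<in> op_shift T1 z" by (rule key[OF _ e'])
    then show "p \<in> (op_shift T1 z)\<inverse>" unfolding p by simp
  qed
  then show ?thesis using K0 by blast
qed

lemma common_part_boundary:
  assumes l: "boundary_functional l" and m: "boundary_functional m" and n: "boundary_functional n"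
    and s: "s \<noteq> 0"
  shows "max_common_part M (realization (\<lambda>g. l g = 0 \<and> m g = 0))
      (realization (\<lambda>g. l g = 0 \<and> c * m g + s * n g = 0)) =
    realization (\<lambda>g. l g = 0 \<and> m g = 0 \<and> n g = 0)"
proof -
  have "max_common_part M (realization (\<lambda>g. l g = 0 \<and> m g = 0))
      (realization (\<lambda>g. l g = 0 \<and> c * m g + s * n g = 0)) =
    realization (\<lambda>g. (l g = 0 \<and> m g = 0) \<and> l g = 0 \<and> c * m g + s * n g = 0)"
  proof (rule common_part_realization)
    fix f g assume fg: "f \<in> dom_max S" "g \<in> dom_max S" "\<And>x. x \<in> X \<Longrightarrow> f x = g x"
      and Q: "l f = 0 \<and> c * m f + s * n f = 0"
    have "l f = l g" by (rule boundary_functionalD(2)[OF l fg])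
    moreover have "m f = m g" by (rule boundary_functionalD(2)[OF m fg])
    moreover have "n f = n g" by (rule boundary_functionalD(2)[OF n fg])
    ultimately show "l g = 0 \<and> c * m g + s * n g = 0" using Q by simp
  qed
  also have "(\<lambda>g. (l g = 0 \<and> m g = 0) \<and> l g = 0 \<and> c * m g + s * n g = 0) =
      (\<lambda>g. l g = 0 \<and> m g = 0 \<and> n g = 0)"
    using s by (auto simp: fun_eq_iff)
  finally show ?thesis .
qed

end

theorem theorem4p5:
  fixes S :: sl_expr
    and \<phi>a \<psi>a \<phi>b \<psi>b :: "real \<Rightarrow> complex"
    and T :: "real \<Rightarrow> real \<Rightarrow> l2op"
    and M :: "real measure"
    and u1 u2 :: "complex \<Rightarrow> real \<Rightarrow> complex"
  defines "M \<equiv> sl_measure S"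
    and "T \<equiv> T_sep S \<phi>a \<psi>a \<phi>b \<psi>b"
  assumes "sturm_liouville S"
    and "limit_circle_l S" and "limit_circle_r S"
    and "bc_basis_l S \<phi>a \<psi>a" and "bc_basis_r S \<phi>b \<psi>b"
    and u1: "\<And>z. z \<in> resolvent_set M (T 0 0) \<Longrightarrow>
          sl_solution S z (u1 z) \<and> bracket_l S (u1 z) \<phi>a = 0 \<and> bracket_r S (u1 z) \<phi>b = 1"
    and u2: "\<And>z. z \<in> resolvent_set M (T 0 0) \<Longrightarrow>
          sl_solution S z (u2 z) \<and> bracket_l S (u2 z) \<phi>a = 1 \<and> bracket_r S (u2 z) \<phi>b = 0"
  shows "(\<forall>\<beta>\<in>{0<..<pi}.
            max_common_part M (T 0 0) (T 0 \<beta>) =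
              op_restrict M (T_max S) {y \<in> dom_max S.
                bracket_l S y \<phi>a = 0 \<and> bracket_r S y \<phi>b = 0 \<and> bracket_r S y \<psi>b = 0} \<and>
            (\<forall>z \<in> resolvent_set M (T 0 0) \<inter> resolvent_set M (T 0 \<beta>).
               let K = - of_real (cot \<beta>) - bracket_r S (u1 z) \<psi>b
               in K \<noteq> 0 \<and>
                  (op_shift (T 0 \<beta>) z)\<inverse> =
                    op_add ((op_shift (T 0 0) z)\<inverse>) (rank_one_op M (inverse K) (u1 (cnj z)) (u1 z))))
       \<and> (\<forall>\<alpha>\<in>{0<..<pi}.
            max_common_part M (T 0 0) (T \<alpha> 0) =
              op_restrict M (T_max S) {y \<in> dom_max S.
                bracket_l S y \<phi>a = 0 \<and> bracket_r S y \<phi>b = 0 \<and> bracket_l S y \<psi>a = 0} \<and>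
            (\<forall>z \<in> resolvent_set M (T 0 0) \<inter> resolvent_set M (T \<alpha> 0).
               let K = of_real (cot \<alpha>) + bracket_l S (u2 z) \<psi>a
               in K \<noteq> 0 \<and>
                  (op_shift (T \<alpha> 0) z)\<inverse> =
                    op_add ((op_shift (T 0 0) z)\<inverse>) (rank_one_op M (inverse K) (u2 (cnj z)) (u2 z))))"
proof -
  interpret sl_problem S by unfold_locales (rule assms(3))
  note lc = solution_dom_max[OF assms(4,5)]
  have a: "\<phi>a \<in> dom_max S" "\<psi>a \<in> dom_max S" "\<And>x. x \<in> X \<Longrightarrow> \<phi>a x \<in> \<real>" "\<And>x. x \<in> X \<Longrightarrow> \<psi>a x \<in> \<real>"
      "bracket_l S \<psi>a \<phi>a = 1"
    and b: "\<phi>b \<in> dom_max S" "\<psi>b \<in> dom_max S" "\<And>x. x \<in> X \<Longrightarrow> \<phi>b x \<in> \<real>" "\<And>x. x \<in> X \<Longrightarrow> \<psi>b x \<in> \<real>"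
      "bracket_r S \<psi>b \<phi>b = 1"
    using assms(6,7) by (auto simp: bc_basis_l_def bc_basis_r_def)
  have El: "is_end (at_right (lend S))" and Er: "is_end (at_left (rend S))"
    by (auto simp: is_end_def)
  have la: "boundary_functional (\<lambda>g. bracket_l S g \<phi>a)" "boundary_functional (\<lambda>g. bracket_l S g \<psi>a)"
    unfolding bracket_l_bdry
    by (rule bdry_boundary_functional[OF El a(1)], erule a(3),
        rule bdry_boundary_functional[OF El a(2)], erule a(4))
  have rb: "boundary_functional (\<lambda>g. bracket_r S g \<phi>b)" "boundary_functional (\<lambda>g. bracket_r S g \<psi>b)"
    unfolding bracket_r_bdry
    by (rule bdry_boundary_functional[OF Er b(1)], erule b(3),
        rule bdry_boundary_functional[OF Er b(2)], erule b(4))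
  have T: "T \<alpha> \<beta> = realization (\<lambda>g.
      of_real (cos \<alpha>) * bracket_l S g \<phi>a + of_real (sin \<alpha>) * bracket_l S g \<psi>a = 0 \<and>
      of_real (cos \<beta>) * bracket_r S g \<phi>b + of_real (sin \<beta>) * bracket_r S g \<psi>b = 0)" for \<alpha> \<beta>
    unfolding T_def T_sep_def by (rule op_restrict_realization)
  have T00: "T 0 0 = realization (\<lambda>g. bracket_l S g \<phi>a = 0 \<and> bracket_r S g \<phi>b = 0)"
    unfolding T by simp
  have T00': "T 0 0 = realization (\<lambda>g. bracket_r S g \<phi>b = 0 \<and> bracket_l S g \<phi>a = 0)"
    unfolding T00 by (simp add: conj_commute)
  have T0b: "T 0 \<beta> = realization (\<lambda>g. bracket_l S g \<phi>a = 0 \<and>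
      of_real (cos \<beta>) * bracket_r S g \<phi>b + of_real (sin \<beta>) * bracket_r S g \<psi>b = 0)" for \<beta>
    unfolding T by simp
  have Ta0: "T \<alpha> 0 = realization (\<lambda>g. bracket_r S g \<phi>b = 0 \<and>
      of_real (cos \<alpha>) * bracket_l S g \<phi>a + of_real (sin \<alpha>) * bracket_l S g \<psi>a = 0)" for \<alpha>
    unfolding T by (simp add: conj_commute)
  \<comment> \<open>Only for points of the resolvent set do \<open>u1\<close> and \<open>u2\<close> carry information, and the formulas
    involve them at the conjugate of \<open>z\<close>.\<close>
  have cnj_z: "cnj z \<in> resolvent_set M (T 0 0)" if "z \<in> resolvent_set M (T 0 0)" for z
    using that unfolding T00 M_def
    by (rule resolvent_set_cnj[rotated]) (simp add: boundary_functionalD(3)[OF la(1)] boundary_functionalD(3)[OF rb(1)])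
  \<comment> \<open>At each endpoint, one of the two bracket products disappears when the boundary conditions of
    \<open>T 0 0\<close> are inserted.\<close>
  have pl: "bracket_l S f v = bracket_l S f \<psi>a * cnj (bracket_l S v \<phi>a) - bracket_l S f \<phi>a * cnj (bracket_l S v \<psi>a)"
    if "f \<in> dom_max S" "v \<in> dom_max S" for f v
    using bdry_pluecker[OF El that a(1,3,2,4)] a(5) unfolding bracket_l_bdry by blast
  have pr: "bracket_r S f v = bracket_r S f \<psi>b * cnj (bracket_r S v \<phi>b) - bracket_r S f \<phi>b * cnj (bracket_r S v \<psi>b)"
    if "f \<in> dom_max S" "v \<in> dom_max S" for f v
    using bdry_pluecker[OF Er that b(1,3,2,4)] b(5) unfolding bracket_r_bdry by blast
  show ?thesis
  proof (intro conjI ballI)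
    fix \<beta> assume "\<beta> \<in> {0<..<pi}"
    then have s: "complex_of_real (sin \<beta>) \<noteq> 0" using sin_gt_zero[of \<beta>] by simp
    show "max_common_part M (T 0 0) (T 0 \<beta>) = op_restrict M (T_max S) {y \<in> dom_max S.
        bracket_l S y \<phi>a = 0 \<and> bracket_r S y \<phi>b = 0 \<and> bracket_r S y \<psi>b = 0}"
      unfolding T00 M_def op_restrict_realization
      unfolding T0b
      by (rule common_part_boundary[OF la(1) rb(1) rb(2) s])
    fix z assume z: "z \<in> resolvent_set M (T 0 0) \<inter> resolvent_set M (T 0 \<beta>)"
    then have z0: "z \<in> resolvent_set M (T 0 0)" and z1: "z \<in> resolvent_set M (T 0 \<beta>)" by auto
    note u = u1[OF z0] and v = u1[OF cnj_z[OF z0]]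
    define K where "K = - of_real (cot \<beta>) - bracket_r S (u1 z) \<psi>b"
    have "K \<noteq> 0 \<and> (op_shift (T 0 \<beta>) z)\<inverse> =
        op_add ((op_shift (T 0 0) z)\<inverse>) (rank_one_op M (inverse K) (u1 (cnj z)) (u1 z))"
      unfolding T00 M_def
      unfolding T0b
    proof (rule krein_resolvent_formula[where \<sigma> = 1, OF la(1) rb(1) rb(2) s])
      show "z \<in> resolvent_set (sl_measure S) (realization (\<lambda>g. bracket_l S g \<phi>a = 0 \<and> bracket_r S g \<phi>b = 0))"
        using z0 unfolding T00 M_def .
      show "z \<in> resolvent_set (sl_measure S) (realization (\<lambda>g. bracket_l S g \<phi>a = 0 \<and>
          of_real (cos \<beta>) * bracket_r S g \<phi>b + of_real (sin \<beta>) * bracket_r S g \<psi>b = 0))"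
        using z1 unfolding T0b M_def .
      show "u1 z \<in> dom_max S" "AE x in sl_measure S. sl_tau S (u1 z) x = z * u1 z x"
        "u1 (cnj z) \<in> dom_max S" "AE x in sl_measure S. sl_tau S (u1 (cnj z)) x = cnj z * u1 (cnj z) x"
        using lc u v by blast+
      fix f assume f: "f \<in> dom_max S" "bracket_l S f \<phi>a = 0" "bracket_r S f \<phi>b = 0"
      have vD: "u1 (cnj z) \<in> dom_max S" using lc v by blast
      show "(LINT x|sl_measure S. sl_tau S f x * cnj (u1 (cnj z) x) - f x * cnj (sl_tau S (u1 (cnj z)) x)) =
          1 * bracket_r S f \<psi>b"
        unfolding green[OF f(1) vD, symmetric] pl[OF f(1) vD] pr[OF f(1) vD] using f v by simp
    qed (use u in \<open>simp_all add: K_def cot_def\<close>)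
    then show "let K = - of_real (cot \<beta>) - bracket_r S (u1 z) \<psi>b in K \<noteq> 0 \<and>
        (op_shift (T 0 \<beta>) z)\<inverse> =
        op_add ((op_shift (T 0 0) z)\<inverse>) (rank_one_op M (inverse K) (u1 (cnj z)) (u1 z))"
      unfolding K_def Let_def .
  next
    fix \<alpha> assume "\<alpha> \<in> {0<..<pi}"
    then have s: "complex_of_real (sin \<alpha>) \<noteq> 0" using sin_gt_zero[of \<alpha>] by simp
    show "max_common_part M (T 0 0) (T \<alpha> 0) = op_restrict M (T_max S) {y \<in> dom_max S.
        bracket_l S y \<phi>a = 0 \<and> bracket_r S y \<phi>b = 0 \<and> bracket_l S y \<psi>a = 0}"
      unfolding T00' M_def op_restrict_realization
      unfolding Ta0
      using common_part_boundary[OF rb(1) la(1) la(2) s, of "of_real (cos \<alpha>)"]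
      by (simp add: conj_left_commute)
    fix z assume z: "z \<in> resolvent_set M (T 0 0) \<inter> resolvent_set M (T \<alpha> 0)"
    then have z0: "z \<in> resolvent_set M (T 0 0)" and z1: "z \<in> resolvent_set M (T \<alpha> 0)" by auto
    note u = u2[OF z0] and v = u2[OF cnj_z[OF z0]]
    define K where "K = of_real (cot \<alpha>) + bracket_l S (u2 z) \<psi>a"
    have "K \<noteq> 0 \<and> (op_shift (T \<alpha> 0) z)\<inverse> =
        op_add ((op_shift (T 0 0) z)\<inverse>) (rank_one_op M (inverse K) (u2 (cnj z)) (u2 z))"
      unfolding T00' M_def
      unfolding Ta0
    proof (rule krein_resolvent_formula[where \<sigma> = "- 1", OF rb(1) la(1) la(2) s])
      show "z \<in> resolvent_set (sl_measure S) (realization (\<lambda>g. bracket_r S g \<phi>b = 0 \<and> bracket_l S g \<phi>a = 0))"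
        using z0 unfolding T00' M_def .
      show "z \<in> resolvent_set (sl_measure S) (realization (\<lambda>g. bracket_r S g \<phi>b = 0 \<and>
          of_real (cos \<alpha>) * bracket_l S g \<phi>a + of_real (sin \<alpha>) * bracket_l S g \<psi>a = 0))"
        using z1 unfolding Ta0 M_def .
      show "u2 z \<in> dom_max S" "AE x in sl_measure S. sl_tau S (u2 z) x = z * u2 z x"
        "u2 (cnj z) \<in> dom_max S" "AE x in sl_measure S. sl_tau S (u2 (cnj z)) x = cnj z * u2 (cnj z) x"
        using lc u v by blast+
      fix f assume f: "f \<in> dom_max S" "bracket_r S f \<phi>b = 0" "bracket_l S f \<phi>a = 0"
      have vD: "u2 (cnj z) \<in> dom_max S" using lc v by blast
      show "(LINT x|sl_measure S. sl_tau S f x * cnj (u2 (cnj z) x) - f x * cnj (sl_tau S (u2 (cnj z)) x)) =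
          - 1 * bracket_l S f \<psi>a"
        unfolding green[OF f(1) vD, symmetric] pl[OF f(1) vD] pr[OF f(1) vD] using f v by simp
    qed (use u in \<open>simp_all add: K_def cot_def\<close>)
    then show "let K = of_real (cot \<alpha>) + bracket_l S (u2 z) \<psi>a in K \<noteq> 0 \<and>
        (op_shift (T \<alpha> 0) z)\<inverse> =
        op_add ((op_shift (T 0 0) z)\<inverse>) (rank_one_op M (inverse K) (u2 (cnj z)) (u2 z))"
      unfolding K_def Let_def .
  qed
qed

end
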